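(* There are universal constants $c>0$ and $c'>0$ such that for every sufficiently large $n$ and every $t\geq 1$, every array $A\in\{0,1\}^n$ can be preprocessed into a data structure in the word RAM with word size $w=\Theta(\log n)$ that occupies \[ n+\frac{n}{(\log n)^{c' t}}+n^{1-c} \] bits of memory and answers every rank query $\mathrm{rank}(u)=\sum_{i=0}^{u-1}A[i]$, $0\le u\le n$, in $O(t)$ time.
   Context: The word RAM with word size $w$: memory consists of $w$-bit words and the query algorithm may use only the standard word operations, each in constant time. *)

theory Defs
  imports Complex_Main "HOL-Library.Landau_Symbols"
begin

text \<open>
  Word RAM with word size \<open>w\<close>. A word is a natural number below \<open>2 ^ w\<close>; the word size is a run-time
  parameter, so it cannot be a type index. A program is a finite list of instructions over word-sized
  registers. Every executed instruction costs one time unit.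
\<close>

datatype word_op = Add | Sub | Mul | Div | Mod | And | Or | Xor | Shl | Shr

text \<open>
  Arithmetic is modulo \<open>2 ^ w\<close>. Division is unsigned, with \<open>x div 0 = 0\<close> and \<open>x mod 0 = x\<close>.
\<close>

context
  includes bit_operations_syntax
begin

fun apply_op :: "nat \<Rightarrow> word_op \<Rightarrow> nat \<Rightarrow> nat \<Rightarrow> nat" where
  "apply_op w Add x y = (x + y) mod 2 ^ w"
| "apply_op w Sub x y = (x + 2 ^ w - y) mod 2 ^ w"
| "apply_op w Mul x y = (x * y) mod 2 ^ w"
| "apply_op w Div x y = x div y"
| "apply_op w Mod x y = x mod y"
| "apply_op w And x y = x AND y"
| "apply_op w Or x y = x OR y"
| "apply_op w Xor x y = x XOR y"
| "apply_op w Shl x y = push_bit y x mod 2 ^ w"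
| "apply_op w Shr x y = drop_bit y x"

end

text \<open>
  Registers are named by natural numbers. In \<open>Load d a\<close> and \<open>Store a s\<close>, \<open>a\<close> is the register holding
  the address. Jump targets are absolute positions in the program.
\<close>

datatype instr =
    Const nat nat
  | Move nat nat
  | Op word_op nat nat nat
  | Not nat nat
  | Load nat nat
  | Store nat nat
  | Jump nat
  | JumpEq nat nat nat
  | JumpLess nat nat nat
  | Halt

record config =
  pc :: nat
  regs :: "nat \<Rightarrow> nat"
  mem :: "nat list"

definition set_reg :: "nat \<Rightarrow> nat \<Rightarrow> config \<Rightarrow> config" where
  "set_reg d x s = s\<lparr>pc := Suc (pc s), regs := (regs s)(d := x)\<rparr>"

text \<open>
  The memory consists of exactly the \<open>length (mem s)\<close> words that are charged for; accessing any other
  address is an error (\<open>None\<close>). So no uncharged scratch memory exists apart from the registers, of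
  which a program uses only a fixed finite number.
\<close>

fun step :: "nat \<Rightarrow> instr \<Rightarrow> config \<Rightarrow> config option" where
  "step w (Const d k) s = Some (set_reg d (k mod 2 ^ w) s)"
| "step w (Move d a) s = Some (set_reg d (regs s a) s)"
| "step w (Op f d a b) s = Some (set_reg d (apply_op w f (regs s a) (regs s b)) s)"
| "step w (Not d a) s = Some (set_reg d (2 ^ w - 1 - regs s a) s)"
| "step w (Load d a) s =
     (if regs s a < length (mem s) then Some (set_reg d (mem s ! regs s a) s) else None)"
| "step w (Store a b) s =
     (if regs s a < length (mem s)
      then Some (s\<lparr>pc := Suc (pc s), mem := (mem s)[regs s a := regs s b]\<rparr>) else None)"
| "step w (Jump l) s = Some (s\<lparr>pc := l\<rparr>)"
| "step w (JumpEq a b l) s = Some (s\<lparr>pc := (if regs s a = regs s b then l else Suc (pc s))\<rparr>)"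
| "step w (JumpLess a b l) s = Some (s\<lparr>pc := (if regs s a < regs s b then l else Suc (pc s))\<rparr>)"
| "step w Halt s = None"

text \<open>
  The configuration in which the program halts if it does so in at most the given number of time
  units; \<open>None\<close> if it does not, or if it runs into an error.
\<close>

fun run :: "nat \<Rightarrow> instr list \<Rightarrow> nat \<Rightarrow> config \<Rightarrow> config option" where
  "run w P 0 s = None"
| "run w P (Suc k) s =
     (if pc s < length P
      then if P ! pc s = Halt then Some s
           else (case step w (P ! pc s) s of None \<Rightarrow> None | Some s' \<Rightarrow> run w P k s')
      else None)"

text \<open>
  On query \<open>x\<close> (passed in register 0, all other registers being zero) the program returns \<open>y\<close> in
  register 0 within time \<open>k\<close>. It may write to the memory \<open>M\<close>, but must leave the data structure
  intact for later queries.
\<close>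

definition answers_within :: "nat \<Rightarrow> instr list \<Rightarrow> nat list \<Rightarrow> nat \<Rightarrow> nat \<Rightarrow> nat \<Rightarrow> bool" where
  "answers_within w P M k x y \<longleftrightarrow>
     (\<exists>s. run w P k \<lparr>pc = 0, regs = (\<lambda>_. 0)(0 := x), mem = M\<rparr> = Some s \<and>
          regs s 0 = y \<and> mem s = M)"

definition memories :: "nat \<Rightarrow> nat list set" where
  "memories w = {M. \<forall>x \<in> set M. x < 2 ^ w}"

definition space_bits :: "nat \<Rightarrow> nat list \<Rightarrow> nat" where
  "space_bits w M = w * length M"

definition bit_arrays :: "nat \<Rightarrow> nat list set" where
  "bit_arrays n = {A. length A = n \<and> set A \<subseteq> {0, 1}}"

definition rank :: "nat list \<Rightarrow> nat \<Rightarrow> nat" where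
  "rank A u = (\<Sum>i<u. A ! i)"

text \<open>
  Word sizes \<open>w = \<Theta>(log n)\<close>, with the usual word RAM convention that a word can hold an index into
  the input, that is, any query argument \<open>0 \<le> u \<le> n\<close>.
\<close>

definition log_word_size :: "(nat \<Rightarrow> nat) \<Rightarrow> bool" where
  "log_word_size w \<longleftrightarrow>
     (\<lambda>n. real (w n)) \<in> \<Theta>(\<lambda>n. log 2 (real n)) \<and>
     (\<forall>\<^sub>F n in sequentially. n < 2 ^ w n)"

end

theory Submission
  imports Defs "HOL-Real_Asymp.Real_Asymp"
begin

text \<open>
  The array is cut into blocks of \<open>S = g B\<^sup>H\<close> bits, \<open>B \<approx> \<surd>(log n)\<close>, \<open>g = \<Theta>(log n)\<close>; a block is the root of a
  \<open>B\<close>-ary tree of height \<open>H = O(t)\<close>. A string of \<open>S_h = g B\<^sup>h\<close> bits with \<open>x\<close> ones is coded by \<open>B\<^sup>h - 1\<close> cells of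
  \<open>g\<close> bits and a spill \<open>k < K_h x\<close>, where \<open>K_h x\<close> exceeds \<open>2\<^sup>g (S_h choose x) / 2\<^bsup>S_h\<^esup>\<close> by an
  additive \<open>2\<^bsup>-\<Omega>(g)\<^esup>\<close> fraction of \<open>2\<^sup>g\<close> only. Allowing this additive error is what makes all codes of a level
  equally long, even for atypical strings, so that children are stored at fixed addresses. A block then costs
  \<open>S\<close> bits plus \<open>O(1)\<close> words, which is \<open>n / (log n)\<^sup>t\<close> bits in total.

  The work is to code the spills \<open>(x_j, k_j)\<close> of \<open>B\<close> children so that one of them and the prefix sum in front of
  it can be read with \<open>O(1)\<close> probes, although the \<open>B\<close> prefix sums together do not fit into \<open>O(1)\<close> words. Let \<open>L\<close>
  be slightly below \<open>\<surd>S\<close> and cut the range of prefix sums into windows of length \<open>L\<close>. For positions \<open>s\<close>, \<open>t\<close> inside two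
  windows at distance \<open>v\<close>,
  \<open>S choose (v L + t - s)\<close> is an explicit sum of products \<open>a(s) b(t)\<close> of nonnegative functions whose terms decay
  geometrically, so that few of them suffice. Hence \<open>k_j\<close> amounts to a type (\<open>v\<close> and the number of the term)
  and two numbers, one attached to either neighbouring prefix sum. The list of types has \<open>o(g)\<close> bits and joins the
  spill of the parent; given the types, the data attached to different prefix sums are independent, and they
  are chained into cells of exactly \<open>g\<close> bits, each passing its excess on to the next cell.

  All steps of a query are computed by table lookup, so the program only follows a finite automaton.
\<close>

section \<open>Codes of a node of the tree\<close>

text \<open>All sizes are powers of \<open>2 ^ q\<close> with \<open>q\<close> close to
  \<open>log n / 400\<close> and \<open>g = 32 * q\<close>. The two parts of a spill get about
  \<open>16 * q\<close> bits each; the resulting rounding errors stay below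
  \<open>2 ^ (20 * q)\<close> and disappear in the additive error \<open>e * e\<close>. The obstacle
  is the growth of this error from level to level. One node turns \<open>e * e\<close> into about
  \<open>9 * B * (e * e)\<close>, which \<open>e = 2 ^ (10 * q) * (3 * B) ^ h\<close> survives
  because \<open>B ^ H\<close> is at most \<open>2 ^ q\<close>. A further factor of the number of
  windows at every level would not fit; hence a window is stored only where it follows from neither
  end. \<open>B\<close> is a compromise: a list of \<open>B\<close> types, each from a set
  polynomial in \<open>q\<close>, has to fit into \<open>q\<close> bits, while \<open>B ^ 3\<close>
  has to exceed \<open>log n\<close>, so that height \<open>3 * (t + 2)\<close> gives blocks of
  \<open>(log n) powr (t + 2)\<close> bits; the two extra factors pay for the words spent per block.
  For large \<open>t\<close> the height is capped to keep \<open>S\<close> below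
  \<open>2 ^ q\<close>. Then \<open>S\<close> is \<open>n powr (1 / 400)\<close> up to logarithms,
  and the loss moves into the term \<open>n powr (1 - c)\<close>, which also pays for tables of
  about \<open>2 ^ (326 * q)\<close> words.\<close>

definition idx :: "'a set \<Rightarrow> 'a \<Rightarrow> nat" where
  "idx A = (SOME f. bij_betw f A {..<card A})"

definition elt :: "'a set \<Rightarrow> nat \<Rightarrow> 'a" where
  "elt A = the_inv_into A (idx A)"

lemma idx_bij: "finite A \<Longrightarrow> bij_betw (idx A) A {..<card A}"
  unfolding idx_def using ex_bij_betw_finite_nat[of A]
  by (metis (mono_tags, lifting) atLeast0LessThan someI_ex)

lemma idx_less: "finite A \<Longrightarrow> x \<in> A \<Longrightarrow> idx A x < card A"
  using idx_bij[of A] by (auto simp: bij_betw_def)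

lemma idx_inject: "finite A \<Longrightarrow> x \<in> A \<Longrightarrow> y \<in> A \<Longrightarrow> idx A x = idx A y \<Longrightarrow> x = y"
  using idx_bij[of A] by (auto simp: bij_betw_def inj_on_def)

lemma elt_in: "finite A \<Longrightarrow> k < card A \<Longrightarrow> elt A k \<in> A"
  unfolding elt_def using idx_bij[of A]
  by (metis bij_betw_def bij_betw_the_inv_into bij_betwE lessThan_iff)

lemma idx_elt: "finite A \<Longrightarrow> k < card A \<Longrightarrow> idx A (elt A k) = k"
  unfolding elt_def using idx_bij[of A]
  by (metis bij_betw_def f_the_inv_into_f lessThan_iff)

lemma elt_idx: "finite A \<Longrightarrow> x \<in> A \<Longrightarrow> elt A (idx A x) = x"
  unfolding elt_def using idx_bij[of A]
  by (metis bij_betw_def the_inv_into_f_f)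

text \<open>
  \<open>T\<close> is the set of types \<open>\<tau>\<close> of a child; \<open>off \<tau>\<close> is the distance of the windows of the prefix sums in front
  of and behind the child, and \<open>a \<tau> s\<close>, \<open>b \<tau> t\<close> are the sizes of the two parts of its spill when these prefix
  sums lie at \<open>s\<close> and \<open>t\<close> inside their windows. A further type \<open>None\<close>, with \<open>e\<close> in place of \<open>a\<close> and \<open>b\<close>,
  absorbs whatever is not covered by \<open>T\<close>; it leaves the distance of the windows open.
\<close>

locale chain =
  fixes q S B L e :: nat and T :: "'t set" and off :: "'t \<Rightarrow> nat" and a b :: "'t \<Rightarrow> nat \<Rightarrow> nat"
    and K :: "nat \<Rightarrow> nat"
  assumes q_ge: "16 \<le> q" and B_ge: "2 \<le> B" and L_pos: "1 \<le> L" and L_le: "L \<le> S"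
    and SB: "8 * B * S \<le> 2 ^ q" and B32: "32 ^ B \<le> (2::nat) ^ q"
    and T_fin: "finite T" and T_card: "(card T + 1) ^ B \<le> 2 ^ q"
    and a_pos: "\<And>\<tau> s. \<tau> \<in> T \<Longrightarrow> 1 \<le> a \<tau> s"
    and a_le: "\<And>\<tau> s. \<tau> \<in> T \<Longrightarrow> s < L \<Longrightarrow> a \<tau> s \<le> 2 ^ (16 * q + 2)"
    and b_le: "\<And>\<tau> s. \<tau> \<in> T \<Longrightarrow> s < L \<Longrightarrow> b \<tau> s \<le> 2 ^ (16 * q + 2)"
    and ab_le: "\<And>\<tau> \<tau>'. \<tau> \<in> T \<Longrightarrow> \<tau>' \<in> T \<Longrightarrow> (\<Sum>s<L. b \<tau> s * a \<tau>' s) \<le> 2 ^ (32 * q + 3)"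
    and e_ge: "2 ^ (10 * q) \<le> e" and e_le: "e \<le> 2 ^ (12 * q)"
    and off_ge: "\<And>\<tau>. \<tau> \<in> T \<Longrightarrow> L \<le> off \<tau> * L + 1"
    and off_card: "card (off ` T) * L \<le> 2 ^ q"
    and cover: "\<And>v s t. s < L \<Longrightarrow> t < L \<Longrightarrow> s \<le> v * L + t \<Longrightarrow> v * L + t - s \<le> S \<Longrightarrow>
       K (v * L + t - s) \<le> (\<Sum>\<tau>\<in>{\<tau>\<in>T. off \<tau> = v}. a \<tau> s * b \<tau> t) + e * e"
    and upper: "\<And>v s t. v \<in> off ` T \<Longrightarrow> s < L \<Longrightarrow> t < L \<Longrightarrow>
       real (\<Sum>\<tau>\<in>{\<tau>\<in>T. off \<tau> = v}. a \<tau> s * b \<tau> t)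
         \<le> 2 ^ (32 * q) * real (S choose (v * L + t - s)) / 2 ^ S + 2 ^ (20 * q)"
begin

primrec aa :: "'t option \<Rightarrow> nat \<Rightarrow> nat" where
  "aa None s = e" | "aa (Some \<tau>) s = a \<tau> s"

primrec bb :: "'t option \<Rightarrow> nat \<Rightarrow> nat" where
  "bb None s = e" | "bb (Some \<tau>) s = b \<tau> s"

definition nI :: nat where "nI = B * S + 1"

definition Ty :: "'t option set" where "Ty = insert None (Some ` T)"

definition TL :: "nat \<Rightarrow> 't option list set" where
  "TL i = {\<kappa>. length \<kappa> = i \<and> set \<kappa> \<subseteq> Ty}"

text \<open>The spill of a child is coded by an element of this set when its two prefix sums lie at
  \<open>s\<close> and \<open>t\<close> in windows at distance \<open>v\<close>;
  \<open>cover\<close> makes the set large enough.\<close>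

definition KS :: "nat \<Rightarrow> nat \<Rightarrow> nat \<Rightarrow> ('t option \<times> nat \<times> nat) set" where
  "KS v s t = (SIGMA \<tau>:insert None (Some ` {\<tau>\<in>T. off \<tau> = v}). {..<aa \<tau> s} \<times> {..<bb \<tau> t})"

text \<open>
  Lists of types are reversed: the head belongs to the last child. The window of a prefix sum follows from the
  types alone as long as no \<open>None\<close> comes before it, and from the total sum if no \<open>None\<close> comes after it. Between two
  occurrences of \<open>None\<close> it has to be stored, which is done in the slot at the second one.
\<close>

definition slot :: "'t option list \<Rightarrow> 't option \<Rightarrow> bool" where
  "slot \<kappa> \<tau> \<longleftrightarrow> \<tau> = None \<and> None \<in> set \<kappa>"

text \<open>The item attached to the prefix sum between the children \<open>\<kappa>\<close> and a
  child of type \<open>\<tau>\<close>: its place \<open>s\<close> in its window, the part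
  \<open>b\<close> of the child before, the part \<open>a\<close> of the child behind, and the
  window if it has to be stored. As both parts are sized by the same \<open>s\<close>, the item
  comes from a disjoint union over \<open>s\<close>, which loses nothing.\<close>

definition ZS :: "'t option list \<Rightarrow> 't option \<Rightarrow> (nat \<times> nat \<times> nat \<times> nat) set" where
  "ZS \<kappa> \<tau> = (SIGMA s:{..<L}. {..<bb (hd \<kappa>) s} \<times> {..<aa \<tau> s} \<times> {..<(if slot \<kappa> \<tau> then nI else 1)})"

text \<open>
  \<open>Y \<kappa>\<close> bounds the excess passed on by the cells of the children in \<open>\<kappa>\<close>: if an item from a set of size \<open>z\<close> is
  added to an excess below \<open>y\<close>, the cell takes the excess and the item modulo \<open>C = 2\<^sup>g div y\<close>, and the quotient,
  at most \<open>z div C\<close>, is the new excess.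
\<close>

fun Y :: "'t option list \<Rightarrow> nat" where
  "Y [] = 1"
| "Y [\<tau>] = aa \<tau> 0"
| "Y (\<tau> # \<tau>' # \<kappa>) = card (ZS (\<tau>' # \<kappa>) \<tau>) div (2 ^ (32 * q) div Y (\<tau>' # \<kappa>)) + 1"

definition osum :: "'t option list \<Rightarrow> nat" where
  "osum \<kappa> = sum_list (map (\<lambda>\<tau>. off (the \<tau>)) \<kappa>)"

text \<open>The spills of a parent with sum \<open>N\<close>: all types, the excess of the last
  cell, and the part \<open>b\<close> of the last child, whose place \<open>N mod L\<close> is
  known. Forcing the offsets to add up to \<open>N div L\<close> is what leaves a single binomial
  coefficient in the count.\<close>

definition FS :: "nat \<Rightarrow> ('t option list \<times> nat \<times> nat) set" where
  "FS N = (SIGMA \<kappa>:{\<kappa>\<in>TL B. None \<notin> set \<kappa> \<longrightarrow> osum \<kappa> = N div L}. {..<Y \<kappa>} \<times> {..<bb (hd \<kappa>) (N mod L)})"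

lemma S_pos: "1 \<le> S" using L_pos L_le by simp

lemma Ty_fin[simp]: "finite Ty" by (simp add: Ty_def T_fin)

lemma card_Ty: "card Ty = card T + 1"
  by (simp add: Ty_def T_fin card_image)

lemma TL_fin[simp]: "finite (TL i)"
  using finite_lists_length_eq[OF Ty_fin, of i] by (simp add: TL_def conj_commute)

lemma card_TL: "card (TL i) = (card T + 1) ^ i"
  using card_lists_length_eq[OF Ty_fin, of i] by (simp add: TL_def conj_commute card_Ty)

lemma KS_fin[simp]: "finite (KS v s t)"
  using T_fin by (simp add: KS_def)

lemma ZS_fin[simp]: "finite (ZS \<kappa> \<tau>)"
  by (simp add: ZS_def)

lemma FS_fin[simp]: "finite (FS N)"
  by (simp add: FS_def)

lemma card_KS: "card (KS v s t) = (\<Sum>\<tau>\<in>{\<tau>\<in>T. off \<tau> = v}. a \<tau> s * b \<tau> t) + e * e"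
proof -
  have "card (KS v s t) = (\<Sum>\<tau>\<in>insert None (Some ` {\<tau>\<in>T. off \<tau> = v}). aa \<tau> s * bb \<tau> t)"
    using T_fin by (simp add: KS_def card_cartesian_product)
  also have "\<dots> = e * e + (\<Sum>\<tau>\<in>Some ` {\<tau>\<in>T. off \<tau> = v}. aa \<tau> s * bb \<tau> t)"
    using T_fin by (subst sum.insert) auto
  also have "(\<Sum>\<tau>\<in>Some ` {\<tau>\<in>T. off \<tau> = v}. aa \<tau> s * bb \<tau> t) = (\<Sum>\<tau>\<in>{\<tau>\<in>T. off \<tau> = v}. a \<tau> s * b \<tau> t)"
    by (subst sum.reindex) auto
  finally show ?thesis by simp
qed

lemma card_ZS: "card (ZS \<kappa> \<tau>) = (\<Sum>s<L. bb (hd \<kappa>) s * aa \<tau> s) * (if slot \<kappa> \<tau> then nI else 1)"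
  by (simp add: ZS_def card_cartesian_product sum_distrib_right mult.assoc)

lemma e_pos: "1 \<le> e" using e_ge by (meson le_trans one_le_numeral one_le_power)

lemma aa_pos: "\<tau> \<in> Ty \<Longrightarrow> 1 \<le> aa \<tau> s"
  using a_pos e_pos by (auto simp: Ty_def)

lemma e_le': "e \<le> 2 ^ (16 * q + 2)"
  by (rule order_trans[OF e_le]) (rule power_increasing, auto)

lemma aa_le: "\<tau> \<in> Ty \<Longrightarrow> s < L \<Longrightarrow> aa \<tau> s \<le> 2 ^ (16 * q + 2)"
  and bb_le: "\<tau> \<in> Ty \<Longrightarrow> s < L \<Longrightarrow> bb \<tau> s \<le> 2 ^ (16 * q + 2)"
  using a_le b_le e_le' by (auto simp: Ty_def)

lemma BS_le: "B * S + 1 \<le> 2 ^ q"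
proof -
  have "B * 1 \<le> B * S" using S_pos by (rule mult_le_mono2)
  thus ?thesis using SB B_ge by linarith
qed

lemma L_q: "L \<le> 2 ^ q" and B_q: "8 * B \<le> 2 ^ q"
proof -
  have "L \<le> B * S + 1" using L_le B_ge by (metis One_nat_def Suc_1 Suc_leD le_trans mult.commute mult_le_mono2 nat_mult_1_right trans_le_add1)
  thus "L \<le> 2 ^ q" using BS_le by simp
  have "8 * B * 1 \<le> 8 * B * S" using S_pos by (intro mult_le_mono2)
  thus "8 * B \<le> 2 ^ q" using SB by linarith
qed

lemma L_nI: "L * nI \<le> 2 ^ (2 * q)"
proof -
  have "L * nI \<le> 2 ^ q * 2 ^ q" using L_q BS_le by (intro mult_le_mono) (auto simp: nI_def)
  thus ?thesis by (simp add: power_add[symmetric] mult_2)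
qed

text \<open>Two proper types are handled by \<open>ab_le\<close>. If \<open>None\<close> occurs on
  either side, one factor is at most \<open>2 ^ (12 * q)\<close> instead of
  \<open>2 ^ (16 * q + 2)\<close>, and this gain pays for \<open>L * nI\<close>, which is at most
  \<open>2 ^ (2 * q)\<close>.\<close>

lemma ZS_le:
  assumes "set \<kappa> \<subseteq> Ty" "\<kappa> \<noteq> []" "\<tau> \<in> Ty"
  shows "card (ZS \<kappa> \<tau>) \<le> 2 ^ (32 * q + 3)"
proof -
  have h: "hd \<kappa> \<in> Ty" using assms by (cases \<kappa>) auto
  show ?thesis
  proof (cases "hd \<kappa> = None \<or> \<tau> = None")
    case False
    then obtain x y where "hd \<kappa> = Some x" "\<tau> = Some y" "x \<in> T" "y \<in> T"
      using h assms(3) by (auto simp: Ty_def)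
    thus ?thesis using ab_le[of x y] by (simp add: card_ZS slot_def)
  next
    case True
    have "(\<Sum>s<L. bb (hd \<kappa>) s * aa \<tau> s) \<le> (\<Sum>s<L. 2 ^ (12 * q) * 2 ^ (16 * q + 2))"
    proof (rule sum_mono)
      fix s assume "s \<in> {..<L}"
      hence s: "s < L" by simp
      show "bb (hd \<kappa>) s * aa \<tau> s \<le> 2 ^ (12 * q) * 2 ^ (16 * q + 2)"
      proof (cases "\<tau> = None")
        case N: True
        thus ?thesis using mult_le_mono[OF e_le bb_le[OF h s]] by (simp add: mult.commute)
      next
        case False
        hence "hd \<kappa> = None" using True by blast
        thus ?thesis using mult_le_mono[OF e_le aa_le[OF assms(3) s]] by (simp add: mult.commute)
      qed
    qed
    also have "\<dots> = L * 2 ^ (28 * q + 2)" by (simp add: power_add[symmetric])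
    finally have "card (ZS \<kappa> \<tau>) \<le> (L * 2 ^ (28 * q + 2)) * nI"
      unfolding card_ZS by (intro mult_le_mono) (auto simp: nI_def)
    also have "\<dots> = (L * nI) * 2 ^ (28 * q + 2)" by simp
    also have "\<dots> \<le> 2 ^ (2 * q) * 2 ^ (28 * q + 2)" using L_nI by (rule mult_le_mono1)
    also have "\<dots> = 2 ^ (30 * q + 2)" by (simp add: power_add[symmetric])
    also have "\<dots> \<le> 2 ^ (32 * q + 3)" by (rule power_increasing) auto
    finally show ?thesis .
  qed
qed

lemma Y_pos: "set \<kappa> \<subseteq> Ty \<Longrightarrow> 1 \<le> Y \<kappa>"
  by (induction \<kappa> rule: Y.induct) (use aa_pos in auto)

text \<open>The price of the floor in \<open>C = G div Yv\<close>: since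
  \<open>C > G / Yv - 1\<close> and \<open>C \<ge> G / (2 * Yv)\<close>, the reciprocal of
  \<open>C\<close> exceeds \<open>Yv / G\<close> by at most
  \<open>2 * (Yv / G)\<^sup>2\<close>.\<close>

lemma div_bounds:
  fixes Yv Z G :: nat
  assumes Y: "1 \<le> Yv" "2 * Yv \<le> G"
  shows "real (Z div (G div Yv) + 1) \<le> real Yv * real Z / real G + 2 * real Z * (real Yv)\<^sup>2 / (real G)\<^sup>2 + 1"
proof -
  define C where "C = G div Yv"
  have C2: "2 \<le> C" unfolding C_def using Y by (simp add: less_eq_div_iff_mult_less_eq mult.commute)
  have GC: "G < Yv * C + Yv" unfolding C_def using Y
    by (metis Suc_le_eq add.commute dividend_less_times_div mult.commute mult_Suc_right One_nat_def)
  have rC: "real G / real Yv - 1 < real C" "real C > 0" "real Yv > 0" "real G > 0"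
  proof -
    have "real G < real Yv * real C + real Yv" using GC by (metis of_nat_add of_nat_less_iff of_nat_mult)
    thus "real G / real Yv - 1 < real C" using Y by (simp add: field_simps)
  qed (use C2 Y in auto)
  have C2': "real C * (2 * real Yv) \<ge> real G"
  proof -
    have "Yv * 1 \<le> Yv * C" using C2 by (intro mult_le_mono2) simp
    hence "G \<le> Yv * C + Yv * C" using GC by linarith
    hence "real G \<le> real (Yv * C + Yv * C)" by (metis of_nat_le_iff)
    thus ?thesis by (simp add: algebra_simps)
  qed
  have "real (Z div C) \<le> real Z / real C" 
    using C2 by (simp add: of_nat_div_le_of_nat)
  also have "1 / real C \<le> real Yv / real G + 2 * (real Yv)\<^sup>2 / (real G)\<^sup>2"
  proof -
    have "1 / real C - real Yv / real G = (real G - real Yv * real C) / (real C * real G)"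
      using rC by (simp add: field_simps)
    also have "\<dots> \<le> real Yv / (real C * real G)"
    proof (rule divide_right_mono)
      have "real G < real (Yv * C + Yv)" using GC by (metis of_nat_less_iff)
      thus "real G - real Yv * real C \<le> real Yv" by simp
    qed (use rC in auto)
    also have "\<dots> = (real Yv / real G) * (1 / real C)" by simp
    also have "\<dots> \<le> (real Yv / real G) * (2 * real Yv / real G)"
    proof (rule mult_left_mono)
      show "1 / real C \<le> 2 * real Yv / real G" using C2' rC by (simp add: field_simps)
    qed (use rC in auto)
    also have "\<dots> = 2 * (real Yv)\<^sup>2 / (real G)\<^sup>2" by (simp add: power2_eq_square)
    finally show ?thesis by simp
  qed
  hence "real Z / real C \<le> real Z * (real Yv / real G + 2 * (real Yv)\<^sup>2 / (real G)\<^sup>2)"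
    by (metis mult_left_mono of_nat_0_le_iff times_divide_eq_right mult.right_neutral)
  finally show ?thesis unfolding C_def by (simp add: algebra_simps)
qed

text \<open>A crude a priori bound that only serves to control the second order term of
  \<open>div_bounds\<close>. An item has at most \<open>8 * 2 ^ (32 * q)\<close> values and
  \<open>C\<close> loses at most a factor 2, so the excess grows by at most 32 per child, and
  \<open>B32\<close> absorbs \<open>32 ^ B\<close>.\<close>

lemma Y_le: "set \<kappa> \<subseteq> Ty \<Longrightarrow> \<kappa> \<noteq> [] \<Longrightarrow> length \<kappa> \<le> B \<Longrightarrow> Y \<kappa> \<le> 2 ^ (16 * q + 2) * 32 ^ length \<kappa> \<and> Y \<kappa> \<le> 2 ^ (17 * q + 2)"
proof (induction \<kappa> rule: Y.induct)
  case 1 thus ?case by simp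
next
  case (2 \<tau>)
  have "aa \<tau> 0 \<le> 2 ^ (16 * q + 2)" using 2 L_pos by (intro aa_le) auto
  moreover have "(2::nat) ^ (16 * q + 2) \<le> 2 ^ (17 * q + 2)" by (rule power_increasing) auto
  ultimately have "aa \<tau> 0 \<le> 2 ^ (16 * q + 2)" "aa \<tau> 0 \<le> 2 ^ (17 * q + 2)" by linarith+
  thus ?case by simp
next
  case (3 \<tau> \<tau>' \<kappa>)
  let ?k = "\<tau>' # \<kappa>"
  have IH: "Y ?k \<le> 2 ^ (16 * q + 2) * 32 ^ length ?k" "Y ?k \<le> 2 ^ (17 * q + 2)"
    using 3 by auto
  have Yp: "1 \<le> Y ?k" using 3 by (intro Y_pos) auto
  have Z: "card (ZS ?k \<tau>) \<le> 2 ^ (32 * q + 3)" using 3 by (intro ZS_le) auto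
  have "2 * Y ?k \<le> 2 * 2 ^ (17 * q + 2)" using IH by simp
  also have "\<dots> = 2 ^ (17 * q + 3)" by (simp add: power_add)
  also have "\<dots> \<le> 2 ^ (32 * q)" using q_ge by (intro power_increasing) auto
  finally have YG: "2 * Y ?k \<le> 2 ^ (32 * q)" .
  define C where "C = 2 ^ (32 * q) div Y ?k"
  have GC: "2 ^ (32 * q) < Y ?k * C + Y ?k" unfolding C_def using Yp
    by (metis Suc_le_eq add.commute dividend_less_times_div mult.commute mult_Suc_right One_nat_def)
  have C1: "1 \<le> C" unfolding C_def using YG Yp by (simp add: less_eq_div_iff_mult_less_eq mult.commute)
  have "Y ?k * 1 \<le> Y ?k * C" using C1 by (rule mult_le_mono2)
  hence "2 ^ (32 * q) \<le> 2 * Y ?k * C" using GC by linarith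
  hence "card (ZS ?k \<tau>) \<le> 8 * (2 * Y ?k * C)" using Z by (simp add: power_add)
  hence "card (ZS ?k \<tau>) \<le> (16 * Y ?k) * C" by simp
  hence "card (ZS ?k \<tau>) div C \<le> 16 * Y ?k" using C1
    by (metis Suc_le_eq One_nat_def div_le_mono div_mult_self_is_m)
  hence "Y (\<tau> # ?k) \<le> 32 * Y ?k" using Yp by (simp add: C_def[symmetric])
  also have "\<dots> \<le> 32 * (2 ^ (16 * q + 2) * 32 ^ length ?k)" using IH(1) by (rule mult_le_mono2)
  also have "\<dots> = 2 ^ (16 * q + 2) * 32 ^ length (\<tau> # ?k)" by simp
  finally have A: "Y (\<tau> # ?k) \<le> 2 ^ (16 * q + 2) * 32 ^ length (\<tau> # ?k)" .
  also have "\<dots> \<le> 2 ^ (16 * q + 2) * 32 ^ B" using 3 by (intro mult_le_mono2 power_increasing) auto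
  also have "\<dots> \<le> 2 ^ (16 * q + 2) * 2 ^ q" using B32 by (intro mult_le_mono2)
  also have "\<dots> = 2 ^ (17 * q + 2)" by (simp add: power_add[symmetric])
  finally show ?case using A by simp
qed

lemma Y_G: "set \<kappa> \<subseteq> Ty \<Longrightarrow> \<kappa> \<noteq> [] \<Longrightarrow> length \<kappa> \<le> B \<Longrightarrow> 2 * Y \<kappa> \<le> 2 ^ (32 * q)"
proof -
  assume "set \<kappa> \<subseteq> Ty" "\<kappa> \<noteq> []" "length \<kappa> \<le> B"
  hence "2 * Y \<kappa> \<le> 2 * 2 ^ (17 * q + 2)" using Y_le by simp
  also have "\<dots> = 2 ^ (17 * q + 3)" by (simp add: power_add)
  also have "\<dots> \<le> 2 ^ (32 * q)" using q_ge by (intro power_increasing) auto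
  finally show ?thesis .
qed

text \<open>Apart from an additive term, a cell divides the number of combinations by exactly
  \<open>2 ^ (32 * q)\<close>. The second order term is at most
  \<open>2 * 2 ^ (32 * q + 3) * 2 ^ (34 * q + 4) / 2 ^ (64 * q)\<close>.\<close>

lemma Y_step:
  assumes "set \<kappa> \<subseteq> Ty" "\<kappa> \<noteq> []" "length \<kappa> < B" "\<tau> \<in> Ty"
  shows "real (Y (\<tau> # \<kappa>)) \<le> real (Y \<kappa>) * real (card (ZS \<kappa> \<tau>)) / 2 ^ (32 * q) + 2 ^ (2 * q + 9)"
proof -
  obtain \<tau>' \<kappa>' where k: "\<kappa> = \<tau>' # \<kappa>'" using assms by (cases \<kappa>) auto
  have Z: "card (ZS \<kappa> \<tau>) \<le> 2 ^ (32 * q + 3)" using assms by (intro ZS_le) auto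
  have "real (Y (\<tau> # \<kappa>)) \<le> real (Y \<kappa>) * real (card (ZS \<kappa> \<tau>)) / real (2 ^ (32 * q)) +
     2 * real (card (ZS \<kappa> \<tau>)) * (real (Y \<kappa>))\<^sup>2 / (real (2 ^ (32 * q)))\<^sup>2 + 1"
    unfolding k Y.simps
    by (rule div_bounds) (use Y_pos Y_G assms k in auto)
  also have "2 * real (card (ZS \<kappa> \<tau>)) * (real (Y \<kappa>))\<^sup>2 / (real (2 ^ (32 * q)))\<^sup>2 \<le> 2 ^ (2 * q + 8)"
  proof -
    have z: "real (card (ZS \<kappa> \<tau>)) \<le> 2 ^ (32 * q + 3)" using Z by (metis of_nat_le_iff of_nat_numeral of_nat_power)
    have "Y \<kappa> \<le> 2 ^ (17 * q + 2)" using Y_le assms by simp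
    hence y: "real (Y \<kappa>) \<le> 2 ^ (17 * q + 2)" by (metis of_nat_le_iff of_nat_numeral of_nat_power)
    have "2 * real (card (ZS \<kappa> \<tau>)) * (real (Y \<kappa>))\<^sup>2 \<le> 2 * 2 ^ (32 * q + 3) * (2 ^ (17 * q + 2))\<^sup>2"
      using z y by (intro mult_mono power_mono) auto
    also have "\<dots> = 2 ^ (66 * q + 8)" 
      by (simp add: power_add power_mult_distrib flip: power_mult) (simp add: mult.assoc flip: power_add)
    finally have "2 * real (card (ZS \<kappa> \<tau>)) * (real (Y \<kappa>))\<^sup>2 / (real (2 ^ (32 * q)))\<^sup>2 \<le> 2 ^ (66 * q + 8) / 2 ^ (64 * q)"
      by (simp add: divide_right_mono power_mult[symmetric])
    also have "\<dots> = 2 ^ (2 * q + 8)" by (simp add: power_diff[symmetric])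
    finally show ?thesis .
  qed
  finally have 1: "real (Y (\<tau> # \<kappa>)) \<le> real (Y \<kappa>) * real (card (ZS \<kappa> \<tau>)) / real (2 ^ (32 * q)) + 2 ^ (2 * q + 8) + 1"
    by simp
  have "(1::real) \<le> 2 ^ (2 * q + 8)" by simp
  hence "(2::real) ^ (2 * q + 8) + 1 \<le> 2 ^ (2 * q + 9)" by (simp add: power_add)
  thus ?thesis using 1 by simp
qed

end

section \<open>Counting the codes of a node\<close>

lemma sum_binomial_inj_le:
  assumes "finite X" "inj_on f X"
  shows "(\<Sum>x\<in>X. m choose f x) \<le> 2 ^ m"
proof -
  have "(\<Sum>x\<in>X. m choose f x) = (\<Sum>y\<in>f ` X. m choose y)" using assms by (simp add: sum.reindex)
  also have "\<dots> = (\<Sum>y\<in>f ` X \<inter> {..m}. m choose y)"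
    using assms by (intro sum.mono_neutral_right) auto
  also have "\<dots> \<le> (\<Sum>y\<le>m. m choose y)" by (intro sum_mono2) auto
  also have "\<dots> = 2 ^ m" by (rule choose_row_sum)
  finally show ?thesis .
qed

lemma inj_on_pairI:
  "(\<And>v s v' s'. v \<in> A \<Longrightarrow> s \<in> C \<Longrightarrow> v' \<in> A \<Longrightarrow> s' \<in> C \<Longrightarrow> f v s = f v' s' \<Longrightarrow> v = v' \<and> s = s')
    \<Longrightarrow> inj_on (\<lambda>(v, s). f v s) (A \<times> C)"
  unfolding inj_on_def by fast

context chain
begin

text \<open>The number of spills an ideal code of \<open>i\<close> children with \<open>x\<close>
  ones would need: each child contributes \<open>2 ^ (32 * q)\<close>, and \<open>i - 1\<close>
  cells remove all but one of these factors.\<close>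

definition bet :: "nat \<Rightarrow> nat \<Rightarrow> real" where
  "bet i x = 2 ^ (32 * q) * real (i * S choose x) / 2 ^ (i * S)"

text \<open>Counts what remains open after the children of a type list in \<open>A\<close>, if the
  prefix sum behind them lies at \<open>s\<close>: the current excess and the part \<open>b\<close>
  of the last child.\<close>

definition G :: "'t option list set \<Rightarrow> nat \<Rightarrow> real" where
  "G A s = (\<Sum>\<kappa>\<in>A. real (Y \<kappa>) * real (bb (hd \<kappa>) s))"

text \<open>
  The types without \<open>None\<close> (\<open>US\<close>, or \<open>WS\<close> if the final window is prescribed) account for the main term. With
  \<open>None\<close> (\<open>VS\<close>) the final window is not constrained at all, hence the bound on \<open>VS\<close> is uniform in it.
\<close>

definition WS :: "nat \<Rightarrow> nat \<Rightarrow> 't option list set" where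
  "WS i I = {\<kappa>\<in>TL i. None \<notin> set \<kappa> \<and> osum \<kappa> = I}"

definition US :: "nat \<Rightarrow> 't option list set" where
  "US i = {\<kappa>\<in>TL i. None \<notin> set \<kappa>}"

definition VS :: "nat \<Rightarrow> 't option list set" where
  "VS i = {\<kappa>\<in>TL i. None \<in> set \<kappa>}"

lemma bet_nonneg: "0 \<le> bet i x" by (simp add: bet_def)

lemma G_nonneg: "0 \<le> G A s" by (simp add: G_def sum_nonneg)

lemma bet_sum:
  assumes "finite X" "inj_on f X"
  shows "(\<Sum>x\<in>X. bet i (f x)) \<le> 2 ^ (32 * q)"
proof -
  have "real (\<Sum>x\<in>X. i * S choose f x) \<le> real (2 ^ (i * S))"
    using sum_binomial_inj_le[OF assms, of "i * S"] of_nat_le_iff by blast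
  hence "(\<Sum>x\<in>X. real (i * S choose f x)) \<le> 2 ^ (i * S)" by simp
  hence "2 ^ (32 * q) * (\<Sum>x\<in>X. real (i * S choose f x)) / 2 ^ (i * S) \<le> 2 ^ (32 * q)"
    by (simp add: field_simps)
  thus ?thesis by (simp add: bet_def sum_distrib_left sum_divide_distrib)
qed

lemma bet_conv: "(\<Sum>p\<le>r. bet i p * bet 1 (r - p)) = 2 ^ (32 * q) * bet (Suc i) r"
proof -
  have "(\<Sum>p\<le>r. bet i p * bet 1 (r - p)) =
      2 ^ (32 * q) * 2 ^ (32 * q) / (2 ^ (i * S) * 2 ^ S) * (\<Sum>p\<le>r. real (i * S choose p) * real (S choose (r - p)))"
    by (simp add: bet_def sum_distrib_left field_simps)
  also have "(\<Sum>p\<le>r. real (i * S choose p) * real (S choose (r - p))) = real (i * S + S choose r)"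
    using vandermonde[of "i * S" S r] by (metis (no_types, lifting) of_nat_mult of_nat_sum sum.cong)
  finally show ?thesis by (simp add: bet_def power_add algebra_simps)
qed

lemma G_step:
  assumes A: "A \<subseteq> TL i" and i: "1 \<le> i" "i < B" and \<tau>: "\<tau> \<in> Ty" and sl: "\<And>\<kappa>. \<kappa> \<in> A \<Longrightarrow> slot \<kappa> \<tau> = sl"
  shows "G ((#) \<tau> ` A) t \<le> (\<Sum>s<L. G A s * real (aa \<tau> s)) * real (if sl then nI else 1) / 2 ^ (32 * q) * real (bb \<tau> t)
     + real (card A) * (2 ^ (2 * q + 9) * real (bb \<tau> t))"
proof -
  have fA: "finite A" using A TL_fin finite_subset by blast
  let ?f = "real (if sl then nI else 1)"
  have "G ((#) \<tau> ` A) t = (\<Sum>\<kappa>\<in>A. real (Y (\<tau> # \<kappa>)) * real (bb \<tau> t))"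
    by (simp add: G_def sum.reindex)
  also have "\<dots> \<le> (\<Sum>\<kappa>\<in>A. ((\<Sum>s<L. real (Y \<kappa>) * real (bb (hd \<kappa>) s) * real (aa \<tau> s)) * ?f / 2 ^ (32 * q) + 2 ^ (2 * q + 9)) * real (bb \<tau> t))"
  proof (intro sum_mono mult_right_mono)
    fix \<kappa> assume k: "\<kappa> \<in> A"
    have "set \<kappa> \<subseteq> Ty" "\<kappa> \<noteq> []" "length \<kappa> < B" using k A i by (auto simp: TL_def)
    note Y_step[OF this \<tau>]
    also have "real (Y \<kappa>) * real (card (ZS \<kappa> \<tau>)) = (\<Sum>s<L. real (Y \<kappa>) * real (bb (hd \<kappa>) s) * real (aa \<tau> s)) * ?f"
      by (simp add: card_ZS sl[OF k] sum_distrib_left sum_distrib_right mult.assoc)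
    finally show "real (Y (\<tau> # \<kappa>)) \<le> (\<Sum>s<L. real (Y \<kappa>) * real (bb (hd \<kappa>) s) * real (aa \<tau> s)) * ?f / 2 ^ (32 * q) + 2 ^ (2 * q + 9)" .
  qed simp
  also have "\<dots> = (\<Sum>\<kappa>\<in>A. (\<Sum>s<L. real (Y \<kappa>) * real (bb (hd \<kappa>) s) * real (aa \<tau> s))) * ?f / 2 ^ (32 * q) * real (bb \<tau> t)
       + real (card A) * (2 ^ (2 * q + 9) * real (bb \<tau> t))"
    by (simp only: distrib_right sum.distrib sum_distrib_right sum_divide_distrib sum_constant mult.assoc)
  also have "(\<Sum>\<kappa>\<in>A. (\<Sum>s<L. real (Y \<kappa>) * real (bb (hd \<kappa>) s) * real (aa \<tau> s))) = (\<Sum>s<L. G A s * real (aa \<tau> s))"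
    unfolding G_def sum_distrib_right by (rule sum.swap)
  finally show ?thesis .
qed

text \<open>The rounding error is paid once per type list. There are at most \<open>2 ^ q\<close> of
  them by \<open>T_card\<close>, each costs \<open>2 ^ (2 * q + 9) * 2 ^ (16 * q + 2)\<close>, and
  \<open>q \<ge> 16\<close> brings the total below \<open>2 ^ (20 * q)\<close>.\<close>

lemma G_union:
  assumes T': "T' \<subseteq> Ty" and A: "\<And>\<tau>. \<tau> \<in> T' \<Longrightarrow> A \<tau> \<subseteq> TL i" and i: "1 \<le> i" "i < B"
    and sl: "\<And>\<tau> \<kappa>. \<tau> \<in> T' \<Longrightarrow> \<kappa> \<in> A \<tau> \<Longrightarrow> slot \<kappa> \<tau> = sl" and t: "t < L"
  shows "G (\<Union>\<tau>\<in>T'. (#) \<tau> ` A \<tau>) t \<le> (\<Sum>\<tau>\<in>T'. (\<Sum>s<L. G (A \<tau>) s * real (aa \<tau> s)) * real (if sl then nI else 1) / 2 ^ (32 * q) * real (bb \<tau> t))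
     + 2 ^ (20 * q)"
proof -
  have fT: "finite T'" using T' Ty_fin finite_subset by blast
  have fA: "\<And>\<tau>. \<tau> \<in> T' \<Longrightarrow> finite (A \<tau>)" using A TL_fin finite_subset by blast
  have dj: "\<And>x y. x \<noteq> y \<Longrightarrow> (#) x ` A x \<inter> (#) y ` A y = {}" by auto
  have "G (\<Union>\<tau>\<in>T'. (#) \<tau> ` A \<tau>) t = (\<Sum>\<tau>\<in>T'. G ((#) \<tau> ` A \<tau>) t)"
    unfolding G_def using fT fA dj by (intro sum.UNION_disjoint) auto
  also have "\<dots> \<le> (\<Sum>\<tau>\<in>T'. (\<Sum>s<L. G (A \<tau>) s * real (aa \<tau> s)) * real (if sl then nI else 1) / 2 ^ (32 * q) * real (bb \<tau> t)
     + real (card (A \<tau>)) * (2 ^ (2 * q + 9) * 2 ^ (16 * q + 2)))"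
  proof (rule sum_mono)
    fix \<tau> assume tt: "\<tau> \<in> T'"
    have ty: "\<tau> \<in> Ty" using tt T' by auto
    have b: "real (bb \<tau> t) \<le> 2 ^ (16 * q + 2)"
      using bb_le[OF ty t] by (metis of_nat_le_iff of_nat_numeral of_nat_power)
    have "real (card (A \<tau>)) * (2 ^ (2 * q + 9) * real (bb \<tau> t)) \<le> real (card (A \<tau>)) * (2 ^ (2 * q + 9) * 2 ^ (16 * q + 2))"
      using b by (intro mult_left_mono) auto
    thus "G ((#) \<tau> ` A \<tau>) t \<le> (\<Sum>s<L. G (A \<tau>) s * real (aa \<tau> s)) * real (if sl then nI else 1) / 2 ^ (32 * q) * real (bb \<tau> t)
     + real (card (A \<tau>)) * (2 ^ (2 * q + 9) * 2 ^ (16 * q + 2))"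
      using G_step[OF A[OF tt] i ty, of sl t] sl[OF tt] by fastforce
  qed
  also have "\<dots> = (\<Sum>\<tau>\<in>T'. (\<Sum>s<L. G (A \<tau>) s * real (aa \<tau> s)) * real (if sl then nI else 1) / 2 ^ (32 * q) * real (bb \<tau> t))
     + real (\<Sum>\<tau>\<in>T'. card (A \<tau>)) * (2 ^ (2 * q + 9) * 2 ^ (16 * q + 2))"
    by (simp add: sum.distrib sum_distrib_right)
  also have "real (\<Sum>\<tau>\<in>T'. card (A \<tau>)) * (2 ^ (2 * q + 9) * 2 ^ (16 * q + 2)) \<le> 2 ^ (20 * q)"
  proof -
    have "(\<Sum>\<tau>\<in>T'. card (A \<tau>)) = (\<Sum>\<tau>\<in>T'. card ((#) \<tau> ` A \<tau>))" by (simp add: card_image)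
    also have "\<dots> = card (\<Union>\<tau>\<in>T'. (#) \<tau> ` A \<tau>)" using fT fA dj by (subst card_UN_disjoint) auto
    also have "\<dots> \<le> card (TL (Suc i))"
    proof (rule card_mono)
      show "(\<Union>\<tau>\<in>T'. (#) \<tau> ` A \<tau>) \<subseteq> TL (Suc i)"
        using A T' unfolding TL_def by fastforce
    qed simp
    also have "\<dots> \<le> (card T + 1) ^ B" unfolding card_TL using i by (intro power_increasing) auto
    also have "\<dots> \<le> 2 ^ q" by (rule T_card)
    finally have "real (\<Sum>\<tau>\<in>T'. card (A \<tau>)) \<le> real (2 ^ q)" using of_nat_le_iff by blast
    hence "real (\<Sum>\<tau>\<in>T'. card (A \<tau>)) * (2 ^ (2 * q + 9) * 2 ^ (16 * q + 2)) \<le> 2 ^ q * (2 ^ (2 * q + 9) * 2 ^ (16 * q + 2))"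
      by (intro mult_right_mono) auto
    also have "\<dots> = 2 ^ (q + ((2 * q + 9) + (16 * q + 2)))" by (simp only: power_add)
    also have "\<dots> = 2 ^ (19 * q + 11)" by (rule arg_cong[where f = "(^) 2"]) simp
    also have "\<dots> \<le> 2 ^ (20 * q)" using q_ge by (intro power_increasing) auto
    finally show ?thesis .
  qed
  finally show ?thesis by simp
qed

section \<open>The transition kernel of one child, with its row and column sums\<close>

definition Kt :: "nat \<Rightarrow> nat \<Rightarrow> nat \<Rightarrow> real" where
  "Kt v s t = (\<Sum>\<tau>\<in>{\<tau>\<in>T. off \<tau> = v}. real (a \<tau> s) * real (b \<tau> t))"

lemma Kt_nonneg: "0 \<le> Kt v s t" by (simp add: Kt_def sum_nonneg)

lemma Kt_le: "v \<in> off ` T \<Longrightarrow> s < L \<Longrightarrow> t < L \<Longrightarrow> Kt v s t \<le> bet 1 (v * L + t - s) + 2 ^ (20 * q)"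
  using upper[of v s t] by (simp add: Kt_def bet_def)

lemma sum_T_Kt:
  "(\<Sum>\<tau>\<in>{\<tau>\<in>T. off \<tau> \<in> V}. f (off \<tau>) * (real (a \<tau> s) * real (b \<tau> t))) = (\<Sum>v\<in>off ` T \<inter> V. f v * Kt v s t)"
proof -
  have "(\<Sum>\<tau>\<in>{\<tau>\<in>T. off \<tau> \<in> V}. f (off \<tau>) * (real (a \<tau> s) * real (b \<tau> t))) =
    (\<Sum>v\<in>off ` {\<tau>\<in>T. off \<tau> \<in> V}. \<Sum>\<tau>\<in>{x\<in>{\<tau>\<in>T. off \<tau> \<in> V}. off x = v}. f (off \<tau>) * (real (a \<tau> s) * real (b \<tau> t)))"
    using T_fin by (intro sum.image_gen) auto
  also have "off ` {\<tau>\<in>T. off \<tau> \<in> V} = off ` T \<inter> V" by auto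
  also have "(\<Sum>v\<in>off ` T \<inter> V. \<Sum>\<tau>\<in>{x\<in>{\<tau>\<in>T. off \<tau> \<in> V}. off x = v}. f (off \<tau>) * (real (a \<tau> s) * real (b \<tau> t))) =
     (\<Sum>v\<in>off ` T \<inter> V. f v * Kt v s t)"
    unfolding Kt_def sum_distrib_left by (intro sum.cong) auto
  finally show ?thesis .
qed

text \<open>Injectivity lets the binomial coefficients add up to at most a full row; by
  \<open>off_card\<close> the additive errors occur at most \<open>2 ^ q\<close> times. So the
  kernel \<open>Kt\<close>, divided by \<open>2 ^ (32 * q)\<close>, is nearly substochastic in both
  directions.\<close>

lemma window_sum_le:
  assumes V: "V \<subseteq> off ` T" and inj: "inj_on (\<lambda>(v, s). f v s) (V \<times> {..<L})"
  shows "(\<Sum>v\<in>V. \<Sum>s<L. bet i (f v s) + 2 ^ (20 * q)) \<le> 2 ^ (32 * q) + 2 ^ (21 * q)"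
proof -
  have fV: "finite V" using V T_fin finite_subset by blast
  have "(\<Sum>v\<in>V. \<Sum>s<L. bet i (f v s)) \<le> 2 ^ (32 * q)"
    using bet_sum[OF _ inj, of i] fV by (simp add: sum.cartesian_product case_prod_beta)
  moreover have "(\<Sum>v\<in>V. \<Sum>s<L. (2::real) ^ (20 * q)) \<le> 2 ^ (21 * q)"
  proof -
    have "card V \<le> card (off ` T)" using V T_fin by (intro card_mono) auto
    hence "card V * L \<le> 2 ^ q" using off_card by (meson le_trans mult_le_mono1)
    hence "real (card V * L) \<le> real (2 ^ q)" using of_nat_le_iff by blast
    hence "real (card V * L) * 2 ^ (20 * q) \<le> 2 ^ q * 2 ^ (20 * q)" by (intro mult_right_mono) auto
    also have "\<dots> = 2 ^ (21 * q)" by (simp flip: power_add)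
    finally show ?thesis by (simp add: mult.assoc)
  qed
  ultimately show ?thesis by (simp add: sum.distrib)
qed

text \<open>Makes \<open>v * L + t - s\<close> a genuine difference. Truncated subtraction would
  merge different values and destroy the injectivity needed for \<open>bet_sum\<close>.\<close>

lemma off_ge': "v \<in> off ` T \<Longrightarrow> s < L \<Longrightarrow> s \<le> v * L"
proof -
  assume "v \<in> off ` T" "s < L"
  then obtain x where "x \<in> T" "v = off x" by auto
  thus ?thesis using off_ge[of x] \<open>s < L\<close> by simp
qed

lemma divmod_window: "s < L \<Longrightarrow> s' < L \<Longrightarrow> v * L + s = v' * L + s' \<Longrightarrow> v = v' \<and> s = (s'::nat)"
proof -
  assume *: "s < L" "s' < L" "v * L + s = v' * L + s'"
  have "(v * L + s) div L = v" "(v' * L + s') div L = v'" using *(1,2) by auto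
  hence "v = v'" using *(3) by simp
  thus ?thesis using *(3) by simp
qed

lemma inj_win1: "V \<subseteq> off ` T \<Longrightarrow> inj_on (\<lambda>(v, s). v * L + t - s) (V \<times> {..<L})"
proof (rule inj_on_pairI)
  fix v s v' s' assume V: "V \<subseteq> off ` T" "v \<in> V" "v' \<in> V" "s \<in> {..<L}" "s' \<in> {..<L}" "v * L + t - s = v' * L + t - s'"
  have "s \<le> v * L" "s' \<le> v' * L" using off_ge' V by auto
  hence "v * L + s' = v' * L + s" using V(6) by linarith
  from divmod_window[OF _ _ this] show "v = v' \<and> s = s'" using V by simp
qed

lemma inj_win2: "V \<subseteq> off ` T \<Longrightarrow> s < L \<Longrightarrow> inj_on (\<lambda>(v, t). v * L + t - s) (V \<times> {..<L})"
proof (rule inj_on_pairI)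
  fix v t v' t' assume V: "V \<subseteq> off ` T" "s < L" "v \<in> V" "v' \<in> V" "t \<in> {..<L}" "t' \<in> {..<L}" "v * L + t - s = v' * L + t' - s"
  have "s \<le> v * L" "s \<le> v' * L" using off_ge' V by auto
  hence "v * L + t = v' * L + t'" using V(7) by linarith
  from divmod_window[OF _ _ this] show "v = v' \<and> t = t'" using V by simp
qed

lemma Kt_col: "t < L \<Longrightarrow> V \<subseteq> off ` T \<Longrightarrow> (\<Sum>v\<in>V. \<Sum>s<L. Kt v s t) \<le> 2 ^ (32 * q) + 2 ^ (21 * q)"
proof -
  assume t: "t < L" and V: "V \<subseteq> off ` T"
  have "(\<Sum>v\<in>V. \<Sum>s<L. Kt v s t) \<le> (\<Sum>v\<in>V. \<Sum>s<L. bet 1 (v * L + t - s) + 2 ^ (20 * q))"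
    by (intro sum_mono Kt_le) (use t V in auto)
  also have "\<dots> \<le> 2 ^ (32 * q) + 2 ^ (21 * q)"
    by (rule window_sum_le[OF V inj_win1[OF V]])
  finally show ?thesis .
qed

lemma Kt_row: "s < L \<Longrightarrow> V \<subseteq> off ` T \<Longrightarrow> (\<Sum>v\<in>V. \<Sum>t<L. Kt v s t) \<le> 2 ^ (32 * q) + 2 ^ (21 * q)"
proof -
  assume t: "s < L" and V: "V \<subseteq> off ` T"
  have "(\<Sum>v\<in>V. \<Sum>t<L. Kt v s t) \<le> (\<Sum>v\<in>V. \<Sum>t<L. bet 1 (v * L + t - s) + 2 ^ (20 * q))"
    by (intro sum_mono Kt_le) (use t V in auto)
  also have "\<dots> \<le> 2 ^ (32 * q) + 2 ^ (21 * q)"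
    by (rule window_sum_le[OF V inj_win2[OF V t]])
  finally show ?thesis .
qed

lemma scal: "(\<Sum>s\<in>X. f s * (x s :: real)) * y = (\<Sum>s\<in>X. f s * (x s * y))"
  by (simp add: sum_distrib_right mult.assoc)

lemma split3: "(\<Sum>v\<in>X. \<Sum>s\<in>Z. P v s * (Q v s + c) + d * (R v s :: real)) =
    (\<Sum>v\<in>X. \<Sum>s\<in>Z. P v s * Q v s) + c * (\<Sum>v\<in>X. \<Sum>s\<in>Z. P v s) + d * (\<Sum>v\<in>X. \<Sum>s\<in>Z. R v s)"
  by (simp only: sum.distrib sum_distrib_left distrib_left mult.commute[of _ c])

lemma pull: "(\<Sum>s\<in>X. G' s * x) * n / g * y = (\<Sum>s\<in>X. G' s) * (n * (x * y)) / (g :: real)"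
  by (simp only: sum_distrib_right[symmetric]) simp

lemma TL_Suc_iff: "x # \<kappa> \<in> TL (Suc i) \<longleftrightarrow> x \<in> Ty \<and> \<kappa> \<in> TL i"
  by (auto simp: TL_def)

lemma TL_SucE: assumes "\<kappa> \<in> TL (Suc i)" obtains x \<kappa>' where "\<kappa> = x # \<kappa>'" "x \<in> Ty" "\<kappa>' \<in> TL i"
  using assms by (cases \<kappa>) (auto simp: TL_def)

lemma B_real: "8 * real B \<le> 2 ^ q"
proof -
  have "real (8 * B) \<le> real (2 ^ q)" using B_q of_nat_le_iff by blast
  thus ?thesis by simp
qed

text \<open>Appending a child sums over its offset and over the place of the prefix sum in front of
  it; Vandermonde's identity puts the products together again. A step adds three errors of
  \<open>2 ^ (20 * q)\<close>: the rounding of the cell, the error of \<open>Kt\<close> against the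
  total mass of \<open>bet i\<close>, and the old error times the excess of a column sum over
  \<open>2 ^ (32 * q)\<close>.\<close>

lemma WS_bound:
  "1 \<le> i \<Longrightarrow> i \<le> B \<Longrightarrow> t < L \<Longrightarrow> G (WS i I) t \<le> bet i (I * L + t) + 3 * real i * 2 ^ (20 * q)"
proof (induction i arbitrary: I t rule: nat_induct_at_least)
  case base
  have "WS 1 I = (\<lambda>\<tau>. [Some \<tau>]) ` {\<tau>\<in>T. off \<tau> = I}"
    by (auto simp: WS_def TL_def Ty_def osum_def length_Suc_conv)
  hence "G (WS 1 I) t = Kt I 0 t"
    by (simp add: G_def Kt_def sum.reindex inj_on_def)
  also have "\<dots> \<le> bet 1 (I * L + t) + 2 ^ (20 * q)"
  proof (cases "I \<in> off ` T")
    case True thus ?thesis using Kt_le[of I 0 t] base L_pos by simp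
  next
    case False
    hence "{\<tau>\<in>T. off \<tau> = I} = {}" by auto
    hence "Kt I 0 t = 0" unfolding Kt_def by (simp only: sum.empty)
    thus ?thesis using bet_nonneg by simp
  qed
  also have "\<dots> \<le> bet 1 (I * L + t) + 3 * real 1 * 2 ^ (20 * q)" by simp
  finally show ?case .
next
  case (Suc i)
  let ?A = "\<lambda>\<tau>. WS i (I - off (the \<tau>))"
  let ?T = "Some ` {\<tau>\<in>T. off \<tau> \<in> {..I}}"
  let ?V = "off ` T \<inter> {..I}"
  let ?d = "3 * real i * 2 ^ (20 * q)"
  let ?e = "(2::real) ^ (20 * q)"
  let ?g = "(2::real) ^ (32 * q)"
  have U: "WS (Suc i) I = (\<Union>\<tau>\<in>?T. (#) \<tau> ` ?A \<tau>)"
  proof (intro equalityI subsetI)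
    fix \<kappa> assume k: "\<kappa> \<in> WS (Suc i) I"
    then obtain \<tau> \<kappa>' where kk: "\<kappa> = \<tau> # \<kappa>'" by (auto simp: WS_def TL_def length_Suc_conv)
    then obtain x where x: "\<tau> = Some x" "x \<in> T" using k by (auto simp: WS_def TL_def Ty_def)
    have "off x + osum \<kappa>' = I" using k kk x by (simp add: WS_def osum_def)
    thus "\<kappa> \<in> (\<Union>\<tau>\<in>?T. (#) \<tau> ` ?A \<tau>)" using k kk x by (auto simp: WS_def TL_def)
  next
    fix \<kappa> assume "\<kappa> \<in> (\<Union>\<tau>\<in>?T. (#) \<tau> ` ?A \<tau>)"
    thus "\<kappa> \<in> WS (Suc i) I" by (auto simp: WS_def TL_def Ty_def osum_def)
  qed
  have "G (WS (Suc i) I) t \<le> (\<Sum>\<tau>\<in>?T. (\<Sum>s<L. G (?A \<tau>) s * real (aa \<tau> s)) * real (if False then nI else 1) / ?g * real (bb \<tau> t)) + ?e"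
    unfolding U by (rule G_union[where i = i]) (use Suc in \<open>auto simp: Ty_def WS_def slot_def\<close>)
  also have "(\<Sum>\<tau>\<in>?T. (\<Sum>s<L. G (?A \<tau>) s * real (aa \<tau> s)) * real (if False then nI else 1) / ?g * real (bb \<tau> t)) =
     (\<Sum>\<tau>\<in>{\<tau>\<in>T. off \<tau> \<in> {..I}}. \<Sum>s<L. G (WS i (I - off \<tau>)) s * (real (a \<tau> s) * real (b \<tau> t))) / ?g"
    by (subst sum.reindex) (simp_all add: scal flip: sum_divide_distrib)
  also have "(\<Sum>\<tau>\<in>{\<tau>\<in>T. off \<tau> \<in> {..I}}. \<Sum>s<L. G (WS i (I - off \<tau>)) s * (real (a \<tau> s) * real (b \<tau> t))) =
     (\<Sum>s<L. \<Sum>v\<in>?V. G (WS i (I - v)) s * Kt v s t)"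
    by (subst sum.swap) (simp only: sum_T_Kt[where f = "\<lambda>v. G (WS i (I - v)) _"])
  also have "\<dots> = (\<Sum>v\<in>?V. \<Sum>s<L. G (WS i (I - v)) s * Kt v s t)" by (rule sum.swap)
  also have "\<dots> \<le> (\<Sum>v\<in>?V. \<Sum>s<L. bet i ((I - v) * L + s) * (bet 1 (v * L + t - s) + ?e) + ?d * Kt v s t)"
  proof (intro sum_mono)
    fix v s assume v: "v \<in> ?V" and s: "s \<in> {..<L}"
    have "G (WS i (I - v)) s * Kt v s t \<le> (bet i ((I - v) * L + s) + ?d) * Kt v s t"
      using Suc s by (intro mult_right_mono Kt_nonneg) auto
    also have "\<dots> = bet i ((I - v) * L + s) * Kt v s t + ?d * Kt v s t" by (simp add: distrib_right)
    also have "\<dots> \<le> bet i ((I - v) * L + s) * (bet 1 (v * L + t - s) + ?e) + ?d * Kt v s t"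
      using Suc s v by (intro add_right_mono mult_left_mono Kt_le bet_nonneg) auto
    finally show "G (WS i (I - v)) s * Kt v s t \<le> bet i ((I - v) * L + s) * (bet 1 (v * L + t - s) + ?e) + ?d * Kt v s t" .
  qed
  also have "\<dots> = (\<Sum>v\<in>?V. \<Sum>s<L. bet i ((I - v) * L + s) * bet 1 (v * L + t - s)) +
      ?e * (\<Sum>v\<in>?V. \<Sum>s<L. bet i ((I - v) * L + s)) + ?d * (\<Sum>v\<in>?V. \<Sum>s<L. Kt v s t)"
    by (rule split3)
  also have "\<dots> \<le> ?g * bet (Suc i) (I * L + t) + ?e * ?g + ?d * (?g + 2 ^ (21 * q))"
  proof (intro add_mono mult_left_mono)
    \<comment> \<open>The full prefix sum in front of the last child, recovered from its window
      \<open>I - v\<close> and its place \<open>s\<close>; every value arises at most once.\<close>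
    let ?h = "\<lambda>(v, s). (I - v) * L + s"
    have inj: "inj_on ?h (?V \<times> {..<L})"
    proof (rule inj_on_pairI)
      fix v s v' s' assume *: "v \<in> ?V" "v' \<in> ?V" "s \<in> {..<L}" "s' \<in> {..<L}" "(I - v) * L + s = (I - v') * L + s'"
      have "I - v = I - v' \<and> s = s'" using divmod_window[OF _ _ *(5)] * by simp
      thus "v = v' \<and> s = s'" using * by auto
    qed
    have fV: "finite ?V" by simp
    have sub: "(I - v) * L + s \<le> I * L + t \<and> I * L + t - ((I - v) * L + s) = v * L + t - s" if "v \<in> ?V" "s < L" for v s
    proof -
      have "s \<le> v * L" using that off_ge' by auto
      moreover have "(I - v) * L + v * L = I * L" using that by (simp add: add_mult_distrib[symmetric])
      ultimately show ?thesis by linarith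
    qed
    have "(\<Sum>v\<in>?V. \<Sum>s<L. bet i ((I - v) * L + s) * bet 1 (v * L + t - s)) =
       (\<Sum>x\<in>?V \<times> {..<L}. bet i (?h x) * bet 1 (I * L + t - ?h x))"
      unfolding sum.cartesian_product
    proof (rule sum.cong[OF refl])
      fix x assume "x \<in> ?V \<times> {..<L}"
      then obtain v s where x: "x = (v, s)" "v \<in> ?V" "s < L" by auto
      show "(case x of (v, s) \<Rightarrow> bet i ((I - v) * L + s) * bet 1 (v * L + t - s)) =
        bet i (?h x) * bet 1 (I * L + t - ?h x)"
        using sub[OF x(2,3)] unfolding x(1) prod.case by (metis (lifting))
    qed
    also have "\<dots> = (\<Sum>p\<in>?h ` (?V \<times> {..<L}). bet i p * bet 1 (I * L + t - p))"
      using inj by (simp add: sum.reindex)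
    also have "\<dots> \<le> (\<Sum>p\<le>I * L + t. bet i p * bet 1 (I * L + t - p))"
      using sub by (intro sum_mono2) (auto simp: bet_nonneg)
    finally show "(\<Sum>v\<in>?V. \<Sum>s<L. bet i ((I - v) * L + s) * bet 1 (v * L + t - s)) \<le> ?g * bet (Suc i) (I * L + t)"
      unfolding bet_conv .
    show "(\<Sum>v\<in>?V. \<Sum>s<L. bet i ((I - v) * L + s)) \<le> ?g"
      using bet_sum[OF _ inj, of i] fV by (simp add: sum.cartesian_product case_prod_beta)
    show "(\<Sum>v\<in>?V. \<Sum>s<L. Kt v s t) \<le> ?g + 2 ^ (21 * q)" using Suc by (intro Kt_col) auto
  qed auto
  finally have "G (WS (Suc i) I) t \<le> (?g * bet (Suc i) (I * L + t) + ?e * ?g + ?d * (?g + 2 ^ (21 * q))) / ?g + ?e"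
    by (simp add: divide_right_mono)
  also have "\<dots> = bet (Suc i) (I * L + t) + 2 * ?e + ?d + ?d * 2 ^ (21 * q) / ?g"
    by (simp add: field_simps)
  also have "?d * 2 ^ (21 * q) / ?g \<le> ?e"
  proof -
    have "3 * real i \<le> 2 ^ q" using B_real Suc by simp
    hence "3 * real i * 2 ^ (21 * q) \<le> 2 ^ q * 2 ^ (21 * q)" by (intro mult_right_mono) auto
    also have "\<dots> = 2 ^ (22 * q)" by (simp flip: power_add)
    also have "\<dots> \<le> ?g" by (intro power_increasing) auto
    finally have "?e * (3 * real i * 2 ^ (21 * q)) \<le> ?e * ?g" by (intro mult_left_mono) auto
    thus ?thesis by (simp add: field_simps)
  qed
  finally show ?case by (simp add: algebra_simps)
qed

text \<open>With the final window left free only the total mass matters, and one more child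
  multiplies it by at most a normalised row sum of \<open>Kt\<close>.\<close>

lemma US_bound:
  "1 \<le> i \<Longrightarrow> i \<le> B \<Longrightarrow> (\<Sum>s<L. G (US i) s) \<le> 2 ^ (32 * q) + 4 * real i * 2 ^ (21 * q)"
proof (induction i rule: nat_induct_at_least)
  case base
  have "US 1 = (\<lambda>\<tau>. [Some \<tau>]) ` T"
    by (auto simp: US_def TL_def Ty_def length_Suc_conv)
  hence "G (US 1) t = (\<Sum>v\<in>off ` T. Kt v 0 t)" for t
    using sum_T_Kt[where V = UNIV and f = "\<lambda>_. 1" and s = 0 and t = t] by (simp add: G_def sum.reindex inj_on_def)
  hence "(\<Sum>t<L. G (US 1) t) = (\<Sum>v\<in>off ` T. \<Sum>t<L. Kt v 0 t)" by (simp only:) (rule sum.swap)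
  also have "\<dots> \<le> 2 ^ (32 * q) + 2 ^ (21 * q)" using L_pos by (intro Kt_row) auto
  also have "\<dots> \<le> 2 ^ (32 * q) + 4 * real 1 * 2 ^ (21 * q)" by simp
  finally show ?case .
next
  case (Suc i)
  let ?e = "(2::real) ^ (20 * q)"
  let ?g = "(2::real) ^ (32 * q)"
  let ?m = "\<Sum>s<L. G (US i) s"
  have U: "US (Suc i) = (\<Union>\<tau>\<in>Some ` T. (#) \<tau> ` US i)"
  proof (intro equalityI subsetI)
    fix \<kappa> assume k: "\<kappa> \<in> US (Suc i)"
    then obtain x \<kappa>' where kk: "\<kappa> = x # \<kappa>'" "x \<in> Ty" "\<kappa>' \<in> TL i" by (auto simp: US_def elim: TL_SucE)
    thus "\<kappa> \<in> (\<Union>\<tau>\<in>Some ` T. (#) \<tau> ` US i)" using k by (auto simp: US_def Ty_def)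
  next
    fix \<kappa> assume "\<kappa> \<in> (\<Union>\<tau>\<in>Some ` T. (#) \<tau> ` US i)"
    thus "\<kappa> \<in> US (Suc i)" by (auto simp: US_def TL_Suc_iff Ty_def)
  qed
  have st: "G (US (Suc i)) t \<le> (\<Sum>s<L. \<Sum>v\<in>off ` T. G (US i) s * Kt v s t) / ?g + ?e" if t: "t < L" for t
  proof -
    have "G (US (Suc i)) t \<le> (\<Sum>\<tau>\<in>Some ` T. (\<Sum>s<L. G (US i) s * real (aa \<tau> s)) * real (if False then nI else 1) / ?g * real (bb \<tau> t)) + ?e"
      unfolding U by (rule G_union[where i = i]) (use Suc t in \<open>auto simp: Ty_def US_def slot_def\<close>)
    also have "(\<Sum>\<tau>\<in>Some ` T. (\<Sum>s<L. G (US i) s * real (aa \<tau> s)) * real (if False then nI else 1) / ?g * real (bb \<tau> t)) =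
       (\<Sum>\<tau>\<in>T. \<Sum>s<L. G (US i) s * (real (a \<tau> s) * real (b \<tau> t))) / ?g"
      by (subst sum.reindex) (simp_all add: scal flip: sum_divide_distrib)
    also have "(\<Sum>\<tau>\<in>T. \<Sum>s<L. G (US i) s * (real (a \<tau> s) * real (b \<tau> t))) =
       (\<Sum>s<L. \<Sum>v\<in>off ` T. G (US i) s * Kt v s t)"
      by (subst sum.swap) (use sum_T_Kt[where V = UNIV and f = "\<lambda>v. G (US i) _"] in simp)
    finally show ?thesis .
  qed
  have "(\<Sum>t<L. G (US (Suc i)) t) \<le> (\<Sum>t<L. (\<Sum>s<L. \<Sum>v\<in>off ` T. G (US i) s * Kt v s t) / ?g + ?e)"
    using st by (intro sum_mono) auto
  also have "\<dots> = (\<Sum>t<L. \<Sum>s<L. \<Sum>v\<in>off ` T. G (US i) s * Kt v s t) / ?g + real L * ?e"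
    by (simp add: sum.distrib sum_divide_distrib)
  also have "(\<Sum>t<L. \<Sum>s<L. \<Sum>v\<in>off ` T. G (US i) s * Kt v s t) = (\<Sum>s<L. G (US i) s * (\<Sum>v\<in>off ` T. \<Sum>t<L. Kt v s t))"
  proof -
    have "(\<Sum>t<L. \<Sum>v\<in>off ` T. G (US i) s * Kt v s t) = G (US i) s * (\<Sum>v\<in>off ` T. \<Sum>t<L. Kt v s t)" for s
      by (subst sum.swap) (simp add: sum_distrib_left)
    thus ?thesis by (subst sum.swap) simp
  qed
  also have "\<dots> \<le> (\<Sum>s<L. G (US i) s * (?g + 2 ^ (21 * q)))"
    by (intro sum_mono mult_left_mono Kt_row G_nonneg) auto
  also have "\<dots> = ?m * (?g + 2 ^ (21 * q))" by (simp add: sum_distrib_right)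
  finally have 1: "(\<Sum>t<L. G (US (Suc i)) t) \<le> ?m * (?g + 2 ^ (21 * q)) / ?g + real L * ?e"
    by (simp add: divide_right_mono)
  have IH: "?m \<le> ?g + 4 * real i * 2 ^ (21 * q)" using Suc by simp
  have "4 * real i * 2 ^ (21 * q) \<le> 2 ^ q * 2 ^ (21 * q)" using B_real Suc by (intro mult_right_mono) auto
  also have "\<dots> = 2 ^ (22 * q)" by (simp flip: power_add)
  also have "\<dots> \<le> ?g" by (intro power_increasing) auto
  finally have m2: "?m \<le> 2 * ?g" using IH by simp
  have "?m * (?g + 2 ^ (21 * q)) / ?g = ?m + ?m * 2 ^ (21 * q) / ?g" by (simp add: field_simps)
  also have "?m * 2 ^ (21 * q) / ?g \<le> 2 * ?g * 2 ^ (21 * q) / ?g"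
    using m2 by (intro divide_right_mono mult_right_mono) auto
  also have "2 * ?g * 2 ^ (21 * q) / ?g = 2 * 2 ^ (21 * q)" by simp
  finally have 2: "?m * (?g + 2 ^ (21 * q)) / ?g \<le> ?m + 2 * 2 ^ (21 * q)" by simp
  have "real L \<le> 2 ^ q" using L_q by (metis of_nat_le_iff of_nat_numeral of_nat_power)
  hence "real L * ?e \<le> 2 ^ q * ?e" by (intro mult_right_mono) auto
  also have "\<dots> = 2 ^ (21 * q)" by (simp flip: power_add)
  finally have 3: "real L * ?e \<le> 2 ^ (21 * q)" .
  have "(0::real) \<le> 2 ^ (21 * q)" by simp
  hence "(\<Sum>t<L. G (US (Suc i)) t) \<le> ?g + 4 * real i * 2 ^ (21 * q) + 4 * 2 ^ (21 * q)" using 1 2 3 IH by linarith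
  thus ?case by (simp add: algebra_simps)
qed

lemma US_bound2: "1 \<le> i \<Longrightarrow> i \<le> B \<Longrightarrow> (\<Sum>s<L. G (US i) s) \<le> 2 * 2 ^ (32 * q)"
proof -
  assume i: "1 \<le> i" "i \<le> B"
  have "4 * real i * 2 ^ (21 * q) \<le> 2 ^ q * 2 ^ (21 * q)" using B_real i by (intro mult_right_mono) auto
  also have "\<dots> = 2 ^ (22 * q)" by (simp flip: power_add)
  also have "\<dots> \<le> 2 ^ (32 * q)" by (intro power_increasing) auto
  finally show ?thesis using US_bound[OF i] by simp
qed

definition E :: real where "E = real (e * e)"

lemma E_ge: "2 ^ (20 * q) \<le> E"
proof -
  have "2 ^ (10 * q) * 2 ^ (10 * q) \<le> e * e" by (intro mult_le_mono e_ge)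
  hence "real (2 ^ (10 * q) * 2 ^ (10 * q)) \<le> real (e * e)" using of_nat_le_iff by blast
  thus ?thesis by (simp add: E_def flip: power_add)
qed

lemma E_le: "E \<le> 2 ^ (24 * q)"
proof -
  have "e * e \<le> 2 ^ (12 * q) * 2 ^ (12 * q)" by (intro mult_le_mono e_le)
  hence "real (e * e) \<le> real (2 ^ (12 * q) * 2 ^ (12 * q))" using of_nat_le_iff by blast
  thus ?thesis by (simp add: E_def flip: power_add)
qed

text \<open>By the last type: a proper type keeps the bound up to a small factor; a first
  \<open>None\<close> costs the whole mass of \<open>US\<close> times
  \<open>E / 2 ^ (32 * q)\<close>, at most \<open>2 * E\<close>; a repeated \<open>None\<close> also
  stores a window, but the second factor \<open>E\<close> makes up for \<open>L * nI\<close>, since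
  \<open>2 ^ (2 * q) * 2 ^ (24 * q)\<close> is far below \<open>2 ^ (32 * q)\<close>. Storing no
  window at a first \<open>None\<close> keeps the factor \<open>nI\<close> away from the dominant
  term \<open>2 * E\<close>.\<close>

lemma VS_bound:
  "1 \<le> i \<Longrightarrow> i \<le> B \<Longrightarrow> t < L \<Longrightarrow> G (VS i) t \<le> 6 * real i * E"
proof (induction i arbitrary: t rule: nat_induct_at_least)
  case base
  have "VS 1 = {[None]}" by (auto simp: VS_def TL_def Ty_def length_Suc_conv)
  hence "G (VS 1) t = E" by (simp add: G_def E_def)
  moreover have "0 \<le> E" by (simp add: E_def)
  ultimately show ?case by simp
next
  case (Suc i)
  let ?e = "(2::real) ^ (20 * q)"
  let ?g = "(2::real) ^ (32 * q)"
  let ?v = "6 * real i * E"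
  have E0: "0 \<le> E" by (simp add: E_def)
  have IH: "G (VS i) s \<le> ?v" if "s < L" for s using Suc that by simp
  let ?A = "\<Union>\<tau>\<in>Some ` T. (#) \<tau> ` VS i" and ?B = "\<Union>\<tau>\<in>{None}. (#) \<tau> ` US i" and ?C = "\<Union>\<tau>\<in>{None}. (#) \<tau> ` VS i"
  have U: "VS (Suc i) = ?A \<union> (?B \<union> ?C)"
  proof (intro equalityI subsetI)
    fix \<kappa> assume k: "\<kappa> \<in> VS (Suc i)"
    then obtain x \<kappa>' where kk: "\<kappa> = x # \<kappa>'" "x \<in> Ty" "\<kappa>' \<in> TL i" by (auto simp: VS_def elim: TL_SucE)
    show "\<kappa> \<in> ?A \<union> (?B \<union> ?C)"
    proof (cases x)
      case None
      thus ?thesis using kk by (cases "None \<in> set \<kappa>'") (auto simp: US_def VS_def)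
    next
      case (Some y)
      thus ?thesis using kk k by (auto simp: VS_def Ty_def)
    qed
  next
    fix \<kappa> assume "\<kappa> \<in> ?A \<union> (?B \<union> ?C)"
    thus "\<kappa> \<in> VS (Suc i)" by (auto simp: VS_def US_def TL_Suc_iff Ty_def)
  qed
  have fin: "finite ?A" "finite ?B" "finite ?C"
    using T_fin by (auto simp: VS_def US_def)
  have "G (VS (Suc i)) t = G ?A t + G (?B \<union> ?C) t"
    unfolding U G_def using fin by (intro sum.union_disjoint) auto
  also have "G (?B \<union> ?C) t = G ?B t + G ?C t"
    unfolding G_def using fin by (intro sum.union_disjoint) (auto simp: VS_def US_def)
  finally have split: "G (VS (Suc i)) t = G ?A t + (G ?B t + G ?C t)" .
  have "G ?A t \<le> (\<Sum>\<tau>\<in>Some ` T. (\<Sum>s<L. G (VS i) s * real (aa \<tau> s)) * real (if False then nI else 1) / ?g * real (bb \<tau> t)) + ?e"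
    by (rule G_union[where i = i]) (use Suc in \<open>auto simp: Ty_def VS_def slot_def\<close>)
  also have "(\<Sum>\<tau>\<in>Some ` T. (\<Sum>s<L. G (VS i) s * real (aa \<tau> s)) * real (if False then nI else 1) / ?g * real (bb \<tau> t)) =
     (\<Sum>\<tau>\<in>T. \<Sum>s<L. G (VS i) s * (real (a \<tau> s) * real (b \<tau> t))) / ?g"
    by (subst sum.reindex) (simp_all add: scal flip: sum_divide_distrib)
  also have "(\<Sum>\<tau>\<in>T. \<Sum>s<L. G (VS i) s * (real (a \<tau> s) * real (b \<tau> t))) =
     (\<Sum>s<L. \<Sum>v\<in>off ` T. G (VS i) s * Kt v s t)"
    by (subst sum.swap) (use sum_T_Kt[where V = UNIV and f = "\<lambda>v. G (VS i) _"] in simp)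
  also have "\<dots> \<le> (\<Sum>s<L. \<Sum>v\<in>off ` T. ?v * Kt v s t)"
    using IH by (intro sum_mono mult_right_mono Kt_nonneg) auto
  also have "\<dots> = ?v * (\<Sum>v\<in>off ` T. \<Sum>s<L. Kt v s t)"
    by (subst sum.swap) (simp add: sum_distrib_left)
  also have "\<dots> \<le> ?v * (?g + 2 ^ (21 * q))" using Suc E0 by (intro mult_left_mono Kt_col) auto
  finally have "G ?A t \<le> ?v * (?g + 2 ^ (21 * q)) / ?g + ?e" by (simp add: divide_right_mono)
  also have "?v * (?g + 2 ^ (21 * q)) / ?g = ?v + E * (6 * real i * 2 ^ (21 * q) / ?g)" by (simp add: field_simps)
  also have "6 * real i * 2 ^ (21 * q) / ?g \<le> 1 / 2"
  proof -
    have "6 * real i * 2 ^ (21 * q) \<le> 2 ^ q * 2 ^ (21 * q)" using B_real Suc by (intro mult_right_mono) auto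
    also have "\<dots> = 2 ^ (22 * q)" by (simp flip: power_add)
    also have "\<dots> \<le> 2 ^ (32 * q - 1)" using q_ge by (intro power_increasing) auto
    also have "\<dots> = ?g / 2" using q_ge by (simp add: power_diff)
    finally show ?thesis by (simp add: field_simps)
  qed
  finally have a1: "G ?A t \<le> ?v + E * (1 / 2) + ?e" using E0 by (simp add: mult_left_mono)
  have "G ?B t \<le> (\<Sum>\<tau>\<in>{None}. (\<Sum>s<L. G (US i) s * real (aa \<tau> s)) * real (if False then nI else 1) / ?g * real (bb \<tau> t)) + ?e"
    by (rule G_union[where i = i]) (use Suc in \<open>auto simp: Ty_def US_def slot_def\<close>)
  also have "\<dots> = (\<Sum>s<L. G (US i) s) * E / ?g + ?e"
    using pull[of "\<lambda>s. G (US i) s" "real e" "{..<L}" 1 ?g "real e"] by (simp add: E_def)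
  also have "(\<Sum>s<L. G (US i) s) * E / ?g \<le> 2 * ?g * E / ?g"
    using US_bound2[of i] Suc E0 by (intro divide_right_mono mult_right_mono) auto
  finally have a2: "G ?B t \<le> 2 * E + ?e" by simp
  have "G ?C t \<le> (\<Sum>\<tau>\<in>{None}. (\<Sum>s<L. G (VS i) s * real (aa \<tau> s)) * real (if True then nI else 1) / ?g * real (bb \<tau> t)) + ?e"
    by (rule G_union[where i = i]) (use Suc in \<open>auto simp: Ty_def VS_def slot_def\<close>)
  also have "\<dots> = (\<Sum>s<L. G (VS i) s) * (real nI * E) / ?g + ?e"
    using pull[of "\<lambda>s. G (VS i) s" "real e" "{..<L}" "real nI" ?g "real e"] by (simp add: E_def)
  finally have c1: "G ?C t \<le> (\<Sum>s<L. G (VS i) s) * (real nI * E) / ?g + ?e" .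
  have c2: "(\<Sum>s<L. G (VS i) s) \<le> (\<Sum>s<L. ?v)" using IH by (intro sum_mono) auto
  have c3: "(\<Sum>s<L. G (VS i) s) * (real nI * E) / ?g \<le> (\<Sum>s<L. ?v) * (real nI * E) / ?g"
    by (intro divide_right_mono mult_right_mono c2) (use E0 in auto)
  have c4: "(\<Sum>s<L. ?v) * (real nI * E) / ?g = E * (6 * real i * (real (L * nI) * E) / ?g)" by simp
  have c5: "6 * real i * (real (L * nI) * E) / ?g \<le> 1 / 2"
  proof -
    have "real (L * nI) \<le> 2 ^ (2 * q)" using L_nI by (metis of_nat_le_iff of_nat_numeral of_nat_power)
    hence "6 * real i * (real (L * nI) * E) \<le> 2 ^ q * (2 ^ (2 * q) * 2 ^ (24 * q))"
      using B_real Suc E_le E0 by (intro mult_mono) auto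
    also have "\<dots> = 2 ^ (27 * q)" by (simp flip: power_add)
    also have "\<dots> \<le> 2 ^ (32 * q - 1)" using q_ge by (intro power_increasing) auto
    also have "\<dots> = ?g / 2" using q_ge by (simp add: power_diff)
    finally show ?thesis by (simp add: field_simps)
  qed
  have a3: "G ?C t \<le> E * (1 / 2) + ?e" using c1 c3 unfolding c4 using mult_left_mono[OF c5 E0] by linarith
  show ?case unfolding split using a1 a2 a3 E_ge by (simp add: algebra_simps)
qed

text \<open>Of the error \<open>9 * B * E\<close>, a part \<open>3 * B * E\<close> comes from
  rounding, as \<open>2 ^ (20 * q)\<close> is at most \<open>E\<close>, and \<open>6 * B * E\<close>
  from lists that contain \<open>None\<close>.\<close>

lemma card_FS: "real (card (FS N)) \<le> bet B N + 9 * real B * E"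
proof -
  have B1: "1 \<le> B" using B_ge by simp
  have t: "N mod L < L" using L_pos by simp
  have "real (card (FS N)) = G {\<kappa>\<in>TL B. None \<notin> set \<kappa> \<longrightarrow> osum \<kappa> = N div L} (N mod L)"
    by (simp add: FS_def G_def card_cartesian_product)
  also have "{\<kappa>\<in>TL B. None \<notin> set \<kappa> \<longrightarrow> osum \<kappa> = N div L} = WS B (N div L) \<union> VS B"
    by (auto simp: WS_def VS_def)
  also have "G (WS B (N div L) \<union> VS B) (N mod L) = G (WS B (N div L)) (N mod L) + G (VS B) (N mod L)"
    unfolding G_def by (rule sum.union_disjoint) (auto simp: WS_def VS_def)
  also have "\<dots> \<le> (bet B (N div L * L + N mod L) + 3 * real B * 2 ^ (20 * q)) + 6 * real B * E"
    using WS_bound[OF B1 _ t, of "N div L"] VS_bound[OF B1 _ t] by simp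
  also have "N div L * L + N mod L = N" by simp
  also have "3 * real B * 2 ^ (20 * q) \<le> 3 * real B * E" using E_ge by (intro mult_left_mono) auto
  finally show ?thesis by (simp add: algebra_simps)
qed

end

context chain
begin

section \<open>Encoding and decoding a node\<close>

definition pre :: "(nat \<Rightarrow> nat) \<Rightarrow> nat \<Rightarrow> nat" where "pre x j = (\<Sum>i<j. x i)"

definition blk :: "(nat \<Rightarrow> nat) \<Rightarrow> nat \<Rightarrow> nat" where "blk x j = pre x j div L"

definition rem :: "(nat \<Rightarrow> nat) \<Rightarrow> nat \<Rightarrow> nat" where "rem x j = pre x j mod L"

definition jmp :: "(nat \<Rightarrow> nat) \<Rightarrow> nat \<Rightarrow> nat" where "jmp x j = blk x (Suc j) - blk x j"

definition KSj :: "(nat \<Rightarrow> nat) \<Rightarrow> nat \<Rightarrow> ('t option \<times> nat \<times> nat) set" where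
  "KSj x j = KS (jmp x j) (rem x j) (rem x (Suc j))"

definition ty :: "(nat \<Rightarrow> nat) \<Rightarrow> (nat \<Rightarrow> nat) \<Rightarrow> nat \<Rightarrow> 't option" where
  "ty x k j = fst (elt (KSj x j) (k j))"

definition al :: "(nat \<Rightarrow> nat) \<Rightarrow> (nat \<Rightarrow> nat) \<Rightarrow> nat \<Rightarrow> nat" where
  "al x k j = fst (snd (elt (KSj x j) (k j)))"

definition be :: "(nat \<Rightarrow> nat) \<Rightarrow> (nat \<Rightarrow> nat) \<Rightarrow> nat \<Rightarrow> nat" where
  "be x k j = snd (snd (elt (KSj x j) (k j)))"

definition kap :: "(nat \<Rightarrow> nat) \<Rightarrow> (nat \<Rightarrow> nat) \<Rightarrow> nat \<Rightarrow> 't option list" where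
  "kap x k j = rev (map (ty x k) [0..<j])"

definition item :: "(nat \<Rightarrow> nat) \<Rightarrow> (nat \<Rightarrow> nat) \<Rightarrow> nat \<Rightarrow> nat \<times> nat \<times> nat \<times> nat" where
  "item x k j = (rem x j, be x k (j - 1), al x k j, if slot (kap x k j) (ty x k j) then blk x j else 0)"

definition zz :: "(nat \<Rightarrow> nat) \<Rightarrow> (nat \<Rightarrow> nat) \<Rightarrow> nat \<Rightarrow> nat" where
  "zz x k j = idx (ZS (kap x k j) (ty x k j)) (item x k j)"

definition Cm :: "'t option list \<Rightarrow> nat" where "Cm \<kappa> = 2 ^ (32 * q) div Y \<kappa>"

text \<open>Prefix sum 0 lies at place 0 and needs no item, so the part \<open>a\<close> of child 0
  serves as the excess entering cell 1; this matches
  \<open>Y [\<tau>] = aa \<tau> 0\<close>.\<close>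

definition yy :: "(nat \<Rightarrow> nat) \<Rightarrow> (nat \<Rightarrow> nat) \<Rightarrow> nat \<Rightarrow> nat" where
  "yy x k j = (if j = 1 then al x k 0 else zz x k (j - 1) div Cm (kap x k (j - 1)))"

definition cell :: "(nat \<Rightarrow> nat) \<Rightarrow> (nat \<Rightarrow> nat) \<Rightarrow> nat \<Rightarrow> nat" where
  "cell x k j = yy x k j * Cm (kap x k j) + zz x k j mod Cm (kap x k j)"

definition fin :: "(nat \<Rightarrow> nat) \<Rightarrow> (nat \<Rightarrow> nat) \<Rightarrow> nat" where
  "fin x k = idx (FS (pre x B)) (kap x k B, yy x k B, be x k (B - 1))"

definition valid :: "(nat \<Rightarrow> nat) \<Rightarrow> (nat \<Rightarrow> nat) \<Rightarrow> bool" where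
  "valid x k \<longleftrightarrow> (\<forall>j<B. x j \<le> S \<and> k j < K (x j))"

lemma pre_Suc: "pre x (Suc j) = pre x j + x j" by (simp add: pre_def)

lemma pre_blk: "pre x j = blk x j * L + rem x j" by (simp add: blk_def rem_def)

lemma rem_less: "rem x j < L" using L_pos by (simp add: rem_def)

lemma blk_Suc: "blk x (Suc j) = blk x j + jmp x j"
proof -
  have "pre x j \<le> pre x (Suc j)" by (simp add: pre_Suc)
  hence "blk x j \<le> blk x (Suc j)" unfolding blk_def by (rule div_le_mono)
  thus ?thesis by (simp add: jmp_def)
qed

lemma x_jmp: "x j + rem x j = jmp x j * L + rem x (Suc j)"
proof -
  have "blk x j * L + rem x j + x j = (blk x j + jmp x j) * L + rem x (Suc j)"
    using pre_Suc[of x j] pre_blk[of x j] pre_blk[of x "Suc j"] blk_Suc[of x j] by simp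
  thus ?thesis by (simp add: algebra_simps)
qed

lemma x_eq: "x j = jmp x j * L + rem x (Suc j) - rem x j"
  using x_jmp[of x j] by simp

text \<open>\<open>x j\<close> is the distance of the two neighbouring prefix sums, hence of the
  form to which \<open>cover\<close> applies.\<close>

lemma k_less: "valid x k \<Longrightarrow> j < B \<Longrightarrow> k j < card (KSj x j)"
proof -
  assume v: "valid x k" "j < B"
  have "K (jmp x j * L + rem x (Suc j) - rem x j) \<le> card (KSj x j)" unfolding KSj_def card_KS
  proof (rule cover[OF rem_less rem_less])
    show "rem x j \<le> jmp x j * L + rem x (Suc j)" using x_jmp[of x j] by linarith
    show "jmp x j * L + rem x (Suc j) - rem x j \<le> S" using v x_eq[of x j, symmetric] by (simp add: valid_def)
  qed
  hence "K (x j) \<le> card (KSj x j)" by (simp add: x_eq[symmetric])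
  thus ?thesis using v unfolding valid_def by (meson less_le_trans)
qed

lemma elt_KSj: "valid x k \<Longrightarrow> j < B \<Longrightarrow> (ty x k j, al x k j, be x k j) \<in> KSj x j"
  using elt_in[OF KS_fin k_less[unfolded KSj_def], of x k j] by (simp add: ty_def al_def be_def KSj_def)

lemma k_idx: "valid x k \<Longrightarrow> j < B \<Longrightarrow> k j = idx (KSj x j) (ty x k j, al x k j, be x k j)"
  using idx_elt[OF KS_fin k_less[unfolded KSj_def], of x k j] by (simp add: ty_def al_def be_def KSj_def)

lemma ty_Ty: "valid x k \<Longrightarrow> j < B \<Longrightarrow> ty x k j \<in> Ty"
  using elt_KSj[of x k j] by (auto simp: KSj_def KS_def Ty_def)

lemma ty_off: "valid x k \<Longrightarrow> j < B \<Longrightarrow> ty x k j \<noteq> None \<Longrightarrow> off (the (ty x k j)) = jmp x j"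
  using elt_KSj[of x k j] by (auto simp: KSj_def KS_def)

lemma al_less: "valid x k \<Longrightarrow> j < B \<Longrightarrow> al x k j < aa (ty x k j) (rem x j)"
  and be_less: "valid x k \<Longrightarrow> j < B \<Longrightarrow> be x k j < bb (ty x k j) (rem x (Suc j))"
  using elt_KSj[of x k j] by (auto simp: KSj_def KS_def)

lemma kap_Suc: "kap x k (Suc j) = ty x k j # kap x k j" by (simp add: kap_def)

lemma kap_Ty: "valid x k \<Longrightarrow> j \<le> B \<Longrightarrow> set (kap x k j) \<subseteq> Ty"
  using ty_Ty by (fastforce simp: kap_def)

lemma length_kap[simp]: "length (kap x k j) = j" by (simp add: kap_def)

lemma kap_TL: "valid x k \<Longrightarrow> j \<le> B \<Longrightarrow> kap x k j \<in> TL j"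
  using kap_Ty by (simp add: TL_def)

lemma pre_le: "valid x k \<Longrightarrow> j \<le> B \<Longrightarrow> pre x j \<le> B * S"
proof -
  assume v: "valid x k" "j \<le> B"
  have "pre x j \<le> (\<Sum>i<j. S)" unfolding pre_def using v by (intro sum_mono) (auto simp: valid_def)
  thus ?thesis using v by (simp add: le_trans)
qed

lemma blk_less: "valid x k \<Longrightarrow> j \<le> B \<Longrightarrow> blk x j < nI"
  using le_trans[OF div_le_dividend pre_le[of x k j], of L] by (simp add: blk_def nI_def)

lemma item_ZS: "valid x k \<Longrightarrow> 1 \<le> j \<Longrightarrow> j < B \<Longrightarrow> item x k j \<in> ZS (kap x k j) (ty x k j)"
proof -
  assume v: "valid x k" "1 \<le> j" "j < B"
  then obtain i where j: "j = Suc i" by (cases j) auto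
  show ?thesis using v rem_less be_less[of x k i] al_less[of x k j] blk_less[of x k j] j
    by (auto simp: item_def ZS_def kap_Suc)
qed

lemma zz_less: "valid x k \<Longrightarrow> 1 \<le> j \<Longrightarrow> j < B \<Longrightarrow> zz x k j < card (ZS (kap x k j) (ty x k j))"
  unfolding zz_def by (intro idx_less item_ZS) auto

lemma kap_ne: "1 \<le> j \<Longrightarrow> kap x k j \<noteq> []"
  using length_kap[of x k j] by (metis list.size(3) not_one_le_zero)

lemma Y_Cm: "valid x k \<Longrightarrow> 1 \<le> j \<Longrightarrow> j \<le> B \<Longrightarrow> 0 < Cm (kap x k j)"
proof -
  assume v: "valid x k" "1 \<le> j" "j \<le> B"
  have "2 * Y (kap x k j) \<le> 2 ^ (32 * q)" using Y_G kap_Ty kap_ne v by auto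
  moreover have "1 \<le> Y (kap x k j)" using Y_pos kap_Ty v by auto
  ultimately show ?thesis unfolding Cm_def by (simp add: div_greater_zero_iff)
qed

lemma yy_less: "valid x k \<Longrightarrow> 1 \<le> j \<Longrightarrow> j \<le> B \<Longrightarrow> yy x k j < Y (kap x k j)"
proof -
  assume v: "valid x k" "1 \<le> j" "j \<le> B"
  show ?thesis
  proof (cases "j = 1")
    case True
    have "rem x 0 = 0" by (simp add: rem_def pre_def)
    thus ?thesis using True al_less[of x k 0] v B_ge by (simp add: yy_def kap_def)
  next
    case False
    then obtain i where j: "j = Suc (Suc i)" using v by (metis One_nat_def not0_implies_Suc not_one_le_zero)
    have z: "zz x k (Suc i) < card (ZS (kap x k (Suc i)) (ty x k (Suc i)))" using v j by (intro zz_less) auto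
    have "zz x k (Suc i) div Cm (kap x k (Suc i)) \<le> card (ZS (kap x k (Suc i)) (ty x k (Suc i))) div Cm (kap x k (Suc i))"
      using z by (intro div_le_mono) simp
    thus ?thesis using j by (simp add: yy_def kap_Suc Cm_def)
  qed
qed

lemma cell_less: "valid x k \<Longrightarrow> 1 \<le> j \<Longrightarrow> j < B \<Longrightarrow> cell x k j < 2 ^ (32 * q)"
proof -
  assume v: "valid x k" "1 \<le> j" "j < B"
  let ?C = "Cm (kap x k j)"
  have C: "0 < ?C" using Y_Cm v by simp
  have "cell x k j < yy x k j * ?C + ?C" using C by (simp add: cell_def)
  also have "\<dots> = Suc (yy x k j) * ?C" by simp
  also have "\<dots> \<le> Y (kap x k j) * ?C" using yy_less[of x k j] v by (intro mult_le_mono1) simp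
  also have "\<dots> \<le> 2 ^ (32 * q)" unfolding Cm_def by simp
  finally show ?thesis .
qed

lemma blk_sum: "valid x k \<Longrightarrow> j \<le> i \<Longrightarrow> i \<le> B \<Longrightarrow> (\<And>r. j \<le> r \<Longrightarrow> r < i \<Longrightarrow> ty x k r \<noteq> None) \<Longrightarrow>
   blk x i = blk x j + (\<Sum>r=j..<i. off (the (ty x k r)))"
proof (induction i)
  case 0 thus ?case by simp
next
  case (Suc i)
  show ?case
  proof (cases "j = Suc i")
    case True thus ?thesis by simp
  next
    case False
    hence "j \<le> i" using Suc by simp
    thus ?thesis using Suc False by (simp add: blk_Suc ty_off)
  qed
qed

lemma set_kap: "set (kap x k j) = ty x k ` {..<j}" by (auto simp: kap_def)

lemma osum_kap: "osum (kap x k j) = (\<Sum>r<j. off (the (ty x k r)))"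
proof -
  have "osum (kap x k j) = sum_list (rev (map (\<lambda>r. off (the (ty x k r))) [0..<j]))"
    by (simp add: osum_def kap_def rev_map o_def)
  also have "\<dots> = sum_list (map (\<lambda>r. off (the (ty x k r))) [0..<j])" by (rule sum_list_rev)
  also have "\<dots> = (\<Sum>r<j. off (the (ty x k r)))" by (simp add: sum_list_distinct_conv_sum_set atLeast0LessThan)
  finally show ?thesis .
qed

lemma fin_FS: "valid x k \<Longrightarrow> (kap x k B, yy x k B, be x k (B - 1)) \<in> FS (pre x B)"
proof -
  assume v: "valid x k"
  have "osum (kap x k B) = pre x B div L" if "None \<notin> set (kap x k B)"
  proof -
    have "blk x B = blk x 0 + (\<Sum>r=0..<B. off (the (ty x k r)))"
    proof (intro blk_sum v)
      fix r assume "r < B"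
      thus "ty x k r \<noteq> None" using that unfolding set_kap by (metis imageI lessThan_iff)
    qed auto
    thus ?thesis by (simp add: osum_kap blk_def pre_def atLeast0LessThan)
  qed
  moreover have "hd (kap x k B) = ty x k (B - 1)" using B_ge kap_Suc[of x k "B - 1"] by simp
  ultimately show ?thesis using v kap_TL[of x k B] yy_less[of x k B] be_less[of x k "B - 1"] B_ge
    by (simp add: FS_def rem_def)
qed

lemma fin_less: "valid x k \<Longrightarrow> fin x k < card (FS (pre x B))"
  unfolding fin_def by (intro idx_less fin_FS) auto

text \<open>Item \<open>j\<close> is spread over two cells: its remainder lies in cell
  \<open>j\<close> and its quotient is the excess in cell \<open>j + 1\<close>. Cells outside
  \<open>1..<B\<close> do not exist; what they would hold is fixed or part of the spill.\<close>

definition agree :: "(nat \<Rightarrow> nat) \<Rightarrow> (nat \<Rightarrow> nat) \<Rightarrow> (nat \<Rightarrow> nat) \<Rightarrow> (nat \<Rightarrow> nat) \<Rightarrow> nat \<Rightarrow> bool" where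
  "agree x k x' k' j \<longleftrightarrow> (\<forall>i\<in>{j, Suc j}. 1 \<le> i \<longrightarrow> i < B \<longrightarrow> cell x k i = cell x' k' i)"

text \<open>The next child of type \<open>None\<close>, the place where the window of prefix sum
  \<open>j\<close> may be stored. Without such a child the window follows otherwise, and the default
  \<open>j\<close> merely names a legal probe. Lists of types are reversed, hence the index
  \<open>B - Suc r\<close>.\<close>

definition nx :: "'t option list \<Rightarrow> nat \<Rightarrow> nat" where
  "nx \<kappa> j = (if \<exists>r. j \<le> r \<and> r < B \<and> \<kappa> ! (B - Suc r) = None then LEAST r. j \<le> r \<and> r < B \<and> \<kappa> ! (B - Suc r) = None else j)"

section \<open>Decoding a child, as injectivity of the code with respect to what is read\<close>

context
  fixes x k x' k'
  assumes v: "valid x k" and v': "valid x' k'" and N: "pre x B = pre x' B" and f: "fin x k = fin x' k'"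
begin

lemma fin_eq: "kap x k B = kap x' k' B" "yy x k B = yy x' k' B" "be x k (B - 1) = be x' k' (B - 1)"
proof -
  have "(kap x k B, yy x k B, be x k (B - 1)) = (kap x' k' B, yy x' k' B, be x' k' (B - 1))"
    using f fin_FS[OF v] fin_FS[OF v'] unfolding fin_def N[symmetric] by (intro idx_inject[OF FS_fin]) (auto simp: N)
  thus "kap x k B = kap x' k' B" "yy x k B = yy x' k' B" "be x k (B - 1) = be x' k' (B - 1)" by auto
qed

lemma ty_kap: "j < B \<Longrightarrow> kap x k B ! (B - Suc j) = ty x k j"
  by (simp add: kap_def rev_nth)

lemma ty_eq: "j < B \<Longrightarrow> ty x k j = ty x' k' j"
proof -
  assume j: "j < B"
  have "kap x k B ! (B - Suc j) = ty x k j" using j by (simp add: kap_def rev_nth)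
  moreover have "kap x' k' B ! (B - Suc j) = ty x' k' j" using j by (simp add: kap_def rev_nth)
  ultimately show ?thesis using fin_eq(1) by simp
qed

lemma kap_eq: "j \<le> B \<Longrightarrow> kap x k j = kap x' k' j"
  unfolding kap_def using ty_eq by simp

lemma cell_eq:
  assumes j: "1 \<le> j" "j < B" and c: "cell x k j = cell x' k' j"
  shows "yy x k j = yy x' k' j \<and> zz x k j mod Cm (kap x k j) = zz x' k' j mod Cm (kap x k j)"
proof -
  let ?C = "Cm (kap x k j)"
  have C: "0 < ?C" using Y_Cm v j by simp
  have kk: "kap x' k' j = kap x k j" using kap_eq[of j] j by simp
  have "cell x k j div ?C = yy x k j" "cell x k j mod ?C = zz x k j mod ?C"
    "cell x' k' j div ?C = yy x' k' j" "cell x' k' j mod ?C = zz x' k' j mod ?C"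
    using C by (simp_all add: cell_def kk)
  thus ?thesis using c by metis
qed

text \<open>Remainder and quotient of the item's number are both known, the quotient from the next
  cell or, for the last prefix sum, from the excess kept in the spill.\<close>

lemma item_eq:
  assumes j: "1 \<le> j" "j < B" and c: "agree x k x' k' j"
  shows "item x k j = item x' k' j"
proof -
  let ?C = "Cm (kap x k j)"
  have kk: "kap x' k' j = kap x k j" using kap_eq[of j] j by simp
  have m: "zz x k j mod ?C = zz x' k' j mod ?C" using cell_eq[OF j] c j by (simp add: agree_def)
  have "yy x k (Suc j) = yy x' k' (Suc j)"
  proof (cases "Suc j = B")
    case True thus ?thesis using fin_eq(2) by simp
  next
    case False thus ?thesis using cell_eq[of "Suc j"] c j by (simp add: agree_def)
  qed
  hence "zz x k j div ?C = zz x' k' j div ?C" using j by (simp add: yy_def kk)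
  hence "zz x k j = zz x' k' j" using m by (metis div_mult_mod_eq)
  thus ?thesis using item_ZS[OF v j] item_ZS[OF v' j] ty_eq[OF j(2)] kk
    unfolding zz_def by (intro idx_inject[OF ZS_fin]) auto
qed

lemma rem_eq: "j \<le> B \<Longrightarrow> agree x k x' k' j \<Longrightarrow> rem x j = rem x' j"
proof -
  assume j: "j \<le> B" "agree x k x' k' j"
  consider "j = 0" | "j = B" | "1 \<le> j" "j < B" using j by linarith
  thus ?thesis
  proof cases
    case 1 thus ?thesis by (simp add: rem_def pre_def)
  next
    case 2 thus ?thesis using N by (simp add: rem_def)
  next
    case 3 thus ?thesis using item_eq[OF 3 j(2)] by (simp add: item_def)
  qed
qed

lemma al_eq: "j < B \<Longrightarrow> agree x k x' k' j \<Longrightarrow> al x k j = al x' k' j"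
proof -
  assume j: "j < B" "agree x k x' k' j"
  show ?thesis
  proof (cases "j = 0")
    case True
    hence "cell x k 1 = cell x' k' 1" using j B_ge by (simp add: agree_def)
    hence "yy x k 1 = yy x' k' 1" using cell_eq[of 1] B_ge by simp
    thus ?thesis using True by (simp add: yy_def)
  next
    case False thus ?thesis using item_eq[of j] j by (simp add: item_def)
  qed
qed

lemma be_eq: "j < B \<Longrightarrow> agree x k x' k' (Suc j) \<Longrightarrow> be x k j = be x' k' j"
proof -
  assume j: "j < B" "agree x k x' k' (Suc j)"
  show ?thesis
  proof (cases "Suc j = B")
    case True thus ?thesis using fin_eq(3) by (metis diff_Suc_1)
  next
    case False thus ?thesis using item_eq[of "Suc j"] j by (simp add: item_def)
  qed
qed

text \<open>If no \<open>None\<close> lies to the left, the offsets determine the window starting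
  from 0. If \<open>None\<close> occurs on both sides, the nearest one to the right has a slot, and
  the offsets lead back from it. If \<open>None\<close> occurs only to the left, they lead back from
  the total \<open>N\<close>.\<close>

lemma blk_eq:
  assumes j: "j \<le> B" and c: "agree x k x' k' (nx (kap x k B) j)"
  shows "blk x j = blk x' j"
proof (cases "\<exists>r<j. ty x k r = None")
  case False
  have "blk x j = blk x 0 + (\<Sum>r=0..<j. off (the (ty x k r)))"
    using False j by (intro blk_sum v) auto
  moreover have "blk x' j = blk x' 0 + (\<Sum>r=0..<j. off (the (ty x' k' r)))"
    using False j ty_eq by (intro blk_sum v') auto
  moreover have "(\<Sum>r=0..<j. off (the (ty x k r))) = (\<Sum>r=0..<j. off (the (ty x' k' r)))"
    using ty_eq j by (intro sum.cong) auto
  ultimately show ?thesis by (simp add: blk_def pre_def)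
next
  case True
  then obtain r0 where r0: "r0 < j" "ty x k r0 = None" by auto
  have eqv: "(j \<le> r \<and> r < B \<and> kap x k B ! (B - Suc r) = None) = (j \<le> r \<and> r < B \<and> ty x k r = None)" for r
    using ty_kap by auto
  show ?thesis
  proof (cases "\<exists>r. j \<le> r \<and> r < B \<and> ty x k r = None")
    case ex: True
    let ?m = "LEAST r. j \<le> r \<and> r < B \<and> ty x k r = None"
    have nx: "nx (kap x k B) j = ?m" unfolding nx_def eqv using ex by simp
    have m: "j \<le> ?m" "?m < B" "ty x k ?m = None" using LeastI_ex[OF ex] by auto
    have least: "ty x k r \<noteq> None" if "j \<le> r" "r < ?m" for r
      using not_less_Least[OF that(2)] that m by auto
    have m1: "1 \<le> ?m" using m r0 by simp
    have "r0 \<in> {..<?m}" using r0 m by simp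
    hence "ty x k r0 \<in> ty x k ` {..<?m}" by (rule imageI)
    hence "None \<in> set (kap x k ?m)" unfolding set_kap r0(2) .
    hence sl: "slot (kap x k ?m) (ty x k ?m)" using m by (simp add: slot_def)
    hence sl': "slot (kap x' k' ?m) (ty x' k' ?m)" using kap_eq[of ?m] ty_eq[of ?m] m by simp
    have "item x k ?m = item x' k' ?m" using item_eq[OF m1 m(2)] c nx by simp
    hence bm: "blk x ?m = blk x' ?m" using sl sl' by (simp add: item_def)
    have "blk x ?m = blk x j + (\<Sum>r=j..<?m. off (the (ty x k r)))"
      using m least by (intro blk_sum v) auto
    moreover have "blk x' ?m = blk x' j + (\<Sum>r=j..<?m. off (the (ty x' k' r)))"
      using m least ty_eq by (intro blk_sum v') auto
    moreover have "(\<Sum>r=j..<?m. off (the (ty x k r))) = (\<Sum>r=j..<?m. off (the (ty x' k' r)))"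
      using ty_eq m by (intro sum.cong) auto
    ultimately show ?thesis using bm by simp
  next
    case nex: False
    have "blk x B = blk x j + (\<Sum>r=j..<B. off (the (ty x k r)))"
      using nex j by (intro blk_sum v) auto
    moreover have "blk x' B = blk x' j + (\<Sum>r=j..<B. off (the (ty x' k' r)))"
      using nex j ty_eq by (intro blk_sum v') auto
    moreover have "(\<Sum>r=j..<B. off (the (ty x k r))) = (\<Sum>r=j..<B. off (the (ty x' k' r)))"
      using ty_eq by (intro sum.cong) auto
    moreover have "blk x B = blk x' B" using N by (simp add: blk_def)
    ultimately show ?thesis by simp
  qed
qed

text \<open>Places and windows at both ends of the child give \<open>x i\<close> and the set
  \<open>KSj x i\<close> in which \<open>k i\<close> is numbered; the type and the two parts then
  determine \<open>k i\<close>.\<close>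

lemma child_eq:
  assumes i: "i < B" and c: "agree x k x' k' i" "agree x k x' k' (Suc i)"
    "agree x k x' k' (nx (kap x k B) i)" "agree x k x' k' (nx (kap x k B) (Suc i))"
  shows "pre x i = pre x' i" "x i = x' i" "k i = k' i"
proof -
  have r: "rem x i = rem x' i" "rem x (Suc i) = rem x' (Suc i)" using rem_eq i c by auto
  have b: "blk x i = blk x' i" "blk x (Suc i) = blk x' (Suc i)" using blk_eq i c by auto
  show "pre x i = pre x' i" by (simp add: pre_blk r b)
  have j: "jmp x i = jmp x' i" by (simp add: jmp_def b)
  show "x i = x' i" unfolding x_eq[of x i] x_eq[of x' i] by (simp add: r j)
  have "KSj x i = KSj x' i" by (simp add: KSj_def r j)
  thus "k i = k' i" using k_idx[OF v i] k_idx[OF v' i] ty_eq[OF i] al_eq[OF i c(1)] be_eq[OF i c(2)] by simp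
qed

end

text \<open>Requests for cells that do not exist become dummy probes of index 0, so that each node
  costs the same number of probes.\<close>

definition clamp :: "nat \<Rightarrow> nat" where "clamp i = (if 1 \<le> i \<and> i < B then i - 1 else 0)"

text \<open>
  Child \<open>i\<close> lies between the prefix sums \<open>i\<close> and \<open>Suc i\<close>; the last four probes find their windows. Cell \<open>j\<close> is
  stored at index \<open>j - 1\<close>.
\<close>

definition pr :: "nat \<Rightarrow> nat \<Rightarrow> nat \<Rightarrow> nat \<Rightarrow> nat" where
  "pr N c i r = (let \<kappa> = fst (elt (FS N) c) in
     map clamp [i, Suc i, Suc i, Suc (Suc i), nx \<kappa> i, Suc (nx \<kappa> i), nx \<kappa> (Suc i), Suc (nx \<kappa> (Suc i))] ! r)"

text \<open>Any code consistent with the values read is chosen. By \<open>child_eq\<close> all of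
  them agree on child \<open>i\<close>, and since decoding is tabulated, no procedure has to be
  given.\<close>

definition dec :: "nat \<Rightarrow> nat \<Rightarrow> nat \<Rightarrow> (nat \<Rightarrow> nat) \<Rightarrow> nat \<times> nat \<times> nat" where
  "dec N c i vs = (SOME y. \<exists>x k. valid x k \<and> pre x B = N \<and> fin x k = c \<and>
      (\<forall>r<8. vs r = cell x k (Suc (pr N c i r))) \<and> y = (pre x i, x i, k i))"

lemma pr_less: "r < 8 \<Longrightarrow> pr N c i r < B - 1"
proof -
  assume r: "r < 8"
  have "\<And>i. clamp i < B - 1" using B_ge by (auto simp: clamp_def)
  thus ?thesis using r by (simp only: pr_def Let_def nth_map length_map list.size)
qed

lemma less8: "(\<forall>r<8. P r) \<longleftrightarrow> P 0 \<and> P 1 \<and> P 2 \<and> P 3 \<and> P 4 \<and> P 5 \<and> P 6 \<and> P (7::nat)"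
  by (simp add: numeral_eq_Suc All_less_Suc) blast

lemma agree_clamp: "cell x k (Suc (clamp j)) = cell x' k' (Suc (clamp j)) \<Longrightarrow>
  cell x k (Suc (clamp (Suc j))) = cell x' k' (Suc (clamp (Suc j))) \<Longrightarrow> agree x k x' k' j"
  by (auto simp: agree_def clamp_def split: if_splits)

lemma dec_correct:
  assumes v: "valid x k" and i: "i < B" and N: "N = pre x B" and c: "c = fin x k"
    and vs: "\<And>r. r < 8 \<Longrightarrow> vs r = cell x k (Suc (pr N c i r))"
  shows "dec N c i vs = (pre x i, x i, k i)"
proof -
  have ek: "elt (FS N) c = (kap x k B, yy x k B, be x k (B - 1))"
    unfolding c fin_def N by (rule elt_idx) (use fin_FS[OF v] in auto)
  have pr: "pr N c i r = map clamp [i, Suc i, Suc i, Suc (Suc i), nx (kap x k B) i, Suc (nx (kap x k B) i),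
      nx (kap x k B) (Suc i), Suc (nx (kap x k B) (Suc i))] ! r" for r
    by (simp only: pr_def ek fst_conv Let_def)
  show ?thesis unfolding dec_def
  proof (rule some_equality)
    show "\<exists>xa ka. valid xa ka \<and> pre xa B = N \<and> fin xa ka = c \<and>
        (\<forall>r<8. vs r = cell xa ka (Suc (pr N c i r))) \<and> (pre x i, x i, k i) = (pre xa i, xa i, ka i)"
      using v N c vs by blast
  next
    fix y assume "\<exists>xa ka. valid xa ka \<and> pre xa B = N \<and> fin xa ka = c \<and>
        (\<forall>r<8. vs r = cell xa ka (Suc (pr N c i r))) \<and> y = (pre xa i, xa i, ka i)"
    then obtain x' k' where v': "valid x' k'" and N': "pre x B = pre x' B" and c': "fin x k = fin x' k'"
      and vs': "\<forall>r<8. vs r = cell x' k' (Suc (pr N c i r))" and y: "y = (pre x' i, x' i, k' i)" using N c by auto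
    have "\<forall>r<8. cell x k (Suc (pr N c i r)) = cell x' k' (Suc (pr N c i r))" using vs vs' by simp
    hence "agree x k x' k' i" "agree x k x' k' (Suc i)" "agree x k x' k' (nx (kap x k B) i)" "agree x k x' k' (nx (kap x k B) (Suc i))"
      unfolding pr less8 by (auto intro!: agree_clamp)
    from child_eq[OF v v' N' c' i this] show "y = (pre x i, x i, k i)" using y by simp
  qed
qed

end

section \<open>Nonnegative decomposition of binomial coefficients\<close>

lemma binomial_term_le: "0 \<le> y \<Longrightarrow> real (n choose x) * y ^ x \<le> (1 + y) ^ n"
proof (cases "x \<le> n")
  case True
  assume y: "0 \<le> y"
  have "real (n choose x) * y ^ x \<le> (\<Sum>k\<le>n. real (n choose k) * y ^ k)"
    using True y by (intro member_le_sum[where f = "\<lambda>k. real (n choose k) * y ^ k"]) auto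
  also have "\<dots> = (y + 1) ^ n" by (simp add: binomial_ring)
  finally show ?thesis by (simp add: add.commute)
qed (simp add: binomial_eq_0)

lemma binomial_upper_tail:
  assumes n: "1 \<le> n" and d: "d * sqrt (real n) \<le> real x - real n / 2"
  shows "real (n choose x) / 2 ^ n \<le> exp (1 / 2 - d)"
proof -
  \<comment> \<open>Exponential moment at \<open>1 / sqrt n\<close>, chosen to make
    \<open>n * \<theta>\<^sup>2 = 1\<close>. Decay exponential in \<open>d\<close>, weaker than
    Gaussian, suffices because windows up to \<open>g\<close> multiples of \<open>sqrt S\<close> are
    kept.\<close>
  define \<theta> where "\<theta> = 1 / sqrt (real n)"
  have s0: "0 < sqrt (real n)" "1 \<le> sqrt (real n)" using n by auto
  have th: "0 \<le> \<theta>" "\<theta> \<le> 1" using s0 by (simp_all add: \<theta>_def)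
  have t2: "real n * \<theta>\<^sup>2 = 1" using n by (simp add: \<theta>_def power_divide)
  have "exp \<theta> \<le> 1 + \<theta> + \<theta>\<^sup>2" using th by (intro exp_bound) auto
  hence "(1 + exp \<theta>) / 2 \<le> 1 + (\<theta> / 2 + \<theta>\<^sup>2 / 2)" by simp
  also have "\<dots> \<le> exp (\<theta> / 2 + \<theta>\<^sup>2 / 2)" by (rule exp_ge_add_one_self)
  finally have "((1 + exp \<theta>) / 2) ^ n \<le> exp (\<theta> / 2 + \<theta>\<^sup>2 / 2) ^ n"
    using add_nonneg_nonneg[of 1 "exp \<theta>"] by (intro power_mono) auto
  also have "\<dots> = exp (real n * (\<theta> / 2 + \<theta>\<^sup>2 / 2))" by (simp add: exp_of_nat_mult)
  also have "real n * (\<theta> / 2 + \<theta>\<^sup>2 / 2) = real n * \<theta> / 2 + 1 / 2" using t2 by (simp add: distrib_left)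
  finally have 1: "(1 + exp \<theta>) ^ n / 2 ^ n \<le> exp (real n * \<theta> / 2 + 1 / 2)" by (simp add: power_divide)
  have "real (n choose x) * exp \<theta> ^ x \<le> (1 + exp \<theta>) ^ n" by (rule binomial_term_le) simp
  hence "real (n choose x) * exp \<theta> ^ x / 2 ^ n \<le> (1 + exp \<theta>) ^ n / 2 ^ n" by (intro divide_right_mono) auto
  also note 1
  finally have "real (n choose x) / 2 ^ n * exp (real x * \<theta>) \<le> exp (real n * \<theta> / 2 + 1 / 2)"
    by (simp add: exp_of_nat_mult)
  hence "real (n choose x) / 2 ^ n \<le> exp (real n * \<theta> / 2 + 1 / 2) / exp (real x * \<theta>)"
    by (simp add: pos_le_divide_eq)
  also have "\<dots> = exp (real n * \<theta> / 2 + 1 / 2 - real x * \<theta>)" by (simp add: exp_diff)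
  also have "\<dots> \<le> exp (1 / 2 - d)"
  proof -
    have "d \<le> (real x - real n / 2) * \<theta>" using d s0 by (simp add: \<theta>_def field_simps)
    thus ?thesis by (simp add: algebra_simps)
  qed
  finally show ?thesis .
qed

lemma binomial_tail:
  assumes n: "1 \<le> n" and d: "d * sqrt (real n) \<le> \<bar>real x - real n / 2\<bar>"
  shows "real (n choose x) / 2 ^ n \<le> exp (1 / 2 - d)"
proof (cases "real x \<ge> real n / 2")
  case True thus ?thesis using d n by (intro binomial_upper_tail) auto
next
  case False
  hence x: "x \<le> n" by linarith
  have "real (n choose (n - x)) / 2 ^ n \<le> exp (1 / 2 - d)"
    using d n False x by (intro binomial_upper_tail) (auto simp: of_nat_diff abs_if)
  thus ?thesis using binomial_symmetric[OF x] by simp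
qed

text \<open>Squaring avoids roots: the quotient of consecutive central coefficients is
  \<open>2 * (2 * k + 1) / (k + 1)\<close>, and the step reduces to
  \<open>(2 * k + 1) * (2 * k + 3) \<le> (2 * k + 2)\<^sup>2\<close>.\<close>

lemma central_binomial_sq: "((2 * k choose k)\<^sup>2) * (2 * k + 1) \<le> 16 ^ k"
proof (induction k)
  case 0 thus ?case by simp
next
  case (Suc k)
  define c c' d where "c = (2 * k choose k)" and "c' = (2 * Suc k choose Suc k)" and "d = ((2 * k + 1) choose k)"
  have 1: "Suc k * c' = (2 * Suc k) * d"
    using Suc_times_binomial_eq[of "2 * k + 1" k] unfolding c'_def d_def by (simp add: mult.commute)
  have 2: "Suc k * d = (2 * k + 1) * c"
    using binomial_absorb_comp[of "2 * k + 1" k] unfolding c_def d_def by simp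
  have "Suc k * c' = Suc k * (2 * d)" unfolding 1 by (simp only: ac_simps)
  hence c': "c' = 2 * d" by (simp only: Suc_mult_cancel1)
  have "(Suc k)\<^sup>2 * c'\<^sup>2 = 4 * (Suc k * d)\<^sup>2" unfolding c' by (simp only: power_mult_distrib) simp
  also have "\<dots> = 4 * (2 * k + 1)\<^sup>2 * c\<^sup>2" unfolding 2 by (simp only: power_mult_distrib mult.assoc)
  finally have 3: "(Suc k)\<^sup>2 * c'\<^sup>2 = 4 * (2 * k + 1)\<^sup>2 * c\<^sup>2" .
  have "(Suc k)\<^sup>2 * (c'\<^sup>2 * (2 * Suc k + 1)) = ((Suc k)\<^sup>2 * c'\<^sup>2) * (2 * k + 3)" by (simp add: algebra_simps)
  also have "\<dots> = 4 * (2 * k + 1) * (2 * k + 3) * (c\<^sup>2 * (2 * k + 1))"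
    unfolding 3 by (simp only: power2_eq_square ac_simps)
  also have "\<dots> \<le> 4 * (2 * k + 1) * (2 * k + 3) * 16 ^ k" using Suc unfolding c_def by (intro mult_le_mono2)
  also have "\<dots> \<le> (16 * (Suc k)\<^sup>2) * 16 ^ k" by (intro mult_le_mono1) (simp add: power2_eq_square algebra_simps)
  finally have "(Suc k)\<^sup>2 * (c'\<^sup>2 * (2 * Suc k + 1)) \<le> (Suc k)\<^sup>2 * 16 ^ Suc k" by (simp only: power_Suc ac_simps)
  hence "c'\<^sup>2 * (2 * Suc k + 1) \<le> 16 ^ Suc k" by (rule mult_left_le_imp_le) simp
  thus ?case unfolding c'_def .
qed

lemma binomial_le_central:
  assumes "even n" "1 \<le> n"
  shows "real (n choose x) / 2 ^ n \<le> 1 / sqrt (real n)"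
proof -
  obtain k where k: "n = 2 * k" using assms by (elim evenE)
  have "(n choose x)\<^sup>2 * n \<le> (2 * k choose k)\<^sup>2 * (2 * k + 1)"
    using binomial_maximum[of n x] k by (intro mult_le_mono power_mono) auto
  also have "\<dots> \<le> 16 ^ k" by (rule central_binomial_sq)
  also have "(16::nat) ^ k = (2 ^ 4) ^ k" by simp
  also have "\<dots> = (2 ^ n)\<^sup>2" unfolding k by (simp only: power_mult[symmetric]) (simp add: mult.commute)
  finally have "real ((n choose x)\<^sup>2 * n) \<le> real ((2 ^ n)\<^sup>2)" using of_nat_le_iff by blast
  hence "(real (n choose x) * sqrt (real n))\<^sup>2 \<le> (2 ^ n)\<^sup>2" by (simp add: power_mult_distrib)
  hence "real (n choose x) * sqrt (real n) \<le> 2 ^ n" by (rule power2_le_imp_le) simp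
  thus ?thesis using assms by (simp add: field_simps)
qed

text \<open>Each of the last \<open>j\<close> quotients \<open>(n - r) / (r + 1)\<close> of
  consecutive coefficients is at least \<open>4 * L\<close>. This is the source of the geometric
  decay.\<close>

lemma binomial_shift_le:
  assumes "4 * L * s + s \<le> n + 1" "j \<le> s"
  shows "(4 * L) ^ j * (n choose (s - j)) \<le> n choose s"
  using assms(2)
proof (induction j)
  case 0 thus ?case by simp
next
  case (Suc j)
  define r where "r = s - Suc j"
  have r: "s - j = Suc r" "Suc r \<le> s" using Suc by (auto simp: r_def)
  have L: "4 * L * Suc r \<le> 4 * L * s" using r by (intro mult_le_mono2)
  have rn: "4 * L * Suc r \<le> n - r" using assms(1) r L by linarith
  have "Suc r * (n choose Suc r) = (n - r) * (n choose r)"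
  proof (cases "n = 0")
    case True thus ?thesis by (cases r) auto
  next
    case False thus ?thesis using binomial_absorption[of r n] binomial_absorb_comp[of n r] by simp
  qed
  hence "(4 * L * Suc r) * (n choose r) \<le> Suc r * (n choose Suc r)"
    using mult_le_mono1[OF rn, of "n choose r"] by (simp only:)
  hence "Suc r * ((4 * L) * (n choose r)) \<le> Suc r * (n choose Suc r)"
    by (simp only: ac_simps)
  hence "(4 * L) * (n choose r) \<le> n choose Suc r" by (rule mult_left_le_imp_le) simp
  hence "(4 * L) ^ j * ((4 * L) * (n choose r)) \<le> (4 * L) ^ j * (n choose (s - j))" unfolding r by (rule mult_le_mono2)
  also have "\<dots> \<le> n choose s" using Suc by simp
  finally show ?case by (simp add: r_def ac_simps)
qed

text \<open>A falling factorial of \<open>n\<close> is at most \<open>n ^ s\<close>, a rising one of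
  \<open>m\<close> at least \<open>m ^ s\<close>; the statement is their quotient without
  denominators.\<close>

lemma binomial_ratio: "(n choose s) * m ^ s \<le> n ^ s * ((m + s) choose s)"
proof (induction s)
  case 0 thus ?case by simp
next
  case (Suc s)
  have n: "Suc s * (n choose Suc s) = (n - s) * (n choose s)"
  proof (cases "n = 0")
    case True thus ?thesis by (cases s) auto
  next
    case False thus ?thesis using binomial_absorption[of s n] binomial_absorb_comp[of n s] by simp
  qed
  have m: "Suc s * ((m + Suc s) choose Suc s) = (m + Suc s) * ((m + s) choose s)"
    using Suc_times_binomial_eq[of "m + s" s] by (simp add: mult.commute)
  have "Suc s * ((n choose Suc s) * m ^ Suc s) = (Suc s * (n choose Suc s)) * m ^ Suc s" by (simp only: mult.assoc)
  also have "\<dots> = ((n - s) * m) * ((n choose s) * m ^ s)" unfolding n by (simp only: power_Suc ac_simps)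
  also have "\<dots> \<le> (n * (m + Suc s)) * (n ^ s * ((m + s) choose s))"
    by (rule mult_le_mono[OF _ Suc]) (intro mult_le_mono, auto)
  also have "\<dots> = n ^ Suc s * ((m + Suc s) * ((m + s) choose s))" by (simp only: power_Suc ac_simps)
  also have "\<dots> = Suc s * (n ^ Suc s * ((m + Suc s) choose Suc s))"
    unfolding m[symmetric] by (simp only: ac_simps)
  finally show ?case by (rule mult_left_le_imp_le) simp
qed

lemma binomial_window:
  fixes n m s t :: nat
  assumes "s \<le> n" "t \<le> m"
  shows "real (n + t choose s) * real (m + s choose t) * real (n + m choose (n + t)) =
     real (n + m choose (n + t - s)) * (real (m + s choose s) * real (m choose t))"
proof -
  have 1: "real (n + t choose s) = fact (n + t) / (fact s * fact (n + t - s))"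
    using assms by (intro binomial_fact) auto
  have 2: "real (m + s choose t) = fact (m + s) / (fact t * fact (m + s - t))"
    using assms by (intro binomial_fact) auto
  have 3: "real (n + m choose (n + t)) = fact (n + m) / (fact (n + t) * fact (m - t))"
    using assms binomial_fact[of "n + t" "n + m", where 'a = real] by simp
  have e: "n + m - (n + t - s) = m + s - t" using assms by simp
  have 4: "real (n + m choose (n + t - s)) = fact (n + m) / (fact (n + t - s) * fact (m + s - t))"
    using assms binomial_fact[of "n + t - s" "n + m", where 'a = real] e by simp
  have 5: "real (m + s choose s) = fact (m + s) / (fact s * fact m)"
    using binomial_fact[of s "m + s", where 'a = real] by simp
  have 6: "real (m choose t) = fact m / (fact t * fact (m - t))"
    using assms by (intro binomial_fact) auto
  show ?thesis unfolding 1 2 3 4 5 6 by (simp add: field_simps)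
qed


section \<open>Windows of prefix sums and the separated terms\<close>

locale window =
  fixes q S :: nat
  assumes q16: "16 \<le> q" and Sev: "even S" and S1: "1 \<le> S"
begin

definition g :: nat where "g = 32 * q"

definition sd :: real where "sd = sqrt (real S)"

text \<open>Small enough for the quotient of the two coefficients in \<open>wide\<close> to stay
  below \<open>exp 1\<close> throughout a window: its logarithm grows by at most
  \<open>5 * g / sd\<close> per position. At low levels \<open>S\<close> is too small for this and
  every window is a single value, whence \<open>max 1\<close>.\<close>

definition L :: nat where "L = max 1 (nat \<lfloor>sd / (8 * real g)\<rfloor>)"

text \<open>Offsets near the mean. Farther out the binomial coefficient is so small that the type
  \<open>None\<close> takes over.\<close>

definition Off :: "nat set" where "Off = {v. \<bar>real (v * L) - real S / 2\<bar> \<le> real g * sd}"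

text \<open>
  With \<open>x = v L\<close>, \<open>S choose (x + t - s)\<close> equals
  \<open>(S choose (x + t)) (x + t choose s) (S - x + s choose t) / ((S - x + s choose s) (S - x choose t))\<close>.
  Vandermonde's identity applied to the second and the third factor separates \<open>s\<close> from \<open>t\<close>. The powers of \<open>L\<close>
  cancel in \<open>A * Bf\<close> and keep both factors bounded.
\<close>

definition A :: "nat \<times> nat \<times> nat \<Rightarrow> nat \<Rightarrow> real" where
  "A = (\<lambda>(v, i, j) s. if j \<le> s then real (v * L choose (s - j)) * real (s choose i) / real (S - v * L + s choose s)
      * real L ^ j / real L ^ i else 0)"

definition Bf :: "nat \<times> nat \<times> nat \<Rightarrow> nat \<Rightarrow> real" where
  "Bf = (\<lambda>(v, i, j) t. if i \<le> t then real (S choose (v * L + t)) / 2 ^ S * real (S - v * L choose (t - i)) / real (S - v * L choose t)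
      * real (t choose j) * real L ^ i / real L ^ j else 0)"

lemma g512: "512 \<le> g" using q16 by (simp add: g_def)

lemma sd1: "1 \<le> sd" "0 < sd" "sd * sd = real S" using S1 by (auto simp: sd_def)

lemma L1: "1 \<le> L" by (simp add: L_def)

lemma L_cases:
  obtains "L = 1" "sd < 16 * real g" | "2 \<le> L" "16 * real g \<le> sd" "real L \<le> sd / (8 * real g)" "sd / (16 * real g) \<le> real L"
proof (cases "sd < 16 * real g")
  case True
  hence "sd / (8 * real g) < 2" using g512 by (simp add: field_simps)
  hence "nat \<lfloor>sd / (8 * real g)\<rfloor> \<le> 1" by linarith
  hence "L = 1" by (simp add: L_def)
  thus ?thesis using True that by simp
next
  case False
  let ?y = "sd / (8 * real g)"
  have y2: "2 \<le> ?y" using False g512 by (simp add: field_simps)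
  hence L: "L = nat \<lfloor>?y\<rfloor>" by (simp add: L_def)
  hence "real L \<le> ?y" "?y < real L + 1" "2 \<le> L" using y2 by linarith+
  moreover have "sd / (16 * real g) = ?y / 2" by simp
  ultimately show ?thesis using that(2) False by linarith
qed

lemma L_sd: "real L \<le> sd"
proof (cases rule: L_cases)
  case 1 thus ?thesis using sd1 by simp
next
  case 2
  have "sd / (8 * real g) \<le> sd / 1" using g512 sd1 by (intro divide_left_mono) auto
  thus ?thesis using 2 by simp
qed

lemma L_sd': "sd / (16 * real g) \<le> real L"
proof (cases rule: L_cases)
  case 1 thus ?thesis using g512 by (simp add: field_simps)
qed

lemma L_S: "L * L \<le> S"
proof -
  have "real L * real L \<le> sd * sd" using L_sd by (intro mult_mono) (use sd1 in auto)
  hence "real (L * L) \<le> real S" using sd1 by simp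
  thus ?thesis by linarith
qed

text \<open>\<open>L \<ge> 2\<close> forces \<open>sd \<ge> 16 * g\<close>, so \<open>g * sd\<close>
  is at most \<open>S / 16\<close>: all offsets kept lie in the middle of the row, while
  \<open>L * L\<close> is at most \<open>S / 64\<close>.\<close>

lemma wide:
  assumes L2: "2 \<le> L" and v: "v \<in> Off" and s: "s < L"
  shows "v * L \<le> S" "4 * L * s + s \<le> v * L + 1" "4 * L * s + s \<le> (S - v * L) + 1" "s \<le> v * L" "s \<le> S - v * L" "1 \<le> v"
    "real (v * L choose s) / real (S - v * L + s choose s) \<le> 3"
proof -
  from L2 have c: "16 * real g \<le> sd" "real L \<le> sd / (8 * real g)" by (cases rule: L_cases; simp)+
  have gsd: "real g * sd \<le> real S / 16"
  proof -
    have "real g * sd \<le> (sd / 16) * sd" using c sd1 by (intro mult_right_mono) auto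
    thus ?thesis using sd1 by simp
  qed
  have vv: "\<bar>real (v * L) - real S / 2\<bar> \<le> real g * sd" using v by (simp add: Off_def)
  hence v1: "7 * real S / 16 \<le> real (v * L)" "real (v * L) \<le> 9 * real S / 16" using gsd by linarith+
  show vS: "v * L \<le> S"
  proof -
    have "real (v * L) \<le> real S" using v1(2) by linarith
    thus ?thesis by linarith
  qed
  have m: "real (S - v * L) = real S - real (v * L)" using vS by (simp add: of_nat_diff)
  have "real L * real L \<le> (sd / (8 * real g)) * (sd / (8 * real g))" using c by (intro mult_mono) auto
  also have "\<dots> = real S / (64 * (real g * real g))" using sd1 by simp
  also have "\<dots> \<le> real S / 64"
  proof (rule divide_left_mono)
    have "1 * 1 \<le> real g * real g" using g512 by (intro mult_mono) auto
    thus "64 \<le> 64 * (real g * real g)" by simp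
  qed (use g512 in auto)
  finally have LL: "real (L * L) \<le> real S / 64" by simp
  have "4 * L * s + s \<le> 5 * (L * L)"
  proof -
    have "L * s \<le> L * L" using s by simp
    moreover have "1 * s \<le> L * L" using s by (intro mult_le_mono) auto
    ultimately show ?thesis by linarith
  qed
  hence s4r: "real (4 * L * s + s) \<le> 5 * real S / 64" using LL by linarith
  show "4 * L * s + s \<le> v * L + 1"
  proof -
    have "real (4 * L * s + s) \<le> real (v * L + 1)" using s4r v1 by linarith
    thus ?thesis by linarith
  qed
  show "4 * L * s + s \<le> (S - v * L) + 1"
  proof -
    have "real (4 * L * s + s) \<le> real ((S - v * L) + 1)" using s4r v1 m by simp
    thus ?thesis by linarith
  qed
  show sv: "s \<le> v * L"
  proof -
    have "real s \<le> real (v * L)" using s4r v1 by linarith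
    thus ?thesis by linarith
  qed
  show "s \<le> S - v * L"
  proof -
    have "real s \<le> real (S - v * L)" using s4r v1 m by linarith
    thus ?thesis by linarith
  qed
  have S0: "0 < real S" using S1 by simp
  have "0 < real (v * L)" using v1 S0 by linarith
  thus "1 \<le> v" by (cases v) auto
  let ?n = "v * L" and ?m = "S - v * L"
  have mp: "0 < real ?m" using m v1 S0 by linarith
  have "real ((?n choose s) * ?m ^ s) \<le> real (?n ^ s * ((?m + s) choose s))" using binomial_ratio of_nat_le_iff by blast
  hence br: "real (?n choose s) * real ?m ^ s \<le> real ?n ^ s * real (?m + s choose s)" by (simp only: of_nat_mult of_nat_power)
  have frac: "x / z \<le> y / u" if "x * u \<le> y * z" "0 < z" "0 < u" for x y z u :: real
    using that by (simp add: field_simps)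
  have "0 < real (?m + s choose s)" by (simp add: zero_less_binomial)
  hence "real (?n choose s) / real (?m + s choose s) \<le> real ?n ^ s / real ?m ^ s"
    by (intro frac br zero_less_power mp)
  also have "\<dots> = (real ?n / real ?m) ^ s" by (simp add: power_divide)
  also have "\<dots> \<le> (1 + 5 * real g / sd) ^ s"
  proof (rule power_mono)
    \<comment> \<open>The two sides differ by at most \<open>2 * g * sd\<close>, and
      \<open>?m\<close> is at least \<open>2 * S / 5\<close>, which yields the constant 5.\<close>
    have "real ?n \<le> real ?m + 2 * (real g * sd)" using vv m by linarith
    moreover have "2 * (real g * sd) \<le> real ?m * (5 * real g / sd)"
    proof -
      have "2 * (real g * sd) = (2 * real S / 5) * (5 * real g / sd)" using sd1 by (simp add: field_simps)
      also have "\<dots> \<le> real ?m * (5 * real g / sd)" 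
      proof (rule mult_right_mono)
        show "2 * real S / 5 \<le> real ?m" using m v1 S0 by linarith
      qed (use sd1 in auto)
      finally show ?thesis .
    qed
    ultimately have "real ?n \<le> real ?m + real ?m * (5 * real g / sd)" by linarith
    also have "\<dots> = (1 + 5 * real g / sd) * real ?m" by (simp only: distrib_right mult_1 mult.commute[of "real ?m"])
    finally show "real ?n / real ?m \<le> 1 + 5 * real g / sd" by (intro pos_divide_le_eq[THEN iffD2, OF mp])
  qed auto
  also have "\<dots> \<le> exp (5 * real g / sd) ^ s" using sd1 by (intro power_mono exp_ge_add_one_self) auto
  also have "\<dots> = exp (real s * (5 * real g / sd))" by (rule exp_of_nat_mult[symmetric])
  also have "\<dots> \<le> exp 1"
  proof -
    have "real s * (5 * real g / sd) \<le> (sd / (8 * real g)) * (5 * real g / sd)"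
      using c s sd1 by (intro mult_right_mono) auto
    also have "\<dots> \<le> 1" using sd1 g512 by (simp add: field_simps)
    finally show ?thesis by simp
  qed
  also have "\<dots> \<le> 3" by (rule exp_le)
  finally show "real (?n choose s) / real (?m + s choose s) \<le> 3" .
qed

lemma A_nonneg: "0 \<le> A \<tau> s" by (simp add: A_def case_prod_beta)

lemma Bf_nonneg: "0 \<le> Bf \<tau> s" by (simp add: Bf_def case_prod_beta)

lemma choose_L: "s < L \<Longrightarrow> real (s choose i) / real L ^ i \<le> 1"
proof -
  assume s: "s < L"
  have "s choose i \<le> L ^ i"
  proof (cases "i \<le> s")
    case True
    have "s choose i \<le> s ^ i" using True by (rule binomial_le_pow)
    also have "\<dots> \<le> L ^ i" using s by (intro power_mono) auto
    finally show ?thesis .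
  qed (simp add: binomial_eq_0)
  hence "real (s choose i) \<le> real (L ^ i)" using of_nat_le_iff by blast
  thus ?thesis using L1 by simp
qed

lemma shift_le:
  assumes "4 * L * s + s \<le> n + 1" "j \<le> s"
  shows "real (n choose (s - j)) * real L ^ j \<le> real (n choose s) * (1 / 4) ^ j"
proof -
  have "real ((4 * L) ^ j * (n choose (s - j))) \<le> real (n choose s)"
    using binomial_shift_le[OF assms] of_nat_le_iff by blast
  thus ?thesis by (simp add: power_mult_distrib power_divide field_simps)
qed

text \<open>\<open>A\<close> decays in \<open>j\<close> and \<open>Bf\<close> in \<open>i\<close>,
  so a product decays like \<open>(1 / 4) ^ (i + j)\<close>. For \<open>L = 1\<close> the only place
  is 0 and a single term is left.\<close>

lemma A_le: "v \<in> Off \<Longrightarrow> s < L \<Longrightarrow> A (v, i, j) s \<le> 3 * (1 / 4) ^ j"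
proof -
  assume v: "v \<in> Off" and s: "s < L"
  consider "L = 1" | "2 \<le> L" using L1 by linarith
  thus ?thesis
  proof cases
    case 1
    hence "s = 0" using s by simp
    thus ?thesis using 1 by (cases i) (auto simp: A_def)
  next
    case 2
    note w = wide[OF 2 v s]
    show ?thesis
    proof (cases "j \<le> s")
      case True
      have "A (v, i, j) s = (real (v * L choose (s - j)) * real L ^ j) * (real (s choose i) / real L ^ i) / real (S - v * L + s choose s)"
        using True by (simp add: A_def ac_simps)
      also have "\<dots> \<le> (real (v * L choose s) * (1 / 4) ^ j) * 1 / real (S - v * L + s choose s)"
        by (intro divide_right_mono mult_mono shift_le w True choose_L s) auto
      also have "\<dots> = (real (v * L choose s) / real (S - v * L + s choose s)) * (1 / 4) ^ j" by simp
      also have "\<dots> \<le> 3 * (1 / 4) ^ j" by (intro mult_right_mono w) auto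
      finally show ?thesis .
    qed (simp add: A_def)
  qed
qed

lemma Bf_le: "v \<in> Off \<Longrightarrow> t < L \<Longrightarrow> Bf (v, i, j) t \<le> (1 / 4) ^ i * (real (S choose (v * L + t)) / 2 ^ S)"
proof -
  assume v: "v \<in> Off" and t: "t < L"
  consider "L = 1" | "2 \<le> L" using L1 by linarith
  thus ?thesis
  proof cases
    case 1
    hence "t = 0" using t by simp
    thus ?thesis using 1 by (cases j) (auto simp: Bf_def)
  next
    case 2
    note w = wide[OF 2 v t]
    show ?thesis
    proof (cases "i \<le> t")
      case True
      have m0: "0 < real (S - v * L choose t)" using w by (simp add: zero_less_binomial)
      have "Bf (v, i, j) t = (real (S choose (v * L + t)) / 2 ^ S) * ((real (S - v * L choose (t - i)) * real L ^ i) / real (S - v * L choose t)) * (real (t choose j) / real L ^ j)"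
        using True by (simp add: Bf_def)
      also have "\<dots> \<le> (real (S choose (v * L + t)) / 2 ^ S) * ((real (S - v * L choose t) * (1 / 4) ^ i) / real (S - v * L choose t)) * 1"
        by (intro divide_right_mono mult_mono shift_le w True choose_L t) auto
      also have "\<dots> = (1 / 4) ^ i * (real (S choose (v * L + t)) / 2 ^ S)" using m0 by simp
      finally show ?thesis .
    qed (simp add: Bf_def)
  qed
qed

text \<open>The factor \<open>1 / sd\<close> of the central coefficient later cancels the sum over
  the \<open>L\<close> places of an item, since \<open>L\<close> is at most \<open>sd\<close>; this
  gives the bound \<open>ab_le\<close>.\<close>

lemma Bf_le_sd: "v \<in> Off \<Longrightarrow> t < L \<Longrightarrow> Bf (v, i, j) t \<le> (1 / 4) ^ i * (1 / sd)"
  by (rule order_trans[OF Bf_le]) (auto simp only: sd_def intro!: mult_left_mono binomial_le_central Sev S1 zero_le_power)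

lemma full_sum:
  assumes v: "v \<in> Off" and s: "s < L" and t: "t < L"
  shows "(\<Sum>i\<le>t. \<Sum>j\<le>s. A (v, i, j) s * Bf (v, i, j) t) = real (S choose (v * L + t - s)) / 2 ^ S"
proof -
  consider "L = 1" | "2 \<le> L" using L1 by linarith
  thus ?thesis
  proof cases
    case 1
    hence "s = 0" "t = 0" using s t by auto
    thus ?thesis using 1 by (simp add: A_def Bf_def)
  next
    case 2
    note ws = wide[OF 2 v s] and wt = wide[OF 2 v t]
    let ?n = "v * L" and ?m = "S - v * L"
    have S: "?n + ?m = S" using ws by simp
    have m0: "0 < real (?m choose t)" "0 < real (?m + s choose s)" using wt by (simp_all add: zero_less_binomial)
    have Lp: "0 < real L" using 2 by simp
    define c where "c = real (S choose (?n + t)) / 2 ^ S / (real (?m + s choose s) * real (?m choose t))"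
    have "(\<Sum>i\<le>t. \<Sum>j\<le>s. A (v, i, j) s * Bf (v, i, j) t) =
      (\<Sum>i\<le>t. \<Sum>j\<le>s. c * (real (s choose i) * real (?m choose (t - i))) * (real (t choose j) * real (?n choose (s - j))))"
    proof (intro sum.cong refl)
      fix i j assume "i \<in> {..t}" "j \<in> {..s}"
      thus "A (v, i, j) s * Bf (v, i, j) t = c * (real (s choose i) * real (?m choose (t - i))) * (real (t choose j) * real (?n choose (s - j)))"
        using Lp by (simp add: A_def Bf_def c_def field_simps)
    qed
    also have "\<dots> = c * (\<Sum>i\<le>t. real (s choose i) * real (?m choose (t - i))) * (\<Sum>j\<le>s. real (t choose j) * real (?n choose (s - j)))"
      by (subst sum.swap) (simp add: sum_distrib_left sum_distrib_right)
    also have "(\<Sum>i\<le>t. real (s choose i) * real (?m choose (t - i))) = real (?m + s choose t)"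
      using vandermonde[of s ?m t] by (simp add: add.commute flip: of_nat_mult of_nat_sum)
    also have "(\<Sum>j\<le>s. real (t choose j) * real (?n choose (s - j))) = real (?n + t choose s)"
      using vandermonde[of t ?n s] by (simp add: add.commute flip: of_nat_mult of_nat_sum)
    also have "c * real (?m + s choose t) * real (?n + t choose s) =
      (real (?n + t choose s) * real (?m + s choose t) * real (S choose (?n + t))) / (real (?m + s choose s) * real (?m choose t)) / 2 ^ S"
      by (simp add: c_def ac_simps)
    also have "real (?n + t choose s) * real (?m + s choose t) * real (S choose (?n + t)) =
       real (S choose (?n + t - s)) * (real (?m + s choose s) * real (?m choose t))"
      using binomial_window[of s ?n t ?m] ws(4) wt(5) S by simp
    finally show ?thesis using m0 by simp
  qed
qed

text \<open>Floor plus one instead of a ceiling: rounded up in either case, but never 0.\<close>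

definition a :: "nat \<times> nat \<times> nat \<Rightarrow> nat \<Rightarrow> nat" where "a \<tau> s = nat \<lfloor>2 ^ (16 * q) * A \<tau> s\<rfloor> + 1"

definition b :: "nat \<times> nat \<times> nat \<Rightarrow> nat \<Rightarrow> nat" where "b \<tau> s = nat \<lfloor>2 ^ (16 * q) * Bf \<tau> s\<rfloor> + 1"

definition T :: "(nat \<times> nat \<times> nat) set" where "T = Off \<times> {..<g} \<times> {..<g}"

section \<open>Truncation, rounding and tail\<close>

lemma floor_bounds: "0 \<le> (y::real) \<Longrightarrow> y \<le> real (nat \<lfloor>y\<rfloor> + 1)" "0 \<le> (y::real) \<Longrightarrow> real (nat \<lfloor>y\<rfloor> + 1) \<le> y + 1"
  by linarith+

lemma a_ge: "2 ^ (16 * q) * A \<tau> s \<le> real (a \<tau> s)" and a_up: "real (a \<tau> s) \<le> 2 ^ (16 * q) * A \<tau> s + 1"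
  unfolding a_def by (intro floor_bounds mult_nonneg_nonneg A_nonneg zero_le_power; simp)+

lemma b_ge: "2 ^ (16 * q) * Bf \<tau> s \<le> real (b \<tau> s)" and b_up: "real (b \<tau> s) \<le> 2 ^ (16 * q) * Bf \<tau> s + 1"
  unfolding b_def by (intro floor_bounds mult_nonneg_nonneg Bf_nonneg zero_le_power; simp)+

lemma A3: "v \<in> Off \<Longrightarrow> s < L \<Longrightarrow> A (v, i, j) s \<le> 3"
  using A_le[of v s i j] power_le_one[of "1 / 4 :: real" j] by simp

lemma B_sd: "v \<in> Off \<Longrightarrow> s < L \<Longrightarrow> Bf (v, i, j) s \<le> 1 / sd"
proof -
  assume "v \<in> Off" "s < L"
  hence "Bf (v, i, j) s \<le> (1 / 4) ^ i * (1 / sd)" by (rule Bf_le_sd)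
  also have "\<dots> \<le> 1 * (1 / sd)" using sd1 by (intro mult_right_mono power_le_one) auto
  finally show ?thesis by simp
qed

lemma B1: "v \<in> Off \<Longrightarrow> s < L \<Longrightarrow> Bf (v, i, j) s \<le> 1"
proof -
  assume "v \<in> Off" "s < L"
  hence "Bf (v, i, j) s \<le> 1 / sd" by (rule B_sd)
  also have "\<dots> \<le> 1" using sd1 by simp
  finally show ?thesis .
qed

lemma trunc_le:
  assumes v: "v \<in> Off" and s: "s < L" and t: "t < L"
  shows "(\<Sum>i<g. \<Sum>j<g. A (v, i, j) s * Bf (v, i, j) t) \<le> real (S choose (v * L + t - s)) / 2 ^ S"
proof -
  let ?F = "\<lambda>(i, j). A (v, i, j) s * Bf (v, i, j) t"
  have nn: "\<And>x. 0 \<le> ?F x" by (simp add: A_nonneg Bf_nonneg case_prod_beta)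
  have z: "?F x = 0" if "x \<notin> {..t} \<times> {..s}" for x
    using that by (cases x) (auto simp: A_def Bf_def)
  have "(\<Sum>i<g. \<Sum>j<g. A (v, i, j) s * Bf (v, i, j) t) = sum ?F ({..<g} \<times> {..<g})"
    by (rule sum.cartesian_product)
  also have "\<dots> = sum ?F (({..<g} \<times> {..<g}) \<inter> ({..t} \<times> {..s}))"
    using z by (intro sum.mono_neutral_right) auto
  also have "\<dots> \<le> sum ?F ({..t} \<times> {..s})" using nn by (intro sum_mono2) auto
  also have "\<dots> = (\<Sum>i\<le>t. \<Sum>j\<le>s. A (v, i, j) s * Bf (v, i, j) t)" by (rule sum.cartesian_product[symmetric])
  also have "\<dots> = real (S choose (v * L + t - s)) / 2 ^ S" by (rule full_sum[OF assms])
  finally show ?thesis .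
qed

text \<open>At most \<open>L * L\<close>, hence \<open>2 ^ q\<close>, terms are dropped, each below
  \<open>3 * (1 / 4) ^ g\<close>. After scaling, \<open>3 * 2 ^ (33 * q) / 2 ^ (64 * q)\<close> is
  left.\<close>

lemma trunc_ge:
  assumes v: "v \<in> Off" and s: "s < L" and t: "t < L" and Sq: "S \<le> 2 ^ q"
  shows "2 ^ (32 * q) * (real (S choose (v * L + t - s)) / 2 ^ S) \<le> 2 ^ (32 * q) * (\<Sum>i<g. \<Sum>j<g. A (v, i, j) s * Bf (v, i, j) t) + 1"
proof -
  let ?F = "\<lambda>(i, j). A (v, i, j) s * Bf (v, i, j) t"
  let ?X = "{..t} \<times> {..s}" and ?G = "{..<g} \<times> {..<g}"
  have nn: "\<And>x. 0 \<le> ?F x" by (simp add: A_nonneg Bf_nonneg case_prod_beta)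
  have "real (S choose (v * L + t - s)) / 2 ^ S = (\<Sum>i\<le>t. \<Sum>j\<le>s. A (v, i, j) s * Bf (v, i, j) t)"
    by (rule full_sum[OF v s t, symmetric])
  also have "\<dots> = sum ?F ?X" by (rule sum.cartesian_product)
  also have "\<dots> = sum ?F (?X \<inter> ?G) + sum ?F (?X - ?G)"
    by (subst sum.union_disjoint[symmetric]) (auto intro!: sum.cong)
  also have "\<dots> \<le> sum ?F ?G + (\<Sum>x\<in>?X - ?G. 3 * (1 / 4) ^ g)"
  proof (intro add_mono sum_mono)
    show "sum ?F (?X \<inter> ?G) \<le> sum ?F ?G" using nn by (intro sum_mono2) auto
  next
    fix x assume x: "x \<in> ?X - ?G"
    obtain i j where ij: "x = (i, j)" by (cases x)
    have "?F x \<le> (3 * (1 / 4) ^ j) * ((1 / 4) ^ i * 1)"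
      unfolding ij prod.case
    proof (intro mult_mono A_le v s Bf_nonneg)
      show "Bf (v, i, j) t \<le> (1 / 4) ^ i * 1"
        by (rule order_trans[OF Bf_le_sd[OF v t]], rule mult_left_mono) (use sd1 in auto)
    qed auto
    also have "\<dots> = 3 * (1 / 4) ^ (i + j)" by (simp add: power_add)
    also have "\<dots> \<le> 3 * (1 / 4) ^ g" using x ij by (intro mult_left_mono power_decreasing) auto
    finally show "?F x \<le> 3 * (1 / 4) ^ g" .
  qed
  also have "(\<Sum>x\<in>?X - ?G. 3 * (1 / 4) ^ g) \<le> 2 ^ q * (3 * (1 / 4) ^ g :: real)"
  proof -
    have "card (?X - ?G) \<le> card ?X" by (intro card_mono) auto
    also have "\<dots> = Suc t * Suc s" by simp
    also have "\<dots> \<le> L * L" using s t by (intro mult_le_mono) auto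
    also have "\<dots> \<le> 2 ^ q" using L_S Sq by linarith
    finally have "real (card (?X - ?G)) \<le> real (2 ^ q)" using of_nat_le_iff by blast
    thus ?thesis by (simp add: mult_right_mono)
  qed
  also have "sum ?F ?G = (\<Sum>i<g. \<Sum>j<g. A (v, i, j) s * Bf (v, i, j) t)" by (rule sum.cartesian_product[symmetric])
  finally have "2 ^ (32 * q) * (real (S choose (v * L + t - s)) / 2 ^ S) \<le>
     2 ^ (32 * q) * ((\<Sum>i<g. \<Sum>j<g. A (v, i, j) s * Bf (v, i, j) t) + 2 ^ q * (3 * (1 / 4) ^ g))"
    by (intro mult_left_mono) auto
  also have "\<dots> = 2 ^ (32 * q) * (\<Sum>i<g. \<Sum>j<g. A (v, i, j) s * Bf (v, i, j) t) + 3 * 2 ^ (33 * q) * (1 / 4) ^ g"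
  proof -
    have "(2::real) ^ (32 * q) * 2 ^ q = 2 ^ (33 * q)" by (simp flip: power_add)
    thus ?thesis by (simp add: distrib_left)
  qed
  also have "3 * (2::real) ^ (33 * q) * (1 / 4) ^ g \<le> 1"
  proof -
    have "(4::real) ^ g = 2 ^ (64 * q)" by (simp add: g_def power_mult)
    moreover have "3 * (2::real) ^ (33 * q) \<le> 2 ^ 2 * 2 ^ (33 * q)" by simp
    moreover have "(2::real) ^ 2 * 2 ^ (33 * q) \<le> 2 ^ (64 * q)" using q16 by (simp only: power_add[symmetric]) (intro power_increasing, auto)
    ultimately have "3 * (2::real) ^ (33 * q) \<le> 4 ^ g" by linarith
    thus ?thesis by (simp add: power_divide)
  qed
  finally show ?thesis by simp
qed

lemma multiples_card:
  fixes l lo hi :: real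
  assumes l: "0 < l" and lh: "lo \<le> hi"
  defines "X \<equiv> {v::nat. lo \<le> real v * l \<and> real v * l \<le> hi}"
  shows "finite X" "real (card X) * l \<le> hi - lo + l"
proof -
  have "X \<subseteq> {..nat \<lceil>hi / l\<rceil>}"
  proof
    fix v assume "v \<in> X"
    hence "real v \<le> hi / l" using l by (simp add: X_def field_simps)
    thus "v \<in> {..nat \<lceil>hi / l\<rceil>}" by simp linarith
  qed
  thus fin: "finite X" using finite_subset by blast
  show "real (card X) * l \<le> hi - lo + l"
  proof (cases "X = {}")
    case True thus ?thesis using l lh by simp
  next
    case False
    define m where "m = Min X"
    have m: "m \<in> X" using False fin by (simp add: m_def)
    have "X \<subseteq> {m..m + nat \<lfloor>(hi - lo) / l\<rfloor>}"
    proof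
      fix v assume v: "v \<in> X"
      have mv: "m \<le> v" using v fin by (simp add: m_def)
      have "(real v - real m) * l \<le> hi - lo" using v m by (simp add: X_def algebra_simps)
      hence "real v - real m \<le> (hi - lo) / l" using l by (simp add: field_simps)
      hence "v \<le> m + nat \<lfloor>(hi - lo) / l\<rfloor>" using mv by linarith
      thus "v \<in> {m..m + nat \<lfloor>(hi - lo) / l\<rfloor>}" using mv by simp
    qed
    hence "card X \<le> nat \<lfloor>(hi - lo) / l\<rfloor> + 1" using card_mono[of "{m..m + nat \<lfloor>(hi - lo) / l\<rfloor>}" X] by simp
    moreover have "0 \<le> (hi - lo) / l" using l lh by simp
    ultimately have "real (card X) \<le> (hi - lo) / l + 1" by linarith
    hence "real (card X) * l \<le> ((hi - lo) / l + 1) * l" using l by (intro mult_right_mono) auto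
    also have "\<dots> = hi - lo + l" using l by (simp add: field_simps)
    finally show ?thesis .
  qed
qed

lemma Off_fin: "finite Off" and Off_card: "real (card Off) * real L \<le> 2 * real g * sd + real L"
proof -
  have "Off = {v. real S / 2 - real g * sd \<le> real v * real L \<and> real v * real L \<le> real S / 2 + real g * sd}"
    by (auto simp: Off_def abs_le_iff)
  note Off = this
  have lp: "0 < real L" using L1 by simp
  have le: "real S / 2 - real g * sd \<le> real S / 2 + real g * sd"
    using mult_nonneg_nonneg[of "real g" sd] sd1(2) by linarith
  show "finite Off" unfolding Off by (rule multiples_card(1)[OF lp le])
  show "real (card Off) * real L \<le> 2 * real g * sd + real L"
    using multiples_card(2)[OF lp le] unfolding Off[symmetric] by linarith
qed

lemma Off_card2: "card Off \<le> 33 * g\<^sup>2"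
proof -
  have "sd \<le> real L * (16 * real g)" using L_sd' g512 by (simp add: field_simps)
  hence "2 * real g * sd \<le> 2 * real g * (real L * (16 * real g))" by (intro mult_left_mono) auto
  hence "real (card Off) * real L \<le> (32 * (real g)\<^sup>2 + 1) * real L" using Off_card by (simp add: power2_eq_square algebra_simps)
  hence "real (card Off) \<le> 32 * (real g)\<^sup>2 + 1" using L1 by simp
  moreover have "1 \<le> (real g)\<^sup>2" using g512 by simp
  ultimately have "real (card Off) \<le> real (33 * g\<^sup>2)" by simp
  thus ?thesis by linarith
qed

text \<open>There are \<open>O(g\<^sup>2)\<close> windows, as \<open>2 * g * sd / L\<close> is at
  most \<open>32 * g\<^sup>2\<close>, and \<open>g * g\<close> terms for each;
  \<open>33 * 32 ^ 4 + 1\<close> is below \<open>2 ^ 26\<close>.\<close>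

lemma card_T: "card T + 1 \<le> 2 ^ 26 * q ^ 4"
proof -
  have "card T = card Off * (g * g)" by (simp add: T_def card_cartesian_product)
  also have "\<dots> \<le> 33 * g\<^sup>2 * (g * g)" by (rule mult_le_mono1[OF Off_card2])
  also have "\<dots> = 33 * 32 ^ 4 * q ^ 4" by (simp add: g_def power2_eq_square power4_eq_xxxx)
  finally have cT: "card T \<le> 33 * 32 ^ 4 * q ^ 4" .
  have "1 \<le> q ^ 4" using q16 by (intro one_le_power) simp
  hence "card T + 1 \<le> 33 * 32 ^ 4 * q ^ 4 + 1 * q ^ 4" using cT by linarith
  also have "\<dots> = (33 * 32 ^ 4 + 1) * q ^ 4" by (simp only: distrib_right)
  also have "\<dots> \<le> 2 ^ 26 * q ^ 4" by (intro mult_le_mono1) simp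
  finally show ?thesis .
qed

lemma T_sum: "v \<in> Off \<Longrightarrow> (\<Sum>\<tau>\<in>{\<tau>\<in>T. fst \<tau> = v}. F \<tau>) = (\<Sum>i<g. \<Sum>j<g. F (v, i, j))"
proof -
  assume v: "v \<in> Off"
  have "{\<tau>\<in>T. fst \<tau> = v} = Pair v ` ({..<g} \<times> {..<g})" using v by (auto simp: T_def)
  hence "(\<Sum>\<tau>\<in>{\<tau>\<in>T. fst \<tau> = v}. F \<tau>) = (\<Sum>x\<in>{..<g} \<times> {..<g}. F (v, x))"
    by (simp add: sum.reindex inj_on_def)
  also have "\<dots> = (\<Sum>i<g. \<Sum>j<g. F (v, i, j))" by (simp add: sum.cartesian_product case_prod_beta)
  finally show ?thesis .
qed

lemma ab_sum_ge:
  assumes "v \<in> Off" "s < L" "t < L" "S \<le> 2 ^ q"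
  shows "2 ^ (32 * q) * (real (S choose (v * L + t - s)) / 2 ^ S) \<le> real (\<Sum>\<tau>\<in>{\<tau>\<in>T. fst \<tau> = v}. a \<tau> s * b \<tau> t) + 1"
proof -
  have p: "(2::real) ^ (32 * q) = 2 ^ (16 * q) * 2 ^ (16 * q)" by (simp flip: power_add)
  have "2 ^ (32 * q) * (\<Sum>i<g. \<Sum>j<g. A (v, i, j) s * Bf (v, i, j) t) =
    (\<Sum>i<g. \<Sum>j<g. (2 ^ (16 * q) * A (v, i, j) s) * (2 ^ (16 * q) * Bf (v, i, j) t))"
    unfolding p by (simp add: sum_distrib_left ac_simps)
  also have "\<dots> \<le> (\<Sum>i<g. \<Sum>j<g. real (a (v, i, j) s) * real (b (v, i, j) t))"
    by (intro sum_mono mult_mono a_ge b_ge mult_nonneg_nonneg Bf_nonneg) auto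
  also have "\<dots> = real (\<Sum>\<tau>\<in>{\<tau>\<in>T. fst \<tau> = v}. a \<tau> s * b \<tau> t)" by (simp add: T_sum[OF assms(1)])
  finally show ?thesis using trunc_ge[OF assms] by linarith
qed

text \<open>Rounding up costs at most \<open>8 * 2 ^ (16 * q)\<close> per term, because
  \<open>A\<close> and \<open>Bf\<close> are bounded; the \<open>g * g\<close> terms cost
  \<open>2 ^ 13 * q\<^sup>2 * 2 ^ (16 * q)\<close> together.\<close>

lemma ab_sum_le:
  assumes "v \<in> Off" "s < L" "t < L"
  shows "real (\<Sum>\<tau>\<in>{\<tau>\<in>T. fst \<tau> = v}. a \<tau> s * b \<tau> t) \<le> 2 ^ (32 * q) * (real (S choose (v * L + t - s)) / 2 ^ S) + 2 ^ (20 * q)"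
proof -
  have p: "(2::real) ^ (32 * q) = 2 ^ (16 * q) * 2 ^ (16 * q)" by (simp flip: power_add)
  let ?P = "(2::real) ^ (16 * q)"
  have "real (\<Sum>\<tau>\<in>{\<tau>\<in>T. fst \<tau> = v}. a \<tau> s * b \<tau> t) = (\<Sum>i<g. \<Sum>j<g. real (a (v, i, j) s) * real (b (v, i, j) t))"
    by (simp add: T_sum[OF assms(1)])
  also have "\<dots> \<le> (\<Sum>i<g. \<Sum>j<g. ?P * ?P * (A (v, i, j) s * Bf (v, i, j) t) + 8 * ?P)"
  proof (intro sum_mono)
    fix i j
    have "real (a (v, i, j) s) * real (b (v, i, j) t) \<le> (?P * A (v, i, j) s + 1) * (?P * Bf (v, i, j) t + 1)"
      by (intro mult_mono a_up b_up add_nonneg_nonneg mult_nonneg_nonneg A_nonneg) auto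
    also have "\<dots> = ?P * ?P * (A (v, i, j) s * Bf (v, i, j) t) + (?P * A (v, i, j) s + ?P * Bf (v, i, j) t + 1)"
      by (simp add: algebra_simps)
    finally have "real (a (v, i, j) s) * real (b (v, i, j) t) \<le>
      ?P * ?P * (A (v, i, j) s * Bf (v, i, j) t) + (?P * A (v, i, j) s + ?P * Bf (v, i, j) t + 1)" .
    moreover have "?P * A (v, i, j) s \<le> ?P * 3" using A3 assms by (intro mult_left_mono) auto
    moreover have "?P * Bf (v, i, j) t \<le> ?P * 1" using B1 assms by (intro mult_left_mono) auto
    moreover have "(1::real) \<le> ?P" by simp
    ultimately show "real (a (v, i, j) s) * real (b (v, i, j) t) \<le> ?P * ?P * (A (v, i, j) s * Bf (v, i, j) t) + 8 * ?P"
      by linarith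
  qed
  also have "\<dots> = 2 ^ (32 * q) * (\<Sum>i<g. \<Sum>j<g. A (v, i, j) s * Bf (v, i, j) t) + real g * real g * (8 * ?P)"
    unfolding p by (simp add: sum.distrib sum_distrib_left)
  also have "2 ^ (32 * q) * (\<Sum>i<g. \<Sum>j<g. A (v, i, j) s * Bf (v, i, j) t) \<le> 2 ^ (32 * q) * (real (S choose (v * L + t - s)) / 2 ^ S)"
    by (intro mult_left_mono trunc_le assms) auto
  also have "real g * real g * (8 * ?P) \<le> 2 ^ (20 * q)"
  proof -
    have "real q \<le> 2 ^ q" using less_exp[of q] by (metis less_imp_le of_nat_le_iff of_nat_numeral of_nat_power)
    hence "real q * real q \<le> 2 ^ q * 2 ^ q" by (intro mult_mono) auto
    hence "real q * real q \<le> 2 ^ (2 * q)" by (simp flip: power_add add: mult_2)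
    hence "real g * real g * (8 * ?P) \<le> 2 ^ 13 * 2 ^ (2 * q) * ?P" by (simp add: g_def)
    also have "\<dots> = 2 ^ (13 + 2 * q + 16 * q)" by (simp only: power_add)
    also have "\<dots> = 2 ^ (18 * q + 13)" by (rule arg_cong[where f = "(^) 2"]) simp
    also have "\<dots> \<le> 2 ^ (20 * q)" using q16 by (intro power_increasing) auto
    finally show ?thesis .
  qed
  finally show ?thesis by simp
qed

text \<open>\<open>s\<close> and \<open>t\<close> are below \<open>sd\<close>, so the value is still
  \<open>g - 1\<close> multiples of \<open>sd\<close> away from the mean, and
  \<open>2 * (1 / 2) ^ (g - 1)\<close> remains after replacing \<open>exp 1\<close> by 2.\<close>

lemma tail_bound:
  assumes "v \<notin> Off" "s < L" "t < L" "s \<le> v * L + t"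
  shows "2 ^ (32 * q) * (real (S choose (v * L + t - s)) / 2 ^ S) \<le> 4"
proof -
  have "real g * sd < \<bar>real (v * L) - real S / 2\<bar>" using assms by (simp add: Off_def)
  moreover have "real (v * L + t - s) = real (v * L) + real t - real s" using assms by (simp add: of_nat_diff)
  moreover have "real t < sd" "real s < sd" using assms L_sd by auto
  ultimately have "(real g - 1) * sd \<le> \<bar>real (v * L + t - s) - real S / 2\<bar>"
    unfolding left_diff_distrib by linarith
  hence 1: "real (S choose (v * L + t - s)) / 2 ^ S \<le> exp (1 / 2 - (real g - 1))"
    using binomial_tail[OF S1, of "real g - 1" "v * L + t - s"] by (simp add: sd_def)
  have "exp (1 / 2 - (real g - 1)) = exp (1 / 2) * (1 / exp (real (g - 1)))"
  proof -
    have "real (g - 1) = real g - 1" using g512 by (simp add: of_nat_diff)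
    thus ?thesis by (simp only: exp_diff) simp
  qed
  also have "exp (real (g - 1)) = exp 1 ^ (g - 1)" by (simp add: exp_of_nat_mult[symmetric])
  also have "exp (1 / 2) * (1 / exp 1 ^ (g - 1)) \<le> 2 * (1 / (2::real) ^ (g - 1))"
  proof (rule mult_mono)
    show "exp (1 / 2 :: real) \<le> 2" using exp_bound[of "1 / 2"] by (simp add: power2_eq_square)
    show "1 / exp 1 ^ (g - 1) \<le> 1 / (2::real) ^ (g - 1)"
      using exp_ge_add_one_self[of 1] by (intro divide_left_mono power_mono) auto
  qed auto
  also have "\<dots> = 4 / 2 ^ g" using g512 by (simp add: power_diff)
  finally have "real (S choose (v * L + t - s)) / 2 ^ S \<le> 4 / 2 ^ (32 * q)" using 1 by (simp add: g_def)
  thus ?thesis by (simp add: field_simps)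
qed

text \<open>\<open>D\<close> is the additive error inherited from the children. The 4 on top of it
  covers the truncated series inside \<open>Off\<close> and all coefficients outside. The factor
  \<open>100 * q\<close> is for \<open>off_card\<close>, where \<open>(64 * q + 1) * S\<close>
  appears.\<close>

lemma chainI:
  assumes B: "2 \<le> Bn" "8 * Bn * S \<le> 2 ^ q" "100 * q * S \<le> 2 ^ q" "32 ^ Bn \<le> (2::nat) ^ q" "(2 ^ 26 * q ^ 4) ^ Bn \<le> (2::nat) ^ q"
    and e: "2 ^ (10 * q) \<le> e" "e \<le> 2 ^ (12 * q)" "D + 4 \<le> real (e * e)"
    and K: "\<And>x. x \<le> S \<Longrightarrow> real (K x) \<le> 2 ^ (32 * q) * real (S choose x) / 2 ^ S + D"
  shows "chain q S Bn L e T fst a b K"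
proof
  have Sq: "S \<le> 2 ^ q"
  proof -
    have "1 * S \<le> 100 * q * S" using q16 by (intro mult_le_mono1) auto
    thus ?thesis using B by linarith
  qed
  have P1: "(1::real) \<le> 2 ^ (16 * q)" by simp
  show "16 \<le> q" "2 \<le> Bn" "1 \<le> L" "8 * Bn * S \<le> 2 ^ q" "32 ^ Bn \<le> (2::nat) ^ q" "2 ^ (10 * q) \<le> e" "e \<le> 2 ^ (12 * q)"
    using q16 B e L1 by auto
  have "L * 1 \<le> L * L" using L1 by (intro mult_le_mono2)
  thus "L \<le> S" using L_S by linarith
  show "finite T" using Off_fin by (simp add: T_def)
  show "(card T + 1) ^ Bn \<le> 2 ^ q" using power_mono[OF card_T, of Bn] B(5) by linarith
  show "1 \<le> a \<tau> s" for \<tau> s by (simp add: a_def)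
  have aP: "real (a \<tau> s) \<le> 4 * 2 ^ (16 * q)" if tT: "\<tau> \<in> T" and "s < L" for \<tau> s
  proof -
    obtain v i j where t: "\<tau> = (v, i, j)" "v \<in> Off" using tT by (cases \<tau>) (auto simp: T_def)
    have "2 ^ (16 * q) * A \<tau> s \<le> 2 ^ (16 * q) * 3" using t A3 that by (intro mult_left_mono) auto
    thus ?thesis using a_up[of \<tau> s] P1 by linarith
  qed
  have bP: "real (b \<tau> s) \<le> 2 ^ (16 * q) * (1 / sd) + 1" if tT: "\<tau> \<in> T" and "s < L" for \<tau> s
  proof -
    obtain v i j where t: "\<tau> = (v, i, j)" "v \<in> Off" using tT by (cases \<tau>) (auto simp: T_def)
    have "2 ^ (16 * q) * Bf \<tau> s \<le> 2 ^ (16 * q) * (1 / sd)" using t B_sd that by (intro mult_left_mono) auto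
    thus ?thesis using b_up[of \<tau> s] by linarith
  qed
  show "a \<tau> s \<le> 2 ^ (16 * q + 2)" if "\<tau> \<in> T" "s < L" for \<tau> s
  proof -
    have "real (a \<tau> s) \<le> real (2 ^ (16 * q + 2))" using aP[OF that] by (simp add: power_add)
    thus ?thesis using of_nat_le_iff by blast
  qed
  show "b \<tau> s \<le> 2 ^ (16 * q + 2)" if "\<tau> \<in> T" "s < L" for \<tau> s
  proof -
    have "2 ^ (16 * q) * (1 / sd) \<le> 2 ^ (16 * q) * 1" using sd1 by (intro mult_left_mono) auto
    hence "real (b \<tau> s) \<le> 4 * 2 ^ (16 * q)" using bP[OF that] P1 by linarith
    hence "real (b \<tau> s) \<le> real (2 ^ (16 * q + 2))" by (simp add: power_add)
    thus ?thesis using of_nat_le_iff by blast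
  qed
  show "(\<Sum>s<L. b \<tau> s * a \<tau>' s) \<le> 2 ^ (32 * q + 3)" if "\<tau> \<in> T" "\<tau>' \<in> T" for \<tau> \<tau>'
  proof -
    have "real (\<Sum>s<L. b \<tau> s * a \<tau>' s) \<le> (\<Sum>s<L. (2 ^ (16 * q) * (1 / sd) + 1) * (4 * 2 ^ (16 * q)))"
      unfolding of_nat_sum of_nat_mult using aP bP that sd1 by (intro sum_mono mult_mono) auto
    also have "\<dots> = (2 ^ (16 * q) * (real L / sd) + real L) * (4 * 2 ^ (16 * q))" by (simp add: algebra_simps)
    also have "\<dots> \<le> (2 ^ (16 * q) * 1 + 2 ^ (16 * q)) * (4 * 2 ^ (16 * q))"
    proof (intro mult_right_mono add_mono mult_left_mono)
      show "real L / sd \<le> 1" using L_sd sd1 by simp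
      have "L \<le> 2 ^ q" using \<open>L \<le> S\<close> Sq by linarith
      also have "\<dots> \<le> 2 ^ (16 * q)" by (intro power_increasing) auto
      finally show "real L \<le> 2 ^ (16 * q)" by (metis of_nat_le_iff of_nat_numeral of_nat_power)
    qed auto
    also have "\<dots> = 8 * (2 ^ (16 * q) * 2 ^ (16 * q))" by simp
    also have "\<dots> = real (2 ^ (32 * q + 3))" by (simp add: power_add flip: power_mult) (simp flip: power_add)
    finally show ?thesis using of_nat_le_iff by blast
  qed
  show "L \<le> fst \<tau> * L + 1" if "\<tau> \<in> T" for \<tau>
  proof (cases "2 \<le> L")
    case True
    have "fst \<tau> \<in> Off" using that by (auto simp: T_def)
    hence "1 \<le> fst \<tau>" using wide(6)[OF True, of "fst \<tau>" 0] True by simp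
    hence "1 * L \<le> fst \<tau> * L" by (intro mult_le_mono1)
    thus ?thesis by linarith
  qed simp
  have fstT: "fst ` T \<subseteq> Off" by (auto simp: T_def)
  show "card (fst ` T) * L \<le> 2 ^ q"
  proof -
    have "card (fst ` T) \<le> card Off" by (rule card_mono[OF Off_fin fstT])
    hence "real (card (fst ` T)) * real L \<le> real (card Off) * real L" by (intro mult_right_mono) auto
    also have "\<dots> \<le> 2 * real g * sd + real L" by (rule Off_card)
    also have "\<dots> \<le> 2 * real g * real S + real S"
    proof (intro add_mono mult_left_mono)
      have "sd * 1 \<le> sd * sd" using sd1 by (intro mult_left_mono) auto
      thus "sd \<le> real S" using sd1 by simp
      show "real L \<le> real S" using \<open>L \<le> S\<close> by simp
    qed auto
    also have "\<dots> = real ((64 * q + 1) * S)" by (simp add: g_def algebra_simps)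
    also have "\<dots> \<le> real (100 * q * S)" using q16 by (intro of_nat_mono mult_le_mono1) linarith
    also have "\<dots> \<le> real (2 ^ q)" using B(3) of_nat_le_iff by blast
    finally have "real (card (fst ` T) * L) \<le> real (2 ^ q)" by simp
    thus ?thesis using of_nat_le_iff by blast
  qed
  show "K (v * L + t - s) \<le> (\<Sum>\<tau>\<in>{\<tau>\<in>T. fst \<tau> = v}. a \<tau> s * b \<tau> t) + e * e"
    if st: "s < L" "t < L" "s \<le> v * L + t" "v * L + t - s \<le> S" for v s t
  proof -
    have k: "real (K (v * L + t - s)) \<le> 2 ^ (32 * q) * (real (S choose (v * L + t - s)) / 2 ^ S) + D" using K[OF st(4)] by simp
    have "real (K (v * L + t - s)) \<le> real ((\<Sum>\<tau>\<in>{\<tau>\<in>T. fst \<tau> = v}. a \<tau> s * b \<tau> t) + e * e)"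
    proof (cases "v \<in> Off")
      case True
      show ?thesis using k ab_sum_ge[OF True st(1,2) Sq] e(3) unfolding of_nat_add by linarith
    next
      case False
      have "0 \<le> real (\<Sum>\<tau>\<in>{\<tau>\<in>T. fst \<tau> = v}. a \<tau> s * b \<tau> t)" by (rule of_nat_0_le_iff)
      thus ?thesis using k tail_bound[OF False st(1,2,3)] e(3) unfolding of_nat_add by linarith
    qed
    thus ?thesis using of_nat_le_iff by blast
  qed
  show "real (\<Sum>\<tau>\<in>{\<tau>\<in>T. fst \<tau> = v}. a \<tau> s * b \<tau> t) \<le> 2 ^ (32 * q) * real (S choose (v * L + t - s)) / 2 ^ S + 2 ^ (20 * q)"
    if "v \<in> fst ` T" "s < L" "t < L" for v s t
    using ab_sum_le[of v s t] that fstT by auto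
qed

end

section \<open>Trees and automata\<close>

primrec rn :: "('s \<Rightarrow> nat) \<Rightarrow> ('s \<Rightarrow> nat \<Rightarrow> 's) \<Rightarrow> (nat \<Rightarrow> nat) \<Rightarrow> nat \<Rightarrow> 's \<Rightarrow> 's" where
  "rn adr nxt M 0 \<sigma> = \<sigma>"
| "rn adr nxt M (Suc n) \<sigma> = nxt (rn adr nxt M n \<sigma>) (M (adr (rn adr nxt M n \<sigma>)))"

lemma rn_add: "rn adr nxt M (m + n) \<sigma> = rn adr nxt M n (rn adr nxt M m \<sigma>)"
  by (induction n) auto

text \<open>
  Blocks of \<open>S\<close> bits stored as a root value below \<open>Rn\<close> and \<open>m\<close> cells of \<open>g\<close> bits, queried by an automaton with
  \<open>Qn\<close> states that makes \<open>T\<close> probes.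
\<close>

definition block_ds :: "nat \<Rightarrow> nat \<Rightarrow> nat \<Rightarrow> nat \<Rightarrow> nat \<Rightarrow> nat \<Rightarrow> bool" where
  "block_ds g S T m Qn Rn \<longleftrightarrow> (\<exists>ini adr nxt out.
     (\<forall>\<rho> u. ini \<rho> u < Qn) \<and> (\<forall>\<sigma> v. nxt \<sigma> v < Qn) \<and> (\<forall>\<sigma>. adr \<sigma> < m) \<and> (\<forall>\<sigma>. out \<sigma> \<le> S) \<and>
     (\<forall>A :: nat \<Rightarrow> nat. (\<forall>i. A i \<le> 1) \<longrightarrow> (\<exists>\<rho><Rn. \<exists>M. (\<forall>i. M i < 2 ^ g) \<and>
        (\<forall>u<S. out (rn adr nxt M T (ini \<rho> u)) = (\<Sum>i<u. A i)))))"

text \<open>All that the tree uses of a node. The decoder returns the ones before a child and the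
  child's sum and spill, which is again the data known at a root, so that decoding can
  descend.\<close>

definition node_code :: "nat \<Rightarrow> nat \<Rightarrow> nat \<Rightarrow> (nat \<Rightarrow> nat) \<Rightarrow> (nat \<Rightarrow> nat) \<Rightarrow>
   ((nat \<Rightarrow> nat) \<Rightarrow> (nat \<Rightarrow> nat) \<Rightarrow> nat) \<Rightarrow> ((nat \<Rightarrow> nat) \<Rightarrow> (nat \<Rightarrow> nat) \<Rightarrow> nat \<Rightarrow> nat) \<Rightarrow>
   (nat \<Rightarrow> nat \<Rightarrow> nat \<Rightarrow> nat \<Rightarrow> nat) \<Rightarrow> (nat \<Rightarrow> nat \<Rightarrow> nat \<Rightarrow> (nat \<Rightarrow> nat) \<Rightarrow> nat \<times> nat \<times> nat) \<Rightarrow> bool" where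
  "node_code g B S K K' fin cell pr dec \<longleftrightarrow>
     (\<forall>N c i r. r < 8 \<longrightarrow> pr N c i r < B - 1) \<and>
     (\<forall>x k. (\<forall>j<B. x j \<le> S \<and> k j < K (x j)) \<longrightarrow>
        fin x k < K' (\<Sum>i<B. x i) \<and> (\<forall>j<B - 1. cell x k j < 2 ^ g) \<and>
        (\<forall>i<B. \<forall>vs. (\<forall>r<8. vs r = cell x k (pr (\<Sum>i<B. x i) (fin x k) i r)) \<longrightarrow>
            dec (\<Sum>i<B. x i) (fin x k) i vs = (\<Sum>j<i. x j, x i, k i)))"

lemma node_codeD:
  assumes "node_code g B S K K' fin cell pr dec" "\<forall>j<B. x j \<le> S \<and> k j < K (x j)"
  shows "fin x k < K' (\<Sum>i<B. x i)" "j < B - 1 \<Longrightarrow> cell x k j < 2 ^ g"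
    "i < B \<Longrightarrow> \<forall>r<8. vs r = cell x k (pr (\<Sum>i<B. x i) (fin x k) i r) \<Longrightarrow>
       dec (\<Sum>i<B. x i) (fin x k) i vs = (\<Sum>j<i. x j, x i, k i)"
proof -
  note A = mp[OF spec[OF spec[OF conjunct2[OF assms(1)[unfolded node_code_def]], of x], of k] assms(2)]
  show "fin x k < K' (\<Sum>i<B. x i)" using A by (rule conjunct1)
  show "j < B - 1 \<Longrightarrow> cell x k j < 2 ^ g" using A[THEN conjunct2, THEN conjunct1] by simp
  show "i < B \<Longrightarrow> \<forall>r<8. vs r = cell x k (pr (\<Sum>i<B. x i) (fin x k) i r) \<Longrightarrow>
       dec (\<Sum>i<B. x i) (fin x k) i vs = (\<Sum>j<i. x j, x i, k i)"
    using A[THEN conjunct2, THEN conjunct2] by simp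
qed

lemma sum_lessThan_add: "(\<Sum>i<m + n. f i) = (\<Sum>i<m. f i) + (\<Sum>i<n. f (m + i))" for f :: "nat \<Rightarrow> nat"
  by (induction n) (auto simp: add.assoc)

section \<open>The automaton that descends through a block\<close>

locale tree =
  fixes q B H :: nat and K :: "nat \<Rightarrow> nat \<Rightarrow> nat" and fin cell pr dec
  assumes q1: "1 \<le> q" and B2: "2 \<le> B" and H1: "1 \<le> H"
    and node: "\<And>h. h < H \<Longrightarrow> node_code (32 * q) B (32 * q * B ^ h) (K h) (K (Suc h)) (fin h) (cell h) (pr h) (dec h)"
    and K0: "K 0 x = (32 * q choose x)"
    and Kle: "h \<le> H \<Longrightarrow> K h x \<le> 2 ^ (33 * q)"
    and Sle: "32 * q * B ^ H < 2 ^ q" and Hle: "H < 2 ^ q"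
begin

definition g :: nat where "g = 32 * q"

definition S :: "nat \<Rightarrow> nat" where "S h = 32 * q * B ^ h"

definition Str :: "nat \<Rightarrow> nat set set" where "Str x = {X. X \<subseteq> {..<g} \<and> card X = x}"

definition ones :: "nat \<Rightarrow> (nat \<Rightarrow> nat) \<Rightarrow> nat \<Rightarrow> nat" where "ones h A p = (\<Sum>i<S h. A (p + i))"

primrec key :: "nat \<Rightarrow> (nat \<Rightarrow> nat) \<Rightarrow> nat \<Rightarrow> nat" where
  "key 0 A p = idx (Str (ones 0 A p)) {i. i < g \<and> A (p + i) = 1}"
| "key (Suc h) A p = fin h (\<lambda>j. ones h A (p + j * S h)) (\<lambda>j. key h A (p + j * S h))"

text \<open>Own cells first, then one area of \<open>B ^ h - 1\<close> cells per child, in agreement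
  with \<open>B - 1 + B * (B ^ h - 1) = B ^ Suc h - 1\<close>. Equal lengths give every child a
  computable address.\<close>

primrec cont :: "nat \<Rightarrow> (nat \<Rightarrow> nat) \<Rightarrow> nat \<Rightarrow> nat \<Rightarrow> nat" where
  "cont 0 A p i = 0"
| "cont (Suc h) A p i = (if i < B - 1 then cell h (\<lambda>j. ones h A (p + j * S h)) (\<lambda>j. key h A (p + j * S h)) i
     else cont h A (p + (i - (B - 1)) div (B ^ h - 1) * S h) ((i - (B - 1)) mod (B ^ h - 1)))"

text \<open>
  State: level, sum and spill of the current node, position inside it, number of ones before it, address of its
  cells, and the values probed so far at this node.
\<close>

type_synonym st = "nat \<times> nat \<times> nat \<times> nat \<times> nat \<times> nat \<times> nat list"

fun adr :: "st \<Rightarrow> nat" where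
  "adr (0, x, k, u, acc, base, vs) = 0"
| "adr (Suc h, x, k, u, acc, base, vs) = base + pr h x k (u div S h) (length vs)"

fun nxt :: "st \<Rightarrow> nat \<Rightarrow> st" where
  "nxt (0, x, k, u, acc, base, vs) v = (0, x, k, u, acc, base, vs)"
| "nxt (Suc h, x, k, u, acc, base, vs) v =
     (if length vs < 7 then (Suc h, x, k, u, acc, base, vs @ [v])
      else (case dec h x k (u div S h) (\<lambda>r. (vs @ [v]) ! r) of (p, x', k') \<Rightarrow>
        (h, x', k', u mod S h, acc + p, base + (B - 1) + (u div S h) * (B ^ h - 1), [])))"

fun out :: "st \<Rightarrow> nat" where
  "out (h, x, k, u, acc, base, vs) = acc + card (elt (Str x) k \<inter> {..<u})"

text \<open>A finite set that contains all states met on a query. At most seven values are kept,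
  since the eighth is consumed by decoding at once.\<close>

definition Q :: "st set" where
  "Q = {..<2 ^ q} \<times> {..<2 ^ q} \<times> {..<2 ^ (33 * q)} \<times> {..<2 ^ q} \<times> {..<2 ^ q} \<times> {..<2 ^ q} \<times>
      {vs. set vs \<subseteq> {..<2 ^ g} \<and> length vs \<le> 7}"

lemma S_Suc: "S (Suc h) = B * S h" by (simp add: S_def)

lemma S_pos: "0 < S h" using q1 B2 by (simp add: S_def)

lemma S0: "S 0 = g" by (simp add: S_def g_def)

lemma S_mono: "h \<le> H \<Longrightarrow> S h \<le> S H" using B2 by (simp add: S_def power_increasing)

lemma Str_fin: "finite (Str x)" by (simp add: Str_def)

lemma card_Str: "card (Str x) = g choose x"
  using n_subsets[of "{..<g}" x] by (simp add: Str_def)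

lemma ones_le: "(\<And>i. A i \<le> 1) \<Longrightarrow> ones h A p \<le> S h"
proof -
  assume "\<And>i. A i \<le> 1"
  hence "(\<Sum>i<S h. A (p + i)) \<le> (\<Sum>i<S h. 1)" by (intro sum_mono) auto
  thus ?thesis by (simp add: ones_def)
qed

lemma sum_blocks: "(\<Sum>j<n. \<Sum>i<m. f (j * m + i)) = (\<Sum>i<n * m. f i)" for f :: "nat \<Rightarrow> nat"
proof (induction n)
  case 0 thus ?case by simp
next
  case (Suc n)
  have "(\<Sum>i<n * m + m. f i) = (\<Sum>i<n * m. f i) + (\<Sum>i=n*m..<n * m + m. f i)"
    by (simp add: lessThan_atLeast0 sum.atLeastLessThan_concat)
  also have "(\<Sum>i=n*m..<n * m + m. f i) = (\<Sum>i<m. f (n * m + i))"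
    using sum.shift_bounds_nat_ivl[of f 0 "n * m" m] by (simp add: lessThan_atLeast0 add.commute)
  finally show ?case using Suc by (simp add: add.commute)
qed

lemma ones_prefix: "(\<Sum>j<n. ones h A (p + j * S h)) = (\<Sum>i<n * S h. A (p + i))"
  unfolding ones_def using sum_blocks[where f = "\<lambda>i. A (p + i)" and m = "S h" and n = n] by (simp add: add.assoc)

lemma ones_Suc: "(\<Sum>j<B. ones h A (p + j * S h)) = ones (Suc h) A p"
  unfolding ones_prefix by (simp add: ones_def S_Suc)

context
  fixes A :: "nat \<Rightarrow> nat"
  assumes A1: "\<And>i. A i \<le> 1"
begin

lemma leaf_Str: "{i. i < g \<and> A (p + i) = 1} \<in> Str (ones 0 A p)"
proof -
  have "ones 0 A p = (\<Sum>i<g. if A (p + i) = 1 then 1 else 0)"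
    unfolding ones_def S0
  proof (rule sum.cong[OF refl])
    fix i show "A (p + i) = (if A (p + i) = 1 then 1 else 0)" using A1[of "p + i"] by (cases "A (p + i)") auto
  qed
  also have "\<dots> = card {i. i < g \<and> A (p + i) = 1}"
    by (subst sum.inter_filter[symmetric]) (auto simp: lessThan_def)
  finally show ?thesis by (auto simp: Str_def)
qed

lemma key_less: "h \<le> H \<Longrightarrow> key h A p < K h (ones h A p)"
proof (induction h arbitrary: p)
  case 0
  show ?case using idx_less[OF Str_fin leaf_Str] by (simp add: card_Str K0 g_def)
next
  case (Suc h)
  have "\<forall>j<B. ones h A (p + j * S h) \<le> 32 * q * B ^ h \<and> key h A (p + j * S h) < K h (ones h A (p + j * S h))"
    using Suc ones_le[OF A1, of h] by (auto simp: S_def)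
  note v = this
  have "h < H" using Suc(2) by simp
  note node_codeD(1)[OF node[OF this] v]
  thus ?case by (simp only: ones_Suc key.simps)
qed

lemma valid_children: "h < H \<Longrightarrow> \<forall>j<B. ones h A (p + j * S h) \<le> 32 * q * B ^ h \<and> key h A (p + j * S h) < K h (ones h A (p + j * S h))"
  using key_less ones_le[OF A1, of h] by (auto simp: S_def)

lemma cont_less: "h \<le> H \<Longrightarrow> cont h A p i < 2 ^ g"
proof (induction h arbitrary: p i)
  case 0 show ?case by simp
next
  case (Suc h)
  have hH: "h < H" using Suc(2) by simp
  have "cell h (\<lambda>j. ones h A (p + j * S h)) (\<lambda>j. key h A (p + j * S h)) i < 2 ^ g" if "i < B - 1"
    using node_codeD(2)[OF node[OF hH] valid_children[OF hH] that] unfolding g_def .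
  thus ?case using Suc by auto
qed

lemma micro:
  assumes h: "h < H" and n: "n \<le> 7"
  shows "rn adr nxt M n (Suc h, x, k, u, acc, base, []) =
    (Suc h, x, k, u, acc, base, map (\<lambda>r. M (base + pr h x k (u div S h) r)) [0..<n])"
  using n
proof (induction n)
  case 0 thus ?case by simp
next
  case (Suc n)
  have "n < 7" using Suc(2) by simp
  thus ?case using Suc(1) by simp
qed

text \<open>Besides the answer, the induction carries what the passage to tables needs: states stay
  in \<open>Q\<close> and addresses inside the area of the block. Each level takes eight
  probes.\<close>

lemma trajectory:
  assumes "h \<le> H" "u < S h" "\<And>i. i < B ^ h - 1 \<Longrightarrow> M (base + i) = cont h A p i"
    "acc + ones h A p \<le> S H" "base + B ^ h \<le> B ^ H" "\<And>i. M i < 2 ^ g"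
  shows "(\<forall>n\<le>8 * h. rn adr nxt M n (h, ones h A p, key h A p, u, acc, base, []) \<in> Q) \<and>
    (\<forall>n<8 * h. adr (rn adr nxt M n (h, ones h A p, key h A p, u, acc, base, [])) < B ^ H - 1) \<and>
    out (rn adr nxt M (8 * h) (h, ones h A p, key h A p, u, acc, base, [])) = acc + (\<Sum>i<u. A (p + i))"
  using assms(1-5)
proof (induction h arbitrary: u acc base p)
  case 0
  have e: "elt (Str (ones 0 A p)) (key 0 A p) = {i. i < g \<and> A (p + i) = 1}"
    unfolding key.simps by (rule elt_idx[OF Str_fin leaf_Str])
  have "card ({i. i < g \<and> A (p + i) = 1} \<inter> {..<u}) = (\<Sum>i<u. A (p + i))"
  proof -
    have "{i. i < g \<and> A (p + i) = 1} \<inter> {..<u} = {i\<in>{..<u}. A (p + i) = 1}" using 0 by (auto simp: S0)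
    hence "card ({i. i < g \<and> A (p + i) = 1} \<inter> {..<u}) = (\<Sum>i<u. if A (p + i) = 1 then 1 else 0)"
      by (simp add: sum.inter_filter[symmetric])
    also have "\<dots> = (\<Sum>i<u. A (p + i))"
    proof (rule sum.cong[OF refl])
      fix i show "(if A (p + i) = 1 then 1 else 0) = A (p + i)" using A1[of "p + i"] by (cases "A (p + i)") auto
    qed
    finally show ?thesis .
  qed
  moreover have "(0, ones 0 A p, key 0 A p, u, acc, base, []) \<in> Q"
  proof -
    have "K 0 (ones 0 A p) \<le> 2 ^ (33 * q)" using Kle by simp
    moreover have "S H < 2 ^ q" using Sle by (simp add: S_def)
    moreover have "B ^ H \<le> S H" using q1 by (simp add: S_def)
    moreover have "u < S H" using 0 S_mono[of 0] by simp
    moreover have "key 0 A p < K 0 (ones 0 A p)" using key_less[of 0 p] by simp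
    ultimately show ?thesis using 0 unfolding Q_def by simp
  qed
  ultimately show ?case using e by simp
next
  case (Suc h)
  let ?x = "\<lambda>j. ones h A (p + j * S h)" and ?k = "\<lambda>j. key h A (p + j * S h)"
  let ?N = "ones (Suc h) A p" and ?c = "key (Suc h) A p"
  let ?i = "u div S h"
  let ?\<sigma> = "(Suc h, ?N, ?c, u, acc, base, [])"
  have hH: "h < H" using Suc by simp
  have iB: "?i < B" using Suc(3) by (simp add: S_Suc less_mult_imp_div_less)
  have val: "\<forall>j<B. ?x j \<le> 32 * q * B ^ h \<and> ?k j < K h (?x j)" using valid_children[OF hH] .
  have N: "(\<Sum>i<B. ?x i) = ?N" by (rule ones_Suc)
  have c: "fin h ?x ?k = ?c" by simp
  have prl: "pr h ?N ?c ?i r < B - 1" if "r < 8" for r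
    using conjunct1[OF node[OF hH, unfolded node_code_def]] that by simp
  have BB: "B - 1 \<le> B ^ Suc h - 1"
  proof -
    have "B * 1 \<le> B * B ^ h" using B2 by (intro mult_le_mono2) simp
    thus ?thesis by (simp add: diff_le_mono)
  qed
  have Mv: "M (base + pr h ?N ?c ?i r) = cell h ?x ?k (pr h ?N ?c ?i r)" if "r < 8" for r
    using Suc(4)[of "pr h ?N ?c ?i r"] prl[OF that] BB by simp
  let ?vs = "map (\<lambda>r. M (base + pr h ?N ?c ?i r)) [0..<8]"
  have gen: "dec h N' c' ?i vs = (\<Sum>j<?i. ?x j, ?x ?i, ?k ?i)"
    if "(\<Sum>i<B. ?x i) = N'" "fin h ?x ?k = c'" "\<forall>r<8. vs r = cell h ?x ?k (pr h N' c' ?i r)" for N' c' vs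
    unfolding that(1,2)[symmetric]
    by (rule node_codeD(3)[where x = ?x and k = ?k, OF node[OF hH] val iB]) (use that in simp)
  have "dec h ?N ?c ?i (\<lambda>r. ?vs ! r) = (\<Sum>j<?i. ?x j, ?x ?i, ?k ?i)"
  proof (rule gen[OF N c])
    show "\<forall>r<8. ?vs ! r = cell h ?x ?k (pr h ?N ?c ?i r)"
    proof (intro allI impI)
      fix r :: nat assume r: "r < 8"
      hence "?vs ! r = M (base + pr h ?N ?c ?i r)" by (simp only: nth_map_upt diff_zero add_0)
      thus "?vs ! r = cell h ?x ?k (pr h ?N ?c ?i r)" using Mv[OF r] by (rule trans)
    qed
  qed
  hence dec: "dec h ?N ?c ?i (\<lambda>r. ?vs ! r) = (\<Sum>i<?i * S h. A (p + i), ?x ?i, ?k ?i)" by (simp only: ones_prefix)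
  let ?acc = "acc + (\<Sum>i<?i * S h. A (p + i))" and ?base = "base + (B - 1) + ?i * (B ^ h - 1)" and ?p = "p + ?i * S h"
  let ?\<sigma>' = "(h, ones h A ?p, key h A ?p, u mod S h, ?acc, ?base, [])"
  have r7: "rn adr nxt M 7 ?\<sigma> = (Suc h, ?N, ?c, u, acc, base, map (\<lambda>r. M (base + pr h ?N ?c ?i r)) [0..<7])"
    by (rule micro[OF hH]) simp
  have u8: "[0..<8::nat] = [0..<7] @ [7]" by code_simp
  have s8: "(8::nat) = Suc 7" by simp
  have v8: "map (\<lambda>r. M (base + pr h ?N ?c ?i r)) [0..<7] @ [M (base + pr h ?N ?c ?i 7)] = ?vs"
    by (simp only: u8 map_append list.map)
  have "rn adr nxt M 8 ?\<sigma> = nxt (rn adr nxt M 7 ?\<sigma>) (M (adr (rn adr nxt M 7 ?\<sigma>)))"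
    by (subst s8) (rule rn.simps(2))
  also have "\<dots> = nxt (Suc h, ?N, ?c, u, acc, base, map (\<lambda>r. M (base + pr h ?N ?c ?i r)) [0..<7]) (M (base + pr h ?N ?c ?i 7))"
    unfolding r7 by (simp del: key.simps upt_rec_numeral)
  also have "\<dots> = ?\<sigma>'"
    unfolding nxt.simps v8 dec by (simp del: key.simps upt_rec_numeral)
  finally have r8: "rn adr nxt M 8 ?\<sigma> = ?\<sigma>'" .
  have pB: "0 < B ^ h" using B2 by simp
  have cb: "B - 1 + B * (B ^ h - 1) = B ^ Suc h - 1"
  proof -
    have "B * (B ^ h - 1) = B * B ^ h - B" by (simp add: diff_mult_distrib2)
    moreover have "B * 1 \<le> B * B ^ h" using pB by (intro mult_le_mono2) linarith
    ultimately show ?thesis using B2 by simp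
  qed
  have child: "B - 1 + ?i * (B ^ h - 1) + (B ^ h - 1) \<le> B ^ Suc h - 1"
  proof -
    have "Suc ?i * (B ^ h - 1) \<le> B * (B ^ h - 1)" using iB by (intro mult_le_mono1) simp
    thus ?thesis using cb by simp
  qed
  have pSuc: "1 \<le> B ^ Suc h" using B2 by simp
  have IH: "(\<forall>n\<le>8 * h. rn adr nxt M n ?\<sigma>' \<in> Q) \<and> (\<forall>n<8 * h. adr (rn adr nxt M n ?\<sigma>') < B ^ H - 1) \<and>
    out (rn adr nxt M (8 * h) ?\<sigma>') = ?acc + (\<Sum>i<u mod S h. A (?p + i))"
  proof (rule Suc.IH)
    show "h \<le> H" using hH by simp
    show "u mod S h < S h" using S_pos by simp
    show "?acc + ones h A ?p \<le> S H"
    proof -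
      have "(\<Sum>i<?i * S h. A (p + i)) + ones h A ?p = (\<Sum>j<Suc ?i. ?x j)" 
        by (subst sum.lessThan_Suc) (simp only: ones_prefix)
      also have "\<dots> \<le> (\<Sum>j<B. ?x j)" using iB by (intro sum_mono2) auto
      finally have "(\<Sum>i<?i * S h. A (p + i)) + ones h A ?p \<le> ?N" unfolding N .
      thus ?thesis using Suc(5) by simp
    qed
    show "?base + B ^ h \<le> B ^ H" using child Suc(6) pB pSuc by linarith
    fix i assume i: "i < B ^ h - 1"
    have "M (base + (B - 1 + ?i * (B ^ h - 1) + i)) = cont (Suc h) A p (B - 1 + ?i * (B ^ h - 1) + i)"
      by (rule Suc(4)) (use child i in linarith)
    also have "\<dots> = cont h A ?p i" using i by (simp add: add.assoc)
    finally show "M (?base + i) = cont h A ?p i" by (simp add: add.assoc)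
  qed
  have SQ: "S H < 2 ^ q" using Sle by (simp add: S_def)
  have BSH: "B ^ H \<le> S H" using q1 by (simp add: S_def)
  have uS: "u < S H" using Suc(3) S_mono[of "Suc h"] hH by linarith
  have st: "rn adr nxt M n ?\<sigma> \<in> Q \<and> adr (rn adr nxt M n ?\<sigma>) < B ^ H - 1" if n: "n \<le> 7" for n
  proof -
    note m = micro[OF hH n, of M ?N ?c u acc base]
    have "set (map (\<lambda>r. M (base + pr h ?N ?c ?i r)) [0..<n]) \<subseteq> {..<2 ^ g}" using assms(6) by auto
    moreover have "?N < 2 ^ q" "acc < 2 ^ q" using Suc(5) SQ by linarith+
    moreover have "base < 2 ^ q" using Suc(6) BSH SQ pSuc by linarith
    moreover have "Suc h < 2 ^ q" using hH Hle by linarith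
    moreover have "?c < 2 ^ (33 * q)" using key_less[of "Suc h" p] Kle[of "Suc h" ?N] hH by simp
    moreover have "u < 2 ^ q" using uS SQ by linarith
    ultimately have 1: "rn adr nxt M n ?\<sigma> \<in> Q" unfolding m Q_def using n by (simp del: key.simps)
    have "adr (rn adr nxt M n ?\<sigma>) = base + pr h ?N ?c ?i n" unfolding m by (simp del: key.simps)
    also have "\<dots> < base + (B - 1)" using prl[of n] n by simp
    also have "\<dots> \<le> base + (B ^ Suc h - 1)" using BB by simp
    also have "\<dots> \<le> B ^ H - 1" using Suc(6) pSuc by linarith
    finally show ?thesis using 1 by simp
  qed
  have split: "rn adr nxt M n ?\<sigma> = rn adr nxt M (n - 8) ?\<sigma>'" if "8 \<le> n" for n
    using rn_add[of adr nxt M 8 "n - 8" ?\<sigma>] that r8 by simp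
  have A: "\<forall>n\<le>8 * Suc h. rn adr nxt M n ?\<sigma> \<in> Q"
  proof (intro allI impI)
    fix n assume "n \<le> 8 * Suc h"
    thus "rn adr nxt M n ?\<sigma> \<in> Q" using st[of n] IH split[of n] by (cases "n \<le> 7") auto
  qed
  have C: "\<forall>n<8 * Suc h. adr (rn adr nxt M n ?\<sigma>) < B ^ H - 1"
  proof (intro allI impI)
    fix n assume "n < 8 * Suc h"
    thus "adr (rn adr nxt M n ?\<sigma>) < B ^ H - 1" using st[of n] IH split[of n] by (cases "n \<le> 7") auto
  qed
  have "out (rn adr nxt M (8 * Suc h) ?\<sigma>) = ?acc + (\<Sum>i<u mod S h. A (?p + i))"
    using IH split[of "8 * Suc h"] by simp
  also have "\<dots> = acc + (\<Sum>i<u. A (p + i))"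
  proof -
    have "(\<Sum>i<u. A (p + i)) = (\<Sum>i<?i * S h + u mod S h. A (p + i))" by simp
    also have "\<dots> = (\<Sum>i<?i * S h. A (p + i)) + (\<Sum>i<u mod S h. A (p + (?i * S h + i)))"
      by (rule sum_lessThan_add)
    finally show ?thesis by (simp add: add.assoc)
  qed
  finally show ?case using A C by blast
qed

end

text \<open>Five components of \<open>q\<close> bits and a spill of \<open>33 * q\<close> bits give
  \<open>38 * q\<close>; the list of at most seven cell values takes \<open>7 * 32 * q\<close> bits
  and another \<open>32 * q\<close> for its length, rounded generously.\<close>

lemma card_Q: "finite Q \<and> card Q \<le> 2 ^ (294 * q)"
proof -
  let ?V = "{vs :: nat list. set vs \<subseteq> {..<2 ^ g} \<and> length vs \<le> 7}"
  have fV: "finite ?V" by (rule finite_lists_length_le) simp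
  have g3: "8 \<le> (2::nat) ^ g"
  proof -
    have "(2::nat) ^ 3 \<le> 2 ^ g" using q1 by (intro power_increasing) (auto simp: g_def)
    thus ?thesis by simp
  qed
  have "card ?V = (\<Sum>i\<le>7. card {..<(2::nat) ^ g} ^ i)" by (rule card_lists_length_le) simp
  also have "\<dots> \<le> (\<Sum>i\<le>7::nat. (2 ^ g) ^ 7)" by (intro sum_mono) (simp add: power_increasing)
  also have "\<dots> = 8 * (2 ^ g) ^ 7" by simp
  also have "\<dots> \<le> 2 ^ g * (2 ^ g) ^ 7" using g3 by (rule mult_le_mono1)
  also have "\<dots> = 2 ^ (256 * q)" by (simp add: g_def flip: power_mult power_add)
  finally have V: "card ?V \<le> 2 ^ (256 * q)" .
  have "card Q = 2 ^ q * (2 ^ q * (2 ^ (33 * q) * (2 ^ q * (2 ^ q * (2 ^ q * card ?V)))))"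
    unfolding Q_def by (simp only: card_cartesian_product card_lessThan)
  also have "\<dots> \<le> 2 ^ q * (2 ^ q * (2 ^ (33 * q) * (2 ^ q * (2 ^ q * (2 ^ q * 2 ^ (256 * q))))))"
    using V by (intro mult_le_mono2)
  also have "\<dots> = 2 ^ (294 * q)" by (simp flip: power_add)
  finally show ?thesis using fV by (simp add: Q_def)
qed

lemma block: "block_ds (32 * q) (S H) (8 * H) (B ^ H - 1) (2 ^ (294 * q)) (2 ^ (34 * q))"
proof -
  define R where "R = {..<(2::nat) ^ q} \<times> {..<(2::nat) ^ (33 * q)}"
  have R: "finite R" "card R = 2 ^ (34 * q)" by (simp_all add: R_def flip: power_add)
  have Qf: "finite Q" and Qc: "card Q \<le> 2 ^ (294 * q)" using card_Q by auto
  define cc where "cc \<sigma> = (if \<sigma> \<in> Q then idx Q \<sigma> else 0)" for \<sigma>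
  have cc: "cc \<sigma> < 2 ^ (294 * q)" for \<sigma>
    using idx_less[OF Qf, of \<sigma>] Qc by (auto simp: cc_def)
  have m1: "1 \<le> B ^ H - 1"
  proof -
    have "2 ^ 1 \<le> B ^ H" using B2 H1 by (meson le_trans one_le_numeral power_increasing power_mono zero_le)
    thus ?thesis by simp
  qed
  define ini where "ini \<rho> u = cc (H, fst (elt R \<rho>), snd (elt R \<rho>), u, 0, 0, [])" for \<rho> u
  \<comment> \<open>Defaults and clamping keep the entries for states outside the trajectories
    within the bounds of \<open>block_ds\<close>.\<close>
  define ad where "ad c = (if adr (elt Q c) < B ^ H - 1 then adr (elt Q c) else 0)" for c
  define nx where "nx c v = cc (nxt (elt Q c) v)" for c v
  define ou where "ou c = min (S H) (out (elt Q c))" for c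
  show ?thesis unfolding block_ds_def
  proof (rule exI[of _ ini], rule exI[of _ ad], rule exI[of _ nx], rule exI[of _ ou], intro conjI allI impI)
    show "ini \<rho> u < 2 ^ (294 * q)" for \<rho> u by (simp add: ini_def cc)
    show "nx \<sigma> v < 2 ^ (294 * q)" for \<sigma> v by (simp add: nx_def cc)
    show "ad \<sigma> < B ^ H - 1" for \<sigma> 
    using m1 unfolding ad_def by (metis One_nat_def Suc_le_lessD)
    show "ou \<sigma> \<le> S H" for \<sigma> by (simp add: ou_def)
    fix A :: "nat \<Rightarrow> nat" assume A: "\<forall>i. A i \<le> 1"
    define x k where "x = ones H A 0" and "k = key H A 0"
    have xk: "(x, k) \<in> R"
    proof -
      have "x \<le> S H" using ones_le[of A H 0] A by (simp add: x_def)
      moreover have "k < 2 ^ (33 * q)" using key_less[of A H 0] A Kle[of H x] by (simp add: x_def k_def)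
      ultimately show ?thesis using Sle by (simp add: R_def S_def)
    qed
    let ?M = "cont H A 0"
    show "\<exists>\<rho><2 ^ (34 * q). \<exists>M. (\<forall>i. M i < 2 ^ (32 * q)) \<and> (\<forall>u<S H. ou (rn ad nx M (8 * H) (ini \<rho> u)) = (\<Sum>i<u. A i))"
    proof (intro exI[of _ "idx R (x, k)"] conjI exI[of _ ?M] allI impI)
      show "idx R (x, k) < 2 ^ (34 * q)" using idx_less[OF R(1) xk] R(2) by simp
      show M: "?M i < 2 ^ (32 * q)" for i using cont_less[of A H 0 i] A by (simp add: g_def)
      fix u assume u: "u < S H"
      let ?\<sigma> = "(H, x, k, u, 0, 0, [])"
      have tr: "(\<forall>n\<le>8 * H. rn adr nxt ?M n ?\<sigma> \<in> Q) \<and> (\<forall>n<8 * H. adr (rn adr nxt ?M n ?\<sigma>) < B ^ H - 1) \<and>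
        out (rn adr nxt ?M (8 * H) ?\<sigma>) = 0 + (\<Sum>i<u. A (0 + i))"
        unfolding x_def k_def
        by (rule trajectory) (use A u M ones_le[of A H 0] in \<open>auto simp: g_def\<close>)
      have ini: "ini (idx R (x, k)) u = idx Q ?\<sigma>"
      proof -
        have "?\<sigma> \<in> Q" using tr rn.simps(1) by (metis le0)
        thus ?thesis by (simp add: ini_def elt_idx[OF R(1) xk] cc_def)
      qed
      have sim: "n \<le> 8 * H \<Longrightarrow> rn ad nx ?M n (ini (idx R (x, k)) u) = idx Q (rn adr nxt ?M n ?\<sigma>)" for n
      proof (induction n)
        case 0 thus ?case using ini by simp
      next
        case (Suc n)
        let ?s = "rn adr nxt ?M n ?\<sigma>"
        have s: "?s \<in> Q" "adr ?s < B ^ H - 1" using tr Suc by auto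
        have s': "nxt ?s (?M (adr ?s)) \<in> Q" using tr Suc(2) rn.simps(2) by metis
        have ih: "rn ad nx ?M n (ini (idx R (x, k)) u) = idx Q ?s" using Suc by simp
        have "ad (idx Q ?s) = adr ?s" using s by (simp add: ad_def elt_idx[OF Qf])
        hence "rn ad nx ?M (Suc n) (ini (idx R (x, k)) u) = nx (idx Q ?s) (?M (adr ?s))" by (simp only: rn.simps ih)
        also have "\<dots> = cc (nxt ?s (?M (adr ?s)))" using s by (simp only: nx_def elt_idx[OF Qf])
        also have "\<dots> = idx Q (rn adr nxt ?M (Suc n) ?\<sigma>)" using s' by (simp only: cc_def if_True rn.simps)
        finally show ?case .
      qed
      have "rn adr nxt ?M (8 * H) ?\<sigma> \<in> Q" using tr by simp
      hence "ou (rn ad nx ?M (8 * H) (ini (idx R (x, k)) u)) = min (S H) (\<Sum>i<u. A i)"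
        using sim[of "8 * H"] tr by (simp add: ou_def elt_idx[OF Qf])
      also have "(\<Sum>i<u. A i) \<le> (\<Sum>i<u. 1)" using A by (intro sum_mono) auto
      hence "min (S H) (\<Sum>i<u. A i) = (\<Sum>i<u. A i)" using u by simp
      finally show "ou (rn ad nx ?M (8 * H) (ini (idx R (x, k)) u)) = (\<Sum>i<u. A i)" .
    qed
  qed
qed

end

section \<open>Induction over the levels\<close>

lemma (in chain) node: "node_code (32 * q) B S K (\<lambda>N. card (FS N)) fin (\<lambda>x k j. cell x k (Suc j)) pr dec"
  unfolding node_code_def
proof (intro conjI allI impI)
  show "r < 8 \<Longrightarrow> pr N c i r < B - 1" for N c i r by (rule pr_less)
  fix x k assume "\<forall>j<B. x j \<le> S \<and> k j < K (x j)"
  hence v: "valid x k" by (simp add: valid_def)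
  show "fin x k < card (FS (\<Sum>i<B. x i))" using fin_less[OF v] by (simp add: pre_def)
  show "j < B - 1 \<Longrightarrow> cell x k (Suc j) < 2 ^ (32 * q)" for j using cell_less[OF v, of "Suc j"] by simp
  fix i vs assume i: "i < B" and vs: "\<forall>r<8. vs r = cell x k (Suc (pr (\<Sum>i<B. x i) (fin x k) i r))"
  show "dec (\<Sum>i<B. x i) (fin x k) i vs = (\<Sum>j<i. x j, x i, k i)"
    using dec_correct[OF v i refl refl, of vs] vs by (simp add: pre_def)
qed

lemma node_exists:
  assumes q: "16 \<le> q" and S: "even S" "1 \<le> S"
    and B: "2 \<le> B" "8 * B * S \<le> 2 ^ q" "100 * q * S \<le> 2 ^ q" "32 ^ B \<le> (2::nat) ^ q" "(2 ^ 26 * q ^ 4) ^ B \<le> (2::nat) ^ q"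
    and e: "2 ^ (10 * q) \<le> e" "e \<le> 2 ^ (12 * q)"
    and K: "\<And>x. real (K x) \<le> 2 ^ (32 * q) * real (S choose x) / 2 ^ S + (real (e * e) - 4)"
  shows "\<exists>K' fin cell pr dec. node_code (32 * q) B S K K' fin cell pr dec \<and>
     (\<forall>N. real (K' N) \<le> 2 ^ (32 * q) * real (B * S choose N) / 2 ^ (B * S) + 9 * real B * real (e * e))"
proof -
  interpret window q S using q S by unfold_locales auto
  interpret chain q S B L e T fst a b K
    by (rule chainI[OF B e, of "real (e * e) - 4"]) (use K in auto)
  show ?thesis using node card_FS unfolding bet_def E_def by blast
qed

lemma block_ds_exists:
  assumes q: "16 \<le> q" and B: "3 \<le> B" and H: "1 \<le> H"
    and SH: "8 * B * (32 * q * B ^ H) \<le> 2 ^ q" "100 * q * (32 * q * B ^ H) \<le> 2 ^ q"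
    and B': "32 ^ B \<le> (2::nat) ^ q" "(2 ^ 26 * q ^ 4) ^ B \<le> (2::nat) ^ q"
  shows "block_ds (32 * q) (32 * q * B ^ H) (8 * H) (B ^ H - 1) (2 ^ (294 * q)) (2 ^ (34 * q))"
proof -
  define S where "S h = 32 * q * B ^ h" for h
  \<comment> \<open>The error \<open>e * e\<close> has to grow by \<open>9 * B\<close> and leave 4
    in reserve. Tripling \<open>B\<close> multiplies it by \<open>9 * B * B\<close>, at least
    \<open>27 * B\<close> because \<open>B \<ge> 3\<close>.\<close>
  define e where "e h = 2 ^ (10 * q) * (3 * B) ^ h" for h
  define P where "P h K \<longleftrightarrow> (h = 0 \<longrightarrow> K = (choose) (32 * q)) \<and>
     (h \<le> H \<longrightarrow> (\<forall>x. real (K x) \<le> 2 ^ (32 * q) * real (S h choose x) / 2 ^ S h + (real (e h * e h) - 4)))"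
    for h :: nat and K :: "nat \<Rightarrow> nat"
  define R where "R h K K' \<longleftrightarrow> (h < H \<longrightarrow> (\<exists>fin cell pr dec. node_code (32 * q) B (S h) K K' fin cell pr dec))"
    for h :: nat and K K' :: "nat \<Rightarrow> nat"
  have Smono: "S h \<le> S H" if "h \<le> H" for h using that B by (simp add: S_def power_increasing)
  have S1: "1 \<le> S h" for h using q B by (simp add: S_def Suc_le_eq)
  have SHq: "S H < 2 ^ q"
  proof -
    have "2 * S H \<le> 8 * B * S H" using B by (intro mult_le_mono1) simp
    thus ?thesis using SH(1)[folded S_def] S1[of H] by linarith
  qed
  have e_ge: "2 ^ (10 * q) \<le> e h" for h using B by (simp add: e_def)
  have e_le: "e h \<le> 2 ^ (12 * q)" if "h \<le> H" for h
  proof -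
    have "(3 * B) ^ h \<le> (B * B) ^ h" using B by (intro power_mono) auto
    also have "\<dots> = B ^ h * B ^ h" by (simp add: power_mult_distrib)
    also have "\<dots> \<le> S h * S h" using q by (intro mult_le_mono) (auto simp: S_def)
    also have "\<dots> \<le> S H * S H" using Smono[OF that] by (intro mult_le_mono)
    also have "\<dots> \<le> 2 ^ q * 2 ^ q" using SHq by (intro mult_le_mono) auto
    finally have "e h \<le> 2 ^ (10 * q) * (2 ^ q * 2 ^ q)" unfolding e_def by (rule mult_le_mono2)
    also have "\<dots> = 2 ^ (12 * q)" by (simp flip: power_add)
    finally show ?thesis .
  qed
  have e4: "4 \<le> real (e h * e h)" for h
  proof -
    have "(2::nat) ^ 1 \<le> 2 ^ (10 * q)" using q by (intro power_increasing) auto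
    hence "2 \<le> e h" using e_ge[of h] by simp
    hence "2 * 2 \<le> e h * e h" by (intro mult_le_mono)
    thus ?thesis by (metis (mono_tags) numeral_times_numeral of_nat_le_iff of_nat_numeral semiring_norm(12) semiring_norm(13) semiring_norm(11))
  qed
  \<comment> \<open>The bound for the spills of a level only comes into existence with the code of
    the level below, hence the dependent choice.\<close>
  have "\<exists>K. \<forall>n. P n (K n) \<and> R n (K n) (K (Suc n))"
  proof (rule dependent_nat_choice)
    show "\<exists>K. P 0 K"
    proof
      \<comment> \<open>At a leaf \<open>S 0 = 32 * q\<close>, so the powers of 2 cancel and the
        spill of \<open>g\<close> bits is coded without loss.\<close>
      show "P 0 ((choose) (32 * q))" using e4[of 0] by (simp add: P_def S_def)
    qed
  next
    fix K n assume P: "P n K"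
    show "\<exists>K'. P (Suc n) K' \<and> R n K K'"
    proof (cases "n < H")
      case False thus ?thesis by (auto simp: P_def R_def)
    next
      case True
      have Sn: "S n \<le> S H" using Smono True by simp
      have "\<exists>K' fin cell pr dec. node_code (32 * q) B (S n) K K' fin cell pr dec \<and>
        (\<forall>N. real (K' N) \<le> 2 ^ (32 * q) * real (B * S n choose N) / 2 ^ (B * S n) + 9 * real B * real (e n * e n))"
      proof (rule node_exists[OF q])
        show "even (S n)" by (simp add: S_def)
        show "1 \<le> S n" by (rule S1)
        show "2 \<le> B" using B by simp
        show "8 * B * S n \<le> 2 ^ q" using mult_le_mono2[OF Sn, of "8 * B"] SH(1)[folded S_def] by (rule le_trans)
        show "100 * q * S n \<le> 2 ^ q" using mult_le_mono2[OF Sn, of "100 * q"] SH(2)[folded S_def] by (rule le_trans)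
        show "e n \<le> 2 ^ (12 * q)" using e_le True by simp
        show "real (K x) \<le> 2 ^ (32 * q) * real (S n choose x) / 2 ^ S n + (real (e n * e n) - 4)" for x
          using P True by (simp add: P_def)
      qed (use B' e_ge in auto)
      then obtain K' fin cell pr dec where K': "node_code (32 * q) B (S n) K K' fin cell pr dec"
        "\<And>N. real (K' N) \<le> 2 ^ (32 * q) * real (B * S n choose N) / 2 ^ (B * S n) + 9 * real B * real (e n * e n)" by blast
      have "9 * real B * real (e n * e n) \<le> real (e (Suc n) * e (Suc n)) - 4"
      proof -
        have "9 * real B * real (e n * e n) + 1 * real (e n * e n) \<le> (9 * real B + 9 * real B * 2) * real (e n * e n)"
          using B unfolding distrib_right[symmetric] by (intro mult_right_mono) auto
        also have "\<dots> \<le> (9 * real B * real B) * real (e n * e n)" using B by (intro mult_right_mono) auto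
        also have "\<dots> = real (e (Suc n) * e (Suc n))" by (simp add: e_def)
        finally show ?thesis using e4[of n] by linarith
      qed
      note le = this
      have BS: "B * S n = S (Suc n)" by (simp add: S_def)
      have "real (K' N) \<le> 2 ^ (32 * q) * real (S (Suc n) choose N) / 2 ^ S (Suc n) + (real (e (Suc n) * e (Suc n)) - 4)" for N
        using K'(2)[of N] le unfolding BS by linarith
      hence "P (Suc n) K'" unfolding P_def by simp
      moreover have "R n K K'" unfolding R_def using K'(1) by blast
      ultimately show ?thesis by blast
    qed
  qed
  then obtain K where K: "\<And>n. P n (K n)" "\<And>n. R n (K n) (K (Suc n))" by blast
  have "\<forall>h. \<exists>fin cell pr dec. h < H \<longrightarrow> node_code (32 * q) B (S h) (K h) (K (Suc h)) fin cell pr dec"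
    using K(2) unfolding R_def by blast
  then obtain fin cell pr dec where nd: "\<And>h. h < H \<Longrightarrow> node_code (32 * q) B (S h) (K h) (K (Suc h)) (fin h) (cell h) (pr h) (dec h)"
    by metis
  interpret tree q B H K fin cell pr dec
  proof
    show "1 \<le> q" "2 \<le> B" "1 \<le> H" using q B H by auto
    show "node_code (32 * q) B (32 * q * B ^ h) (K h) (K (Suc h)) (fin h) (cell h) (pr h) (dec h)" if "h < H" for h
      using nd[OF that] by (simp add: S_def)
    show "K 0 x = (32 * q choose x)" for x using K(1)[of 0] by (simp add: P_def)
    show "32 * q * B ^ H < 2 ^ q" using SHq by (simp add: S_def)
    have "H < 2 ^ H" by (rule less_exp)
    also have "\<dots> \<le> B ^ H" using B by (intro power_mono) auto
    also have "\<dots> \<le> S H" using q by (simp add: S_def)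
    finally show "H < 2 ^ q" using SHq by simp
    show "K h x \<le> 2 ^ (33 * q)" if h: "h \<le> H" for h x
    proof -
      have "S h choose x \<le> 2 ^ S h" by (rule binomial_le_pow2)
      hence "real (S h choose x) \<le> 2 ^ S h" by (metis of_nat_le_iff of_nat_numeral of_nat_power)
      hence c: "2 ^ (32 * q) * real (S h choose x) / 2 ^ S h \<le> 2 ^ (32 * q)" by (simp add: divide_le_eq)
      have "e h * e h \<le> 2 ^ (12 * q) * 2 ^ (12 * q)" using e_le[OF h] by (intro mult_le_mono)
      also have "\<dots> = 2 ^ (24 * q)" by (simp flip: power_add)
      also have "\<dots> \<le> 2 ^ (32 * q)" by (intro power_increasing) auto
      finally have "real (e h * e h) \<le> 2 ^ (32 * q)" by (metis of_nat_le_iff of_nat_numeral of_nat_power)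
      hence "real (K h x) \<le> 2 * 2 ^ (32 * q)" 
        using conjunct2[OF K(1)[of h, unfolded P_def], rule_format, OF h, of x] c by linarith
      also have "\<dots> = 2 ^ (32 * q + 1)" by simp
      also have "\<dots> \<le> 2 ^ (33 * q)" using q by (intro power_increasing) auto
      finally show ?thesis by (metis of_nat_le_iff of_nat_numeral of_nat_power)
    qed
  qed
  show ?thesis using block by (simp add: S_def tree.S_def[OF tree_axioms])
qed

section \<open>The program\<close>

text \<open>
  The memory starts with eleven parameters: block size, number of probes, word size, \<open>2\<^sup>g\<close>, the addresses of the
  four tables of the automaton (initial states, probe addresses, transitions, output), of the roots and of the
  packed cells, and the number of bits per block. Registers 12, 13: block and position in it; 16: number of ones before the
  block; 18: state; 19: first bit of the block; 21: number of probes made.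
\<close>

definition prog :: "instr list" where
  "prog = [Const 20 0, Load 1 20, Const 20 1, Load 2 20, Const 20 2, Load 3 20,
     Const 20 3, Load 4 20, Const 20 4, Load 5 20, Const 20 5, Load 6 20,
     Const 20 6, Load 7 20, Const 20 7, Load 8 20, Const 20 8, Load 9 20,
     Const 20 9, Load 10 20, Const 20 10, Load 11 20, Op Div 12 0 1, Op Mod 13 0 1,
     Op Add 14 12 12, Op Add 14 14 9, Load 15 14, Const 20 1, Op Add 14 14 20, Load 16 14,
     Op Mul 17 15 1, Op Add 17 17 13, Op Add 17 17 5, Load 18 17, Op Mul 19 12 11, Const 21 0,
     JumpEq 21 2 57, Op Add 22 18 6, Load 22 22, Op Add 22 22 19, Op Div 23 22 3, Op Mod 24 22 3,
     Op Add 23 23 10, Load 25 23, Op Add 23 23 20, Load 26 23, Op Shr 25 25 24, Op Sub 24 3 24,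
     Op Shl 26 26 24, Op Or 25 25 26, Op Mod 25 25 4, Op Mul 22 18 4, Op Add 22 22 25, Op Add 22 22 7,
     Load 18 22, Op Add 21 21 20, Jump 36, Op Add 22 18 8, Load 22 22, Op Add 0 16 22,
     Halt]"

lemma length_prog: "length prog = 61" by (simp add: prog_def)

lemma prog_nth:
  "prog ! 0 = Const 20 0"
  "prog ! 1 = Load 1 20"
  "prog ! 2 = Const 20 1"
  "prog ! 3 = Load 2 20"
  "prog ! 4 = Const 20 2"
  "prog ! 5 = Load 3 20"
  "prog ! 6 = Const 20 3"
  "prog ! 7 = Load 4 20"
  "prog ! 8 = Const 20 4"
  "prog ! 9 = Load 5 20"
  "prog ! 10 = Const 20 5"
  "prog ! 11 = Load 6 20"
  "prog ! 12 = Const 20 6"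
  "prog ! 13 = Load 7 20"
  "prog ! 14 = Const 20 7"
  "prog ! 15 = Load 8 20"
  "prog ! 16 = Const 20 8"
  "prog ! 17 = Load 9 20"
  "prog ! 18 = Const 20 9"
  "prog ! 19 = Load 10 20"
  "prog ! 20 = Const 20 10"
  "prog ! 21 = Load 11 20"
  "prog ! 22 = Op Div 12 0 1"
  "prog ! 23 = Op Mod 13 0 1"
  "prog ! 24 = Op Add 14 12 12"
  "prog ! 25 = Op Add 14 14 9"
  "prog ! 26 = Load 15 14"
  "prog ! 27 = Const 20 1"
  "prog ! 28 = Op Add 14 14 20"
  "prog ! 29 = Load 16 14"
  "prog ! 30 = Op Mul 17 15 1"
  "prog ! 31 = Op Add 17 17 13"
  "prog ! 32 = Op Add 17 17 5"
  "prog ! 33 = Load 18 17"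
  "prog ! 34 = Op Mul 19 12 11"
  "prog ! 35 = Const 21 0"
  "prog ! 36 = JumpEq 21 2 57"
  "prog ! 37 = Op Add 22 18 6"
  "prog ! 38 = Load 22 22"
  "prog ! 39 = Op Add 22 22 19"
  "prog ! 40 = Op Div 23 22 3"
  "prog ! 41 = Op Mod 24 22 3"
  "prog ! 42 = Op Add 23 23 10"
  "prog ! 43 = Load 25 23"
  "prog ! 44 = Op Add 23 23 20"
  "prog ! 45 = Load 26 23"
  "prog ! 46 = Op Shr 25 25 24"
  "prog ! 47 = Op Sub 24 3 24"
  "prog ! 48 = Op Shl 26 26 24"
  "prog ! 49 = Op Or 25 25 26"
  "prog ! 50 = Op Mod 25 25 4"
  "prog ! 51 = Op Mul 22 18 4"
  "prog ! 52 = Op Add 22 22 25"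
  "prog ! 53 = Op Add 22 22 7"
  "prog ! 54 = Load 18 22"
  "prog ! 55 = Op Add 21 21 20"
  "prog ! 56 = Jump 36"
  "prog ! 57 = Op Add 22 18 8"
  "prog ! 58 = Load 22 22"
  "prog ! 59 = Op Add 0 16 22"
  "prog ! 60 = Halt"
  by (simp_all add: prog_def)

lemmas exec = length_prog prog_nth prog_nth(2)[unfolded One_nat_def] numeral_2_eq_2[symmetric] set_reg_def

section \<open>Unpacking a cell, and the running time of the program\<close>

context
  includes bit_operations_syntax
begin

text \<open>A field of \<open>g\<close> bits lies in at most two neighbouring words. For
  \<open>r = 0\<close> the second word is shifted by \<open>w\<close> and vanishes modulo
  \<open>2 ^ w\<close>; bits above the field are cut off by the final \<open>mod\<close>.\<close>

lemma unpack_bits: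
  fixes X w g pos :: nat
  assumes w: "0 < w" and g: "g \<le> w"
  defines "i \<equiv> pos div w" and "r \<equiv> pos mod w"
  shows "(drop_bit r (X div 2 ^ (w * i) mod 2 ^ w) OR (push_bit (w - r) (X div 2 ^ (w * Suc i) mod 2 ^ w) mod 2 ^ w)) mod 2 ^ g
    = X div 2 ^ pos mod 2 ^ g"
proof -
  have r: "r < w" using w by (simp add: r_def)
  have pos: "pos = w * i + r" by (simp add: i_def r_def)
  show ?thesis
    unfolding take_bit_eq_mod[symmetric] drop_bit_eq_div[symmetric]
  proof (rule bit_eqI)
    fix k
    have 2: "w * Suc i + (k - (w - r)) = pos + k" if "w - r \<le> k" using that r pos by simp
    show "bit (take_bit g (drop_bit r (take_bit w (drop_bit (w * i) X)) OR take_bit w (push_bit (w - r) (take_bit w (drop_bit (w * Suc i) X))))) k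
      = bit (take_bit g (drop_bit pos X)) k"
    proof (cases "k < g")
      case False thus ?thesis by (simp only: bit_take_bit_iff) simp
    next
      case True
      hence kw: "k < w" using g by simp
      show ?thesis
      proof (cases "w - r \<le> k")
        case True
        hence "\<not> k + r < w" "k - (w - r) < w" using r kw by auto
        thus ?thesis using True \<open>k < g\<close> kw 2
          by (simp add: bit_take_bit_iff bit_or_iff bit_drop_bit_eq bit_push_bit_iff add.commute del: mult_Suc_right)
      next
        case False
        hence "k + r < w" by simp
        thus ?thesis using False \<open>k < g\<close> kw
          by (simp add: bit_take_bit_iff bit_or_iff bit_drop_bit_eq bit_push_bit_iff pos ac_simps)
      qed
    qed
  qed
qed

lemma exec_init:
  assumes par: "\<And>i. i < 11 \<Longrightarrow> i < length M \<and> M ! i = ps i" and w: "11 < (2::nat) ^ w"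
    and b: "x div ps 0 + x div ps 0 + ps 8 < 2 ^ w"
      "x div ps 0 + x div ps 0 + ps 8 + 1 < 2 ^ w" "x div ps 0 + x div ps 0 + ps 8 + 1 < length M"
    and rho: "M ! (x div ps 0 + x div ps 0 + ps 8) = \<rho>" and pref: "M ! (x div ps 0 + x div ps 0 + ps 8 + 1) = pf"
    and s: "\<rho> * ps 0 + x mod ps 0 + ps 4 < 2 ^ w" "\<rho> * ps 0 + x mod ps 0 + ps 4 < length M"
      "M ! (\<rho> * ps 0 + x mod ps 0 + ps 4) = \<sigma>"
    and bb: "x div ps 0 * ps 10 < 2 ^ w"
  shows "\<exists>R. run w prog (k + 36) \<lparr>pc = 0, regs = (\<lambda>_. 0)(0 := x), mem = M\<rparr> = run w prog k \<lparr>pc = 36, regs = R, mem = M\<rparr> \<and>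
     (\<forall>i<11. R (Suc i) = ps i) \<and> R 16 = pf \<and> R 18 = \<sigma> \<and> R 19 = x div ps 0 * ps 10 \<and> R 20 = 1 \<and> R 21 = 0"
proof -
  have M: "M ! 0 = ps 0" "M ! (Suc 0) = ps 1" "M ! 2 = ps 2" "M ! 3 = ps 3" "M ! 4 = ps 4" "M ! 5 = ps 5" "M ! 6 = ps 6"
    "M ! 7 = ps 7" "M ! 8 = ps 8" "M ! 9 = ps 9" "M ! 10 = ps 10" using par by auto
  have l: "10 < length M" using par[of 10] by simp
  have l': "M \<noteq> []" "Suc 0 < length M" "2 < length M" "3 < length M" "4 < length M" "5 < length M" "6 < length M" "7 < length M"
    "8 < length M" "9 < length M" using l by auto
  have m: "2 mod (2::nat) ^ w = 2" "3 mod (2::nat) ^ w = 3" "4 mod (2::nat) ^ w = 4" "5 mod (2::nat) ^ w = 5" "6 mod (2::nat) ^ w = 6"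
    "7 mod (2::nat) ^ w = 7" "8 mod (2::nat) ^ w = 8" "9 mod (2::nat) ^ w = 9" "10 mod (2::nat) ^ w = 10" "Suc 0 mod (2::nat) ^ w = Suc 0"
    using w by (simp_all only: mod_less)
  have w0: "0 < w" using w by (cases w) auto
  have b': "x div ps 0 + x div ps 0 < 2 ^ w" "x div ps 0 + x div ps 0 + ps 8 < length M" using b by linarith+
  have s': "\<rho> * ps 0 + x mod ps 0 < 2 ^ w" "\<rho> * ps 0 < 2 ^ w" using s by linarith+
  have k: "k + 36 = (Suc (Suc (Suc (Suc (Suc (Suc (Suc (Suc (Suc (Suc (Suc (Suc (Suc (Suc (Suc (Suc (Suc (Suc (Suc (Suc (Suc (Suc (Suc (Suc (Suc (Suc (Suc (Suc (Suc (Suc (Suc (Suc (Suc (Suc (Suc (Suc k))))))))))))))))))))))))))))))))))))" by simp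
  have r11: "(\<forall>i<11. Q (Suc i) = ps i) \<longleftrightarrow> Q 1 = ps 0 \<and> Q 2 = ps 1 \<and> Q 3 = ps 2 \<and> Q 4 = ps 3 \<and> Q 5 = ps 4 \<and> Q 6 = ps 5 \<and> Q 7 = ps 6 \<and>
     Q 8 = ps 7 \<and> Q 9 = ps 8 \<and> Q 10 = ps 9 \<and> Q 11 = ps 10" for Q
    by (simp add: numeral_eq_Suc All_less_Suc) blast
  show ?thesis
    unfolding k r11
    \<comment> \<open>The registers reached stay schematic: simplifying the run instantiates them,
      and the last call reads off their entries.\<close>
    apply (rule exI, rule conjI)
    apply (simp add: exec M l l' m b b' b(2,3)[simplified] w0 s s' bb rho pref[simplified])
    by (simp add: rho pref s)
qed

lemma exec_body:
  assumes R: "\<forall>i<11. R (Suc i) = ps i" "R 18 = \<sigma>" "R 19 = bb" "R 20 = 1" "R 21 = cnt"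
    and cnt: "cnt \<noteq> ps 1" "cnt + 1 < 2 ^ w"
    and a: "\<sigma> + ps 5 < 2 ^ w" "\<sigma> + ps 5 < length M" "M ! (\<sigma> + ps 5) = off"
    and p: "off + bb = pos" "pos < 2 ^ w"
    and d: "pos div ps 2 + ps 9 + 1 < 2 ^ w" "pos div ps 2 + ps 9 + 1 < length M"
      "M ! (pos div ps 2 + ps 9) = lo" "M ! (pos div ps 2 + ps 9 + 1) = hi"
    and w: "ps 2 = w" "w < 2 ^ w" "0 < w"
    and v: "(drop_bit (pos mod w) lo OR (push_bit (w - pos mod w) hi mod 2 ^ w)) mod ps 3 = v"
    and n: "\<sigma> * ps 3 + v + ps 6 < 2 ^ w" "\<sigma> * ps 3 + v + ps 6 < length M" "M ! (\<sigma> * ps 3 + v + ps 6) = \<sigma>'"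
  shows "\<exists>R'. run w prog (k + 21) \<lparr>pc = 36, regs = R, mem = M\<rparr> = run w prog k \<lparr>pc = 36, regs = R', mem = M\<rparr> \<and>
     (\<forall>i<11. R' (Suc i) = ps i) \<and> R' 16 = R 16 \<and> R' 18 = \<sigma>' \<and> R' 19 = bb \<and> R' 20 = 1 \<and> R' 21 = cnt + 1"
proof -
  have r11: "(\<forall>i<11. Q (Suc i) = ps i) \<longleftrightarrow> Q 1 = ps 0 \<and> Q 2 = ps 1 \<and> Q 3 = ps 2 \<and> Q 4 = ps 3 \<and> Q 5 = ps 4 \<and> Q 6 = ps 5 \<and> Q 7 = ps 6 \<and>
     Q 8 = ps 7 \<and> Q 9 = ps 8 \<and> Q 10 = ps 9 \<and> Q 11 = ps 10" for Q
    by (simp add: numeral_eq_Suc All_less_Suc) blast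
  have k: "k + 21 = (Suc (Suc (Suc (Suc (Suc (Suc (Suc (Suc (Suc (Suc (Suc (Suc (Suc (Suc (Suc (Suc (Suc (Suc (Suc (Suc (Suc k)))))))))))))))))))))" by simp
  have d': "pos div w + ps 9 < 2 ^ w" "pos div w + ps 9 < length M" "Suc (pos div w + ps 9) < 2 ^ w" "Suc (pos div w + ps 9) < length M"
    "M ! (pos div w + ps 9) = lo" "M ! Suc (pos div w + ps 9) = hi" using d w by auto
  have n': "\<sigma> * ps 3 + v < 2 ^ w" "\<sigma> * ps 3 < 2 ^ w" using n by linarith+
  have mw: "pos mod w < w" using w by simp
  have sb: "(w + 2 ^ w - pos mod w) mod 2 ^ w = w - pos mod w"
  proof -
    have "w + 2 ^ w - pos mod w = (w - pos mod w) + 2 ^ w" using mw by simp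
    hence "(w + 2 ^ w - pos mod w) mod 2 ^ w = (w - pos mod w) mod 2 ^ w" by (metis mod_add_self2)
    thus ?thesis using w mw by simp
  qed
  have c': "Suc cnt < 2 ^ w" using cnt by simp
  note R' = R[unfolded r11]
  have R1: "R (Suc 0) = ps 0" using R(1) by simp
  show ?thesis
    unfolding k r11
    apply (rule exI, rule conjI)
    apply (simp add: exec R' cnt(1)[simplified] c' a p d' w v n n' sb)
    by (simp add: R' R1 n w)
qed

lemma exec_end:
  assumes R: "\<forall>i<11. R (Suc i) = ps i" "R 18 = \<sigma>" "R 16 = pf" "R 21 = ps 1"
    and a: "\<sigma> + ps 7 < 2 ^ w" "\<sigma> + ps 7 < length M" "M ! (\<sigma> + ps 7) = y" "pf + y < 2 ^ w"
  shows "\<exists>s. run w prog (k + 5) \<lparr>pc = 36, regs = R, mem = M\<rparr> = Some s \<and> regs s 0 = pf + y \<and> mem s = M"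
proof -
  have r: "R 2 = ps 1" "R 8 = ps 7" using R(1)[rule_format, of 1] R(1)[rule_format, of 7] by (simp_all add: numeral_eq_Suc)
  have 5: "k + 5 = Suc (Suc (Suc (Suc (Suc k))))" by simp
  show ?thesis unfolding 5 by (simp add: exec r R(2-) a)
qed

end

section \<open>The memory image\<close>

lemma pack_digits:
  fixes c :: "nat \<Rightarrow> nat"
  assumes c: "\<And>j. c j < 2 ^ g"
  shows "\<exists>X < 2 ^ (g * N). \<forall>j<N. X div 2 ^ (g * j) mod 2 ^ g = c j"
proof (induction N)
  case 0 show ?case by auto
next
  case (Suc N)
  then obtain X where X: "X < 2 ^ (g * N)" "\<forall>j<N. X div 2 ^ (g * j) mod 2 ^ g = c j" by auto
  let ?X = "X + 2 ^ (g * N) * c N"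
  have "?X < 2 ^ (g * N) + 2 ^ (g * N) * c N" using X by simp
  also have "\<dots> = 2 ^ (g * N) * Suc (c N)" by simp
  also have "\<dots> \<le> 2 ^ (g * N) * 2 ^ g" using c[of N] by (intro mult_le_mono2) simp
  also have "\<dots> = 2 ^ (g * Suc N)" by (simp add: power_add)
  finally have less: "?X < 2 ^ (g * Suc N)" .
  have "?X div 2 ^ (g * j) mod 2 ^ g = c j" if j: "j < Suc N" for j
  proof (cases "j = N")
    case True thus ?thesis using X c[of N] by simp
  next
    case False
    hence jN: "j < N" using j by simp
    then obtain d where "N = Suc (j + d)" using less_imp_Suc_add by blast
    hence e: "g * N = g * j + (g + g * (N - Suc j))" by (simp add: algebra_simps)
    have "?X = X + 2 ^ (g * j) * (2 ^ g * (2 ^ (g * (N - Suc j)) * c N))"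
      by (simp only: e power_add mult.assoc)
    moreover have "(X + 2 ^ (g * j) * Z) div 2 ^ (g * j) = X div 2 ^ (g * j) + Z" for Z by simp
    ultimately have "?X div 2 ^ (g * j) = X div 2 ^ (g * j) + 2 ^ g * (2 ^ (g * (N - Suc j)) * c N)" by (simp only:)
    thus ?thesis using X jN by simp
  qed
  thus ?case using less by blast
qed

context
  includes bit_operations_syntax
begin

text \<open>\<open>Len\<close> lists the areas in order: parameters, four tables, two words per
  block (root value and preceding ones), packed cells. The extra block in \<open>Nb\<close> makes
  \<open>u = n\<close> an ordinary query. The time is 36 steps of setup, 21 per probe and 5 at the
  end.\<close>

lemma ram_block:
  fixes g S T m Qn Rn n w :: nat and A :: "nat list"
  defines "Nb \<equiv> n div S + 1"
  defines "Len \<equiv> 11 + Rn * S + Qn + Qn * 2 ^ g + Qn + 2 * Nb + (Nb * (m * g) div w + 2)"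
  assumes ds: "block_ds g S T m Qn Rn" and S: "1 \<le> S" and T: "T \<le> n" and g: "1 \<le> g" "g < w" and n: "n < 2 ^ w"
    and bits: "Nb * (m * g) \<le> n" and len: "Len \<le> n" and A: "A \<in> bit_arrays n"
  shows "\<exists>M\<in>memories w. length M = Len \<and> (\<forall>u\<le>n. answers_within w prog M (21 * T + 41) u (rank A u))"
proof -
  obtain ini adr nxt out where ini: "\<And>\<rho> u. ini \<rho> u < Qn" and nxt: "\<And>\<sigma> v. nxt \<sigma> v < Qn" and adr: "\<And>\<sigma>. adr \<sigma> < m"
    and out: "\<And>\<sigma>. out \<sigma> \<le> S"
    and blk: "\<And>A :: nat \<Rightarrow> nat. (\<forall>i. A i \<le> 1) \<Longrightarrow> \<exists>\<rho><Rn. \<exists>M. (\<forall>i. M i < 2 ^ g) \<and>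
        (\<forall>u<S. out (rn adr nxt M T (ini \<rho> u)) = (\<Sum>i<u. A i))"
    using ds unfolding block_ds_def by blast
  \<comment> \<open>Zeros fill the last block.\<close>
  define A' where "A' i = (if i < n then A ! i else 0)" for i
  have lA: "length A = n" using A by (simp add: bit_arrays_def)
  have A01: "set A \<subseteq> {0, 1}" using A by (simp add: bit_arrays_def)
  have A1: "A' i \<le> 1" for i
  proof (cases "i < n")
    case True
    hence "A ! i \<in> set A" using lA by (simp add: nth_mem)
    hence "A ! i \<in> {0, 1}" using A01 by blast
    thus ?thesis using True by (auto simp: A'_def)
  qed (simp add: A'_def)
  have "\<forall>b. \<exists>\<rho> Mb. \<rho> < Rn \<and> (\<forall>i. Mb i < 2 ^ g) \<and>
        (\<forall>u<S. out (rn adr nxt Mb T (ini \<rho> u)) = (\<Sum>i<u. A' (b * S + i)))"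
  proof
    fix b
    have "\<forall>i. A' (b * S + i) \<le> 1" using A1 by simp
    from blk[OF this] show "\<exists>\<rho> Mb. \<rho> < Rn \<and> (\<forall>i. Mb i < 2 ^ g) \<and>
        (\<forall>u<S. out (rn adr nxt Mb T (ini \<rho> u)) = (\<Sum>i<u. A' (b * S + i)))" by blast
  qed
  from choice[OF this] obtain \<rho> where "\<forall>b. \<exists>Mb. \<rho> b < Rn \<and> (\<forall>i. Mb i < 2 ^ g) \<and>
        (\<forall>u<S. out (rn adr nxt Mb T (ini (\<rho> b) u)) = (\<Sum>i<u. A' (b * S + i)))" ..
  from choice[OF this] obtain Mb where "\<forall>b. \<rho> b < Rn \<and> (\<forall>i. Mb b i < 2 ^ g) \<and>
        (\<forall>u<S. out (rn adr nxt (Mb b) T (ini (\<rho> b) u)) = (\<Sum>i<u. A' (b * S + i)))" ..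
  hence rho: "\<And>b. \<rho> b < Rn" and Mb: "\<And>b i. Mb b i < 2 ^ g"
    and corr: "\<And>b u. u < S \<Longrightarrow> out (rn adr nxt (Mb b) T (ini (\<rho> b) u)) = (\<Sum>i<u. A' (b * S + i))"
    by simp_all
  obtain X where X: "\<And>j. j < Nb * m \<Longrightarrow> X div 2 ^ (g * j) mod 2 ^ g = Mb (j div m) (j mod m)"
    using pack_digits[of "\<lambda>j. Mb (j div m) (j mod m)" g "Nb * m"] Mb by blast
  define pf where "pf b = (\<Sum>i<b * S. A' i)" for b
  define iB aB nB oB rB dB where "iB = (11::nat)" and "aB = iB + Rn * S" and "nB = aB + Qn" and "oB = nB + Qn * 2 ^ g"
    and "rB = oB + Qn" and "dB = rB + 2 * Nb"
  \<comment> \<open>The second extra word lets the unpacking read one word beyond the last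
    cell.\<close>
  define D where "D = Nb * (m * g) div w + 2"
  have Len: "Len = dB + D" by (simp add: Len_def dB_def rB_def oB_def nB_def aB_def iB_def D_def)
  define ps where "ps i = [S, T, w, 2 ^ g, iB, aB, nB, oB, rB, dB, m * g] ! i" for i
  have ps: "ps 0 = S" "ps 1 = T" "ps 2 = w" "ps 3 = 2 ^ g" "ps 4 = iB" "ps 5 = aB" "ps 6 = nB" "ps 7 = oB" "ps 8 = rB" "ps 9 = dB"
    "ps 10 = m * g" by (simp_all add: ps_def)
  \<comment> \<open>Probe addresses are stored as bit offsets, already multiplied by
    \<open>g\<close>.\<close>
  define f where "f i = (if i < iB then ps i
     else if i < aB then ini ((i - iB) div S) ((i - iB) mod S)
     else if i < nB then adr (i - aB) * g
     else if i < oB then nxt ((i - nB) div 2 ^ g) ((i - nB) mod 2 ^ g)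
     else if i < rB then out (i - oB)
     else if i < dB then (if even (i - rB) then \<rho> ((i - rB) div 2) else pf ((i - rB) div 2))
     else X div 2 ^ (w * (i - dB)) mod 2 ^ w)" for i
  define M where "M = map f [0..<Len]"
  have lM: "length M = Len" by (simp add: M_def)
  have Mf: "i < Len \<Longrightarrow> M ! i = f i" for i by (simp add: M_def)
  have order: "iB \<le> aB" "aB \<le> nB" "nB \<le> oB" "oB \<le> rB" "rB \<le> dB" "dB < Len"
    by (simp_all add: aB_def nB_def oB_def rB_def dB_def Len D_def)
  have f_ini: "f (r * S + x + iB) = ini r x \<and> r * S + x + iB < aB" if "r < Rn" "x < S" for r x
  proof -
    have "r * S + x < Suc r * S" using that by simp
    also have "\<dots> \<le> Rn * S" using that by (intro mult_le_mono1) simp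
    finally have l: "r * S + x + iB < aB" by (simp add: aB_def)
    have "(r * S + x) div S = r" "(r * S + x) mod S = x" using that by auto
    thus ?thesis using l by (simp add: f_def)
  qed
  have f_adr: "f (s + aB) = adr s * g \<and> s + aB < nB" if "s < Qn" for s
    using that order by (simp add: f_def nB_def)
  have f_nxt: "f (s * 2 ^ g + v + nB) = nxt s v \<and> s * 2 ^ g + v + nB < oB" if "s < Qn" "v < 2 ^ g" for s v
  proof -
    have "s * 2 ^ g + v < Suc s * 2 ^ g" using that by simp
    also have "\<dots> \<le> Qn * 2 ^ g" using that by (intro mult_le_mono1) simp
    finally have l: "s * 2 ^ g + v + nB < oB" by (simp add: oB_def)
    have "(s * 2 ^ g + v) div 2 ^ g = s" "(s * 2 ^ g + v) mod 2 ^ g = v" using that by auto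
    thus ?thesis using l order by (simp add: f_def)
  qed
  have f_out: "f (s + oB) = out s \<and> s + oB < rB" if "s < Qn" for s
    using that order by (simp add: f_def rB_def)
  have f_rt: "f (b + b + rB) = \<rho> b \<and> f (b + b + rB + 1) = pf b \<and> b + b + rB + 1 < dB" if "b < Nb" for b
  proof -
    have l: "b + b + rB + 1 < dB" using that by (simp add: dB_def)
    have e: "even (b + b)" "(b + b) div 2 = b" "odd (b + b + 1)" "(b + b + 1) div 2 = b" by auto
    have d: "b + b + rB - rB = b + b" "b + b + rB + 1 - rB = b + b + 1" by auto
    show ?thesis unfolding f_def d using l order e by simp
  qed
  have f_data: "f (j + dB) = X div 2 ^ (w * j) mod 2 ^ w" for j
    using order by (simp add: f_def)
  have Len2: "Len < 2 ^ w" using len n by linarith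
  have Qn: "Qn \<le> n" "Rn \<le> n"
  proof -
    have "Rn * 1 \<le> Rn * S" using S by (intro mult_le_mono2)
    thus "Rn \<le> n" "Qn \<le> n" using len unfolding Len_def by linarith+
  qed
  have Sn: "S \<le> n"
  proof -
    have "1 \<le> Rn" using rho[of 0] by linarith
    hence "1 * S \<le> Rn * S" by (rule mult_le_mono1)
    thus ?thesis using len unfolding Len_def by linarith
  qed
  have mgn: "m * g \<le> n"
  proof -
    have "1 * (m * g) \<le> Nb * (m * g)" by (intro mult_le_mono1) (simp add: Nb_def)
    thus ?thesis using bits by linarith
  qed
  have pfn: "pf b \<le> n" for b
  proof -
    have "pf b = (\<Sum>i\<in>{..<b * S} \<inter> {..<n}. A' i)" unfolding pf_def
      by (rule sum.mono_neutral_right) (auto simp: A'_def)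
    also have "\<dots> \<le> (\<Sum>i\<in>{..<b * S} \<inter> {..<n}. 1)" using A1 by (intro sum_mono) auto
    also have "\<dots> = card ({..<b * S} \<inter> {..<n})" by simp
    also have "\<dots> \<le> card {..<n}" by (intro card_mono) auto
    finally show ?thesis by simp
  qed
  have psl: "ps i < 2 ^ w" if "i < 11" for i
  proof -
    have "w < 2 ^ w" by (rule less_exp)
    moreover have "(2::nat) ^ g < 2 ^ w" using g by simp
    moreover have "iB < 2 ^ w" "aB < 2 ^ w" "nB < 2 ^ w" "oB < 2 ^ w" "rB < 2 ^ w" "dB < 2 ^ w" using order Len2 by linarith+
    moreover have "S < 2 ^ w" "T < 2 ^ w" "m * g < 2 ^ w" using Sn T mgn n by linarith+
    ultimately have "\<forall>x\<in>set [S, T, w, 2 ^ g, iB, aB, nB, oB, rB, dB, m * g]. x < 2 ^ w" by simp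
    moreover have "ps i \<in> set [S, T, w, 2 ^ g, iB, aB, nB, oB, rB, dB, m * g]" unfolding ps_def by (rule nth_mem) (use that in simp)
    ultimately show ?thesis by blast
  qed
  have fw: "f i < 2 ^ w" for i
  proof -
    have "adr s * g < 2 ^ w" for s
    proof -
      have "adr s * g \<le> m * g" using adr[of s] by (intro mult_le_mono1) simp
      thus ?thesis using mgn n by linarith
    qed
    moreover have "ini r x < 2 ^ w" for r x using ini[of r x] Qn n by linarith
    moreover have "nxt r x < 2 ^ w" for r x using nxt[of r x] Qn n by linarith
    moreover have "out r < 2 ^ w" for r using out[of r] Sn n by linarith
    moreover have "\<rho> r < 2 ^ w" for r using rho[of r] Qn n by linarith
    moreover have "pf r < 2 ^ w" for r using pfn[of r] n by linarith
    ultimately show ?thesis using psl[of i] unfolding f_def iB_def by simp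
  qed
  have "M \<in> memories w" using fw by (auto simp: memories_def M_def)
  moreover have "answers_within w prog M (21 * T + 41) u (rank A u)" if u: "u \<le> n" for u
  proof -
    define b x where "b = u div S" and "x = u mod S"
    have bN: "b < Nb" using div_le_mono[OF u, of S] by (simp add: b_def Nb_def)
    have xS: "x < S" using S by (simp add: x_def)
    define st where "st j = rn adr nxt (Mb b) j (ini (\<rho> b) x)" for j
    have stQ: "st j < Qn" for j by (cases j) (simp_all add: st_def ini nxt)
    have w11: "11 < (2::nat) ^ w" using len n unfolding Len_def by linarith
    have rt: "M ! (b + b + rB) = \<rho> b" "M ! (b + b + rB + 1) = pf b" "b + b + rB + 1 < Len"
      using f_rt[OF bN] order Mf by auto
    have it: "M ! (\<rho> b * S + x + iB) = st 0" "\<rho> b * S + x + iB < Len"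
      using f_ini[OF rho xS, of b] order Mf by (auto simp: st_def)
    have bmg: "b * (m * g) < 2 ^ w"
    proof -
      have "b * (m * g) \<le> Nb * (m * g)" using bN by (intro mult_le_mono1) simp
      thus ?thesis using bits n by linarith
    qed
    have par: "i < length M \<and> M ! i = ps i" if "i < 11" for i
      using that order Mf[of i] unfolding lM iB_def by (simp add: f_def iB_def)
    have "\<exists>R. run w prog ((21 * T + 5) + 36) \<lparr>pc = 0, regs = (\<lambda>_. 0)(0 := u), mem = M\<rparr> = run w prog (21 * T + 5) \<lparr>pc = 36, regs = R, mem = M\<rparr> \<and>
       (\<forall>i<11. R (Suc i) = ps i) \<and> R 16 = pf b \<and> R 18 = st 0 \<and> R 19 = u div ps 0 * ps 10 \<and> R 20 = 1 \<and> R 21 = 0"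
      by (rule exec_init[where \<rho> = "\<rho> b", OF par w11]) (use rt it bmg Len2 in \<open>simp_all add: ps lM flip: b_def x_def\<close>)
    moreover have "(21 * T + 5) + 36 = 21 * T + 41" by simp
    moreover have "u div ps 0 * ps 10 = b * (m * g)" by (simp only: ps b_def)
    ultimately obtain R0 where R0: "run w prog (21 * T + 41) \<lparr>pc = 0, regs = (\<lambda>_. 0)(0 := u), mem = M\<rparr> = run w prog (21 * T + 5) \<lparr>pc = 36, regs = R0, mem = M\<rparr>"
      "\<forall>i<11. R0 (Suc i) = ps i" "R0 16 = pf b" "R0 18 = st 0" "R0 19 = b * (m * g)" "R0 20 = 1" "R0 21 = 0"
      by (simp only:) blast
    have loop: "j \<le> T \<Longrightarrow> \<exists>R. run w prog (k + 21 * j) \<lparr>pc = 36, regs = R0, mem = M\<rparr> = run w prog k \<lparr>pc = 36, regs = R, mem = M\<rparr> \<and>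
       (\<forall>i<11. R (Suc i) = ps i) \<and> R 16 = pf b \<and> R 18 = st j \<and> R 19 = b * (m * g) \<and> R 20 = 1 \<and> R 21 = j" for j k
    proof (induction j arbitrary: k)
      case 0 thus ?case using R0 by auto
    next
      case (Suc j)
      have "j \<le> T" using Suc(2) by simp
      from Suc(1)[OF this, of "k + 21"] obtain R where
        R: "run w prog (k + 21 + 21 * j) \<lparr>pc = 36, regs = R0, mem = M\<rparr> = run w prog (k + 21) \<lparr>pc = 36, regs = R, mem = M\<rparr>"
        "\<forall>i<11. R (Suc i) = ps i" "R 16 = pf b" "R 18 = st j" "R 19 = b * (m * g)" "R 20 = 1" "R 21 = j" by blast
      define s where "s = st j"
      define pos where "pos = adr s * g + b * (m * g)"
      define j' where "j' = b * m + adr s"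
      have pj: "pos = g * j'" by (simp add: pos_def j'_def algebra_simps)
      have j': "j' < Nb * m"
      proof -
        have "j' < Suc b * m" using adr[of s] by (simp add: j'_def)
        also have "\<dots> \<le> Nb * m" using bN by (intro mult_le_mono1) simp
        finally show ?thesis .
      qed
      have posn: "pos \<le> Nb * (m * g)"
      proof -
        have "g * j' \<le> g * (Nb * m)" using j' by (intro mult_le_mono2) simp
        thus ?thesis unfolding pj by (simp add: ac_simps)
      qed
      hence pw: "pos < 2 ^ w" using bits n by linarith
      have pd: "pos div w + dB + 1 < Len" using div_le_mono[OF posn, of w] by (simp add: Len D_def)
      have j'd: "j' div m = b" "j' mod m = adr s" using adr[of s] by (auto simp: j'_def)
      let ?lo = "X div 2 ^ (w * (pos div w)) mod 2 ^ w" and ?hi = "X div 2 ^ (w * Suc (pos div w)) mod 2 ^ w"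
      have lo: "M ! (pos div w + dB) = ?lo" using pd Mf[of "pos div w + dB"] f_data by simp
      have hi: "M ! (pos div w + dB + 1) = ?hi" using pd Mf[of "pos div w + dB + 1"] f_data[of "Suc (pos div w)"] by simp
      define v where "v = Mb b (adr s)"
      have v2: "v < 2 ^ g" by (simp add: v_def Mb)
      have vX: "X div 2 ^ pos mod 2 ^ g = v" unfolding pj v_def using X[OF j'] j'd by simp
      have sQ: "s < Qn" by (simp add: s_def stQ)
      have ad: "M ! (s + aB) = adr s * g" "s + aB < Len" using f_adr[OF sQ] order Mf by auto
      have nx: "M ! (s * 2 ^ g + v + nB) = nxt s v" "s * 2 ^ g + v + nB < Len" using f_nxt[OF sQ v2] order Mf by auto
      have sS: "nxt s v = st (Suc j)" by (simp add: st_def s_def v_def)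
      have w0: "0 < w" using g by simp
      have "\<exists>R'. run w prog (k + 21) \<lparr>pc = 36, regs = R, mem = M\<rparr> = run w prog k \<lparr>pc = 36, regs = R', mem = M\<rparr> \<and>
        (\<forall>i<11. R' (Suc i) = ps i) \<and> R' 16 = R 16 \<and> R' 18 = st (Suc j) \<and> R' 19 = b * (m * g) \<and> R' 20 = 1 \<and> R' 21 = j + 1"
      proof (rule exec_body[where ps = ps and \<sigma> = s and pos = pos and off = "adr s * g" and lo = ?lo and hi = ?hi and v = v, OF R(2)])
        show "(drop_bit (pos mod w) ?lo OR (push_bit (w - pos mod w) ?hi mod 2 ^ w)) mod ps 3 = v"
          unfolding ps using unpack_bits[where w = w and g = g and X = X and pos = pos] w0 g vX by simp
        show "w < 2 ^ w" by (rule less_exp)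
        show "j \<noteq> ps 1" using Suc(2) by (simp only: ps)
        show "j + 1 < 2 ^ w" using Suc(2) T n by linarith
        show "R 18 = s" "R 19 = b * (m * g)" "R 20 = 1" "R 21 = j" using R by (simp_all only: s_def)
        show "s + ps 5 < 2 ^ w" "s + ps 5 < length M" "M ! (s + ps 5) = adr s * g" unfolding ps lM using ad Len2 by linarith+
        show "adr s * g + b * (m * g) = pos" by (simp only: pos_def)
        show "pos < 2 ^ w" by (rule pw)
        show "pos div ps 2 + ps 9 + 1 < 2 ^ w" "pos div ps 2 + ps 9 + 1 < length M" unfolding ps lM using pd Len2 by linarith+
        show "M ! (pos div ps 2 + ps 9) = ?lo" unfolding ps by (rule lo)
        show "M ! (pos div ps 2 + ps 9 + 1) = ?hi" unfolding ps by (rule hi)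
        show "ps 2 = w" by (rule ps)
        show "0 < w" by (rule w0)
        show "s * ps 3 + v + ps 6 < 2 ^ w" "s * ps 3 + v + ps 6 < length M" unfolding ps lM using nx Len2 by linarith+
        show "M ! (s * ps 3 + v + ps 6) = st (Suc j)" unfolding ps nx(1) by (rule sS)
      qed
      then obtain R' where "run w prog (k + 21) \<lparr>pc = 36, regs = R, mem = M\<rparr> = run w prog k \<lparr>pc = 36, regs = R', mem = M\<rparr>"
        "\<forall>i<11. R' (Suc i) = ps i" "R' 16 = R 16" "R' 18 = st (Suc j)" "R' 19 = b * (m * g)" "R' 20 = 1" "R' 21 = j + 1" by blast
      moreover have "k + 21 * Suc j = k + 21 + 21 * j" "j + 1 = Suc j" by simp_all
      ultimately show ?case using R(1,3) by (simp only:) blast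
    qed
    from loop[of T 5] obtain R where R: "run w prog (5 + 21 * T) \<lparr>pc = 36, regs = R0, mem = M\<rparr> = run w prog 5 \<lparr>pc = 36, regs = R, mem = M\<rparr>"
       "\<forall>i<11. R (Suc i) = ps i" "R 16 = pf b" "R 18 = st T" "R 21 = T" by auto
    have ou: "M ! (st T + oB) = out (st T)" "st T + oB < Len" using f_out[OF stQ[of T]] order Mf by auto
    have tot: "pf b + out (st T) = rank A u"
    proof -
      have "pf b + out (st T) = (\<Sum>i<b * S. A' i) + (\<Sum>i<x. A' (b * S + i))" using corr[OF xS, of b] by (simp add: pf_def st_def)
      also have "\<dots> = (\<Sum>i<b * S + x. A' i)" by (rule sum_lessThan_add[symmetric])
      also have "b * S + x = u" by (simp add: b_def x_def)
      also have "(\<Sum>i<u. A' i) = rank A u" unfolding rank_def using u by (intro sum.cong) (auto simp: A'_def)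
      finally show ?thesis .
    qed
    have "rank A u \<le> n"
    proof -
      have "rank A u = (\<Sum>i<u. A' i)" unfolding rank_def using u by (intro sum.cong) (auto simp: A'_def)
      also have "\<dots> \<le> (\<Sum>i<u. 1)" using A1 by (intro sum_mono) auto
      finally show ?thesis using u by simp
    qed
    hence "pf b + out (st T) < 2 ^ w" using tot n by linarith
    hence "\<exists>s. run w prog (0 + 5) \<lparr>pc = 36, regs = R, mem = M\<rparr> = Some s \<and> regs s 0 = pf b + out (st T) \<and> mem s = M"
    proof (intro exec_end[where ps = ps and \<sigma> = "st T"])
      show "st T + ps 7 < 2 ^ w" "st T + ps 7 < length M" "M ! (st T + ps 7) = out (st T)" unfolding ps lM using ou Len2 by linarith+
    qed (use R in \<open>simp_all only: ps\<close>)
    then obtain s where s: "run w prog 5 \<lparr>pc = 36, regs = R, mem = M\<rparr> = Some s" "regs s 0 = rank A u" "mem s = M" by (auto simp: tot)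
    have "run w prog (21 * T + 41) \<lparr>pc = 0, regs = (\<lambda>_. 0)(0 := u), mem = M\<rparr> = Some s"
      using R0(1) R(1) s(1) by (simp add: add.commute)
    thus ?thesis unfolding answers_within_def using s by blast
  qed
  ultimately show ?thesis using lM by blast
qed

end

section \<open>Choice of the parameters\<close>

lemma two_power_le_powr:
  assumes n: "1 \<le> n" and k: "real k \<le> a * log 2 (real n)"
  shows "2 ^ k \<le> real n powr a"
proof -
  have "(2::real) ^ k = 2 powr real k" by (simp add: powr_realpow)
  also have "\<dots> \<le> 2 powr (a * log 2 (real n))" using k by (intro powr_mono) auto
  also have "\<dots> = (2 powr log 2 (real n)) powr a" by (simp add: powr_powr mult.commute)
  also have "\<dots> = real n powr a" using n by simp
  finally show ?thesis .
qed

text \<open>The number 400 makes the tables sublinear: \<open>328 / 400 = 82 / 100\<close>.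
  Redundancy then comes from the two words per block, about \<open>2 * w * n / S\<close>
  bits.\<close>

lemma rank_structure_at:
  fixes n q B w :: nat and W t :: real
  defines "lg \<equiv> log 2 (real n)"
  assumes q: "q = nat \<lfloor>lg / 400\<rfloor>" "16 \<le> q"
    and B: "3 \<le> B" "B \<le> q" "32 ^ B \<le> (2::nat) ^ q" "(2 ^ 26 * q ^ 4) ^ B \<le> (2::nat) ^ q" "lg \<le> real B ^ 3" "100 * q * (32 * q * B) \<le> 2 ^ q"
    and w: "n < 2 ^ w" "real w \<le> W * lg" "2 * W \<le> lg"
    and a: "W * lg * (real n powr (82 / 100) + 2) \<le> real n powr (1 - 1 / 1000) / 2"
    and b: "400 * W * lg ^ 3 * real n powr (1 - 1 / 400) \<le> real n powr (1 - 1 / 1000) / 2"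
    and t: "1 \<le> t" and A: "A \<in> bit_arrays n"
  shows "\<exists>M\<in>memories w. real (space_bits w M) \<le> real n + real n / lg powr t + real n powr (1 - 1 / 1000) \<and>
     (\<forall>u\<le>n. \<exists>k. real k \<le> 1721 * t \<and> answers_within w prog M k u (rank A u))"
proof -
  have q16: "real q \<ge> 16" using q(2) by simp
  have lq: "real q \<le> lg / 400" "lg / 400 < real q + 1" using q by linarith+
  have lg1: "1 \<le> lg" "0 < lg" using lq q16 by linarith+
  have n1: "1 \<le> n"
  proof (rule ccontr)
    assume "\<not> 1 \<le> n" hence "n = 0" by simp
    thus False using lg1 by (simp add: lg_def log_def)
  qed
  have rn: "1 \<le> real n" using n1 by simp
  have lgw: "lg < real w"
  proof -
    have "real n < real (2 ^ w)" using w(1) of_nat_less_iff by blast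
    hence "real n < 2 powr real w" by (simp add: powr_realpow)
    thus ?thesis using n1 by (simp add: lg_def log_less_iff)
  qed
  have "0 < W * lg" using lgw w(2) lg1 by linarith
  hence W0: "0 < W" using lg1 by (simp add: zero_less_mult_iff)
  \<comment> \<open>The greatest admissible height; \<open>Hm2\<close> will show that blocks of this
    height are already polynomially large.\<close>
  define Hm where "Hm = Max {H. 100 * q * (32 * q * B ^ H) \<le> 2 ^ q}"
  have fin: "finite {H. 100 * q * (32 * q * B ^ H) \<le> 2 ^ q}"
  proof (rule finite_subset)
    show "{H. 100 * q * (32 * q * B ^ H) \<le> 2 ^ q} \<subseteq> {..2 ^ q}"
    proof
      fix H assume "H \<in> {H. 100 * q * (32 * q * B ^ H) \<le> 2 ^ q}"
      hence H: "100 * q * (32 * q * B ^ H) \<le> 2 ^ q" by simp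
      have "H < 2 ^ H" by (rule less_exp)
      also have "\<dots> \<le> B ^ H" using B by (intro power_mono) auto
      also have "\<dots> = 1 * (1 * B ^ H)" by simp
      also have "\<dots> \<le> 100 * q * (32 * q * B ^ H)" using q(2) by (intro mult_le_mono) auto
      finally show "H \<in> {..2 ^ q}" using H by simp
    qed
  qed simp
  have one: "1 \<in> {H. 100 * q * (32 * q * B ^ H) \<le> 2 ^ q}" using B(6) by simp
  have Hm1: "1 \<le> Hm" unfolding Hm_def using Max_ge[OF fin one] by simp
  have Hm: "100 * q * (32 * q * B ^ Hm) \<le> 2 ^ q" using Max_in[OF fin] one unfolding Hm_def by blast
  have Hm2: "2 ^ q < 100 * q * (32 * q * B ^ Suc Hm)"
  proof (rule ccontr)
    assume "\<not> ?thesis"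
    hence "Suc Hm \<le> Hm" using Max_ge[OF fin, of "Suc Hm"] unfolding Hm_def by simp
    thus False by simp
  qed
  \<comment> \<open>As \<open>lg \<le> B ^ 3\<close>, this height yields
    \<open>B ^ Ht \<ge> lg powr (t + 2)\<close>; the two spare factors cover \<open>2 * w\<close>,
    which is at most \<open>lg * lg\<close>.\<close>
  define Ht where "Ht = nat \<lceil>3 * (t + 2)\<rceil>"
  have "0 \<le> \<lceil>3 * (t + 2)\<rceil>" using t by simp
  hence "real Ht = real_of_int \<lceil>3 * (t + 2)\<rceil>" by (simp add: Ht_def)
  hence "real Ht - 1 < 3 * (t + 2)" and Ht1: "3 * (t + 2) \<le> real Ht" using ceiling_correct[of "3 * (t + 2)"] by simp_all
  hence "real Ht < 3 * t + 7" by (simp add: distrib_left)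
  hence Ht: "3 * (t + 2) \<le> real Ht" "real Ht \<le> 10 * t" using t Ht1 by linarith+
  define H where "H = min Ht Hm"
  have H1: "1 \<le> H" using Ht t Hm1 unfolding H_def by simp
  define S where "S = 32 * q * B ^ H"
  have Bp: "0 < B" using B by simp
  have "B ^ H \<le> B ^ Hm" using Bp by (intro power_increasing) (auto simp: H_def)
  hence "100 * q * S \<le> 100 * q * (32 * q * B ^ Hm)" unfolding S_def by (intro mult_le_mono2)
  hence SH2: "100 * q * S \<le> 2 ^ q" using Hm by linarith
  have "8 * B * S \<le> 100 * q * S" using B(2) by (intro mult_le_mono1) linarith
  hence SH1: "8 * B * S \<le> 2 ^ q" using SH2 by linarith
  have ds: "block_ds (32 * q) S (8 * H) (B ^ H - 1) (2 ^ (294 * q)) (2 ^ (34 * q))"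
    unfolding S_def by (rule block_ds_exists) (use q B H1 SH1 SH2 in \<open>auto simp: S_def\<close>)
  have BH1: "1 \<le> B ^ H" using Bp by simp
  have S1: "1 \<le> S" using q(2) BH1 by (simp add: S_def Suc_le_eq)
  have Sq: "S \<le> 2 ^ q"
  proof -
    have "1 * S \<le> 100 * q * S" using q(2) by (intro mult_le_mono1) simp
    thus ?thesis using SH2 by linarith
  qed
  have HS: "H < S"
  proof -
    have "H < 2 ^ H" by (rule less_exp)
    also have "\<dots> \<le> B ^ H" using B by (intro power_mono) auto
    also have "\<dots> \<le> S" using q(2) by (simp add: S_def)
    finally show ?thesis .
  qed
  have q400: "2 ^ (400 * q) \<le> n"
  proof -
    have "real (400 * q) \<le> 1 * log 2 (real n)" using lq unfolding lg_def by simp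
    hence "2 ^ (400 * q) \<le> real n powr 1" using two_power_le_powr[OF n1] by blast
    hence "real (2 ^ (400 * q)) \<le> real n" using n1 by simp
    thus ?thesis using of_nat_le_iff by blast
  qed
  have S3: "8 * (S * S) \<le> n"
  proof -
    have "8 * (S * S) \<le> 2 ^ 3 * (2 ^ q * 2 ^ q)" using Sq by (intro mult_le_mono) auto
    also have "\<dots> = 2 ^ (3 + (q + q))" by (simp only: power_add)
    also have "\<dots> \<le> 2 ^ (400 * q)" using q(2) by (intro power_increasing) auto
    finally show ?thesis using q400 by linarith
  qed
  have SS: "S * 1 \<le> S * S" using S1 by (intro mult_le_mono2)
  have T: "8 * H \<le> n" using HS S3 SS by linarith
  have gw: "32 * q < w"
  proof -
    have "real (32 * q) < real w" using lq lgw lg1 q16 by simp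
    thus ?thesis using of_nat_less_iff by blast
  qed
  define Nb where "Nb = n div S + 1"
  have mg: "(B ^ H - 1) * (32 * q) = S - 32 * q" by (simp add: S_def diff_mult_distrib mult.commute)
  \<comment> \<open>The cells of a block miss \<open>32 * q\<close> of its \<open>S\<close> bits.
    Saving one bit per block already makes room for the extra block, as \<open>n div S\<close> is at
    least \<open>S\<close>.\<close>
  have bits: "Nb * ((B ^ H - 1) * (32 * q)) \<le> n"
  proof -
    have "S * S \<le> n" using S3 by linarith
    hence "S * S div S \<le> n div S" by (rule div_le_mono)
    hence Sd: "S \<le> n div S" using S1 by simp
    have "S - 32 * q \<le> S - 1" using q(2) by linarith
    hence "Nb * (S - 32 * q) \<le> Nb * (S - 1)" by (rule mult_le_mono2)
    also have "\<dots> = (n div S) * (S - 1) + (S - 1)" by (simp add: Nb_def)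
    also have "(n div S) * (S - 1) + n div S = n div S * S" using S1 by (cases S) auto
    hence "(n div S) * (S - 1) + (S - 1) \<le> n div S * S" using Sd by linarith
    also have "\<dots> \<le> n" by simp
    finally show ?thesis unfolding mg .
  qed
  define Len where "Len = 11 + 2 ^ (34 * q) * S + 2 ^ (294 * q) + 2 ^ (294 * q) * 2 ^ (32 * q) + 2 ^ (294 * q) + 2 * Nb
     + (Nb * ((B ^ H - 1) * (32 * q)) div w + 2)"
  have w3: "3 < w" using gw q(2) by linarith
  have space: "real (w * Len) \<le> real n + real n / lg powr t + real n powr (1 - 1 / 1000)"
  proof -
    \<comment> \<open>The transition table dominates, with an entry for every state and every cell
      value.\<close>
    have tab: "13 + 2 ^ (34 * q) * S + 2 ^ (294 * q) + 2 ^ (294 * q) * 2 ^ (32 * q) + 2 ^ (294 * q) \<le> (2::nat) ^ (328 * q)"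
    proof -
      have x13: "13 \<le> (2::nat) ^ (326 * q)"
      proof -
        have "(2::nat) ^ 4 \<le> 2 ^ (326 * q)" using q(2) by (intro power_increasing) auto
        thus ?thesis by simp
      qed
      have "2 ^ (34 * q) * S \<le> 2 ^ (34 * q) * 2 ^ q" using Sq by (rule mult_le_mono2)
      also have "\<dots> = 2 ^ (35 * q)" by (simp flip: power_add)
      also have "\<dots> \<le> (2::nat) ^ (326 * q)" by (intro power_increasing) auto
      finally have x2: "2 ^ (34 * q) * S \<le> 2 ^ (326 * q)" .
      have x3: "(2::nat) ^ (294 * q) \<le> 2 ^ (326 * q)" by (intro power_increasing) auto
      have x4: "(2::nat) ^ (294 * q) * 2 ^ (32 * q) = 2 ^ (326 * q)" by (simp flip: power_add)
      have "(8::nat) * 2 ^ (326 * q) = 2 ^ (3 + 326 * q)" by (simp only: power_add) simp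
      also have "\<dots> \<le> (2::nat) ^ (328 * q)" using q(2) by (intro power_increasing) auto
      finally show ?thesis using x13 x2 x3 x4 by linarith
    qed
    have "w * Len \<le> w * (2 ^ (328 * q) + 2 * Nb + Nb * ((B ^ H - 1) * (32 * q)) div w)"
      using tab unfolding Len_def by (intro mult_le_mono2) linarith
    also have "\<dots> = w * 2 ^ (328 * q) + 2 * w * Nb + w * (Nb * ((B ^ H - 1) * (32 * q)) div w)"
      by (simp add: distrib_left)
    also have "w * (Nb * ((B ^ H - 1) * (32 * q)) div w) \<le> Nb * ((B ^ H - 1) * (32 * q))" by simp
    also note bits
    finally have "w * Len \<le> w * 2 ^ (328 * q) + 2 * w * Nb + n" by simp
    hence "real (w * Len) \<le> real (w * 2 ^ (328 * q) + 2 * w * Nb + n)" using of_nat_le_iff by blast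
    hence 1: "real (w * Len) \<le> real w * 2 ^ (328 * q) + 2 * real w * real Nb + real n" by simp
    have NbS: "real Nb \<le> real n / real S + 1" unfolding Nb_def using of_nat_div_le_of_nat[of n S, where 'a = real] by simp
    have "2 * real w * real Nb \<le> 2 * real w * (real n / real S + 1)" using NbS by (intro mult_left_mono) auto
    hence 2: "2 * real w * real Nb \<le> 2 * real w * real n / real S + 2 * real w" by (simp add: distrib_left)
    have p328: "2 ^ (328 * q) \<le> real n powr (82 / 100)"
      by (rule two_power_le_powr[OF n1]) (use lq in \<open>simp add: lg_def\<close>)
    have "real w * 2 ^ (328 * q) + 2 * real w = real w * (2 ^ (328 * q) + 2)" by (simp add: distrib_left)
    also have "\<dots> \<le> W * lg * (real n powr (82 / 100) + 2)"
      using w(2) p328 W0 lg1 by (intro mult_mono) auto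
    finally have 3: "real w * 2 ^ (328 * q) + 2 * real w \<le> real n powr (1 - 1 / 1000) / 2" using a by linarith
    have Sr: "0 < real S" using S1 by simp
    have 4: "2 * real w * real n / real S \<le> real n / lg powr t + real n powr (1 - 1 / 1000) / 2"
    proof (cases "Ht \<le> Hm")
      case True
      hence HH: "H = Ht" by (simp add: H_def)
      have "lg powr (t + 2) \<le> (real B ^ 3) powr (t + 2)" using B(5) lg1 t by (intro powr_mono2) auto
      also have "\<dots> = real B powr (3 * (t + 2))" using Bp by (simp add: powr_powr flip: powr_numeral)
      also have "\<dots> \<le> real B powr real H" using Ht Bp unfolding HH by (intro powr_mono) auto
      also have "\<dots> = real B ^ H" using Bp by (simp add: powr_realpow)
      also have "\<dots> \<le> real S"
      proof -
        have "B ^ H \<le> S" using q(2) by (simp add: S_def)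
        hence "real (B ^ H) \<le> real S" by (rule of_nat_mono)
        thus ?thesis by simp
      qed
      finally have S_ge: "lg powr (t + 2) \<le> real S" .
      have "2 * real w \<le> 2 * (W * lg)" using w(2) by simp
      also have "\<dots> \<le> lg * lg" using w(3) lg1 by (metis mult.assoc mult_right_mono less_imp_le)
      finally have "2 * real w * real n / real S \<le> lg * lg * real n / lg powr (t + 2)"
        using S_ge lg1 by (intro frac_le mult_right_mono) auto
      also have "\<dots> = real n / lg powr t" using lg1 by (simp add: powr_add power2_eq_square)
      finally show ?thesis by (simp add: add_increasing2)
    next
      case False
      hence HH: "H = Hm" by (simp add: H_def)
      have "real (2 ^ q) \<le> real (100 * q * (32 * q * B ^ Suc Hm))" using Hm2 by (intro of_nat_mono) simp
      also have "\<dots> = 100 * real q * real B * real S" by (simp add: S_def HH)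
      also have "\<dots> \<le> 100 * real q * real q * real S" using B(2) by (intro mult_right_mono mult_left_mono) auto
      also have "\<dots> \<le> 100 * lg * lg * real S"
        using lq lg1 by (intro mult_right_mono mult_mono) auto
      finally have s1: "2 ^ q \<le> 100 * lg * lg * real S" by simp
      have "real n powr (1 / 400) = 2 powr (lg / 400)" using n1 by (simp add: lg_def powr_def log_def)
      also have "\<dots> \<le> 2 powr (real q + 1)" using lq by (intro powr_mono) auto
      also have "\<dots> = 2 * 2 ^ q" by (simp add: powr_add powr_realpow)
      finally have "real n powr (1 / 400) \<le> 200 * lg * lg * real S" using s1 by linarith
      hence s2: "1 / real S \<le> 200 * lg * lg / real n powr (1 / 400)" using Sr n1 by (simp add: field_simps)
      have "2 * real w * real n / real S = 2 * real w * real n * (1 / real S)" by simp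
      also have "\<dots> \<le> 2 * (W * lg) * real n * (200 * lg * lg / real n powr (1 / 400))"
        using w(2) s2 W0 lg1 by (intro mult_mono) auto
      also have "\<dots> = 400 * W * lg ^ 3 * (real n / real n powr (1 / 400))" by (simp add: power3_eq_cube)
      also have "real n / real n powr (1 / 400) = real n powr (1 - 1 / 400)"
        unfolding powr_diff using n1 by simp
      also note b
      finally show ?thesis by (simp add: add_increasing)
    qed
    show ?thesis using 1 2 3 4 by linarith
  qed
  have lgt: "1 \<le> lg powr t" using lg1 t by (simp add: ge_one_powr_ge_zero)
  have "Len \<le> n"
  proof -
    have "real n / lg powr t \<le> real n"
      using mult_left_mono[OF lgt, of "real n"] lg1 by (simp add: pos_divide_le_eq)
    moreover have "real n powr (1 - 1 / 1000) \<le> real n powr 1" using rn by (intro powr_mono) auto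
    ultimately have "real (w * Len) \<le> 3 * real n" using space rn by simp
    hence "w * Len \<le> 3 * n" by linarith
    moreover have "3 * Len \<le> w * Len" using w3 by (intro mult_le_mono1) simp
    ultimately show ?thesis by linarith
  qed
  then obtain M where M: "M \<in> memories w" "length M = Len"
    "\<forall>u\<le>n. answers_within w prog M (21 * (8 * H) + 41) u (rank A u)"
    using ram_block[OF ds S1 T _ gw w(1) _ _ A] bits q(2) unfolding Nb_def Len_def by auto
  \<comment> \<open>\<open>1721 = 21 * 8 * 10 + 41\<close>, with height at most
    \<open>10 * t\<close>.\<close>
  have time: "real (21 * (8 * H) + 41) \<le> 1721 * t"
  proof -
    have "H \<le> Ht" by (simp add: H_def)
    hence "real H \<le> 10 * t" using Ht(2) by linarith
    thus ?thesis using t by simp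
  qed
  show ?thesis
  proof (intro bexI[OF _ M(1)] conjI allI impI)
    show "real (space_bits w M) \<le> real n + real n / lg powr t + real n powr (1 - 1 / 1000)"
      unfolding space_bits_def M(2) by (rule space)
    show "\<exists>k. real k \<le> 1721 * t \<and> answers_within w prog M k u (rank A u)" if "u \<le> n" for u
      using time M(3) that by blast
  qed
qed

text \<open>\<open>B\<close> is about \<open>sqrt q\<close>. Any power of \<open>q\<close> with
  exponent strictly between \<open>1 / 3\<close> and 1 would do: below \<open>q / log q\<close> for
  the list of types, above the cube root of \<open>400 * (q + 1)\<close> for
  \<open>B ^ 3 \<ge> lg\<close>.\<close>

lemma eventually_parameters:
  "\<forall>\<^sub>F q :: nat in sequentially. 16 \<le> q \<and> (\<exists>B. 3 \<le> B \<and> B \<le> q \<and> 32 ^ B \<le> (2::nat) ^ q \<and> (2 ^ 26 * q ^ 4) ^ B \<le> (2::nat) ^ q \<and>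
     400 * (real q + 1) \<le> real B ^ 3 \<and> 100 * q * (32 * q * B) \<le> 2 ^ q)"
proof -
  have ev: "\<forall>\<^sub>F x :: real in at_top. 16 \<le> x \<and> 4 \<le> sqrt x \<and> sqrt x * (26 + 4 * log 2 x) \<le> x \<and> 400 * (x + 1) \<le> (sqrt x - 1) ^ 3 \<and>
      3200 * x ^ 3 \<le> 2 powr x"
    by (intro eventually_conj; real_asymp)
  have "\<forall>\<^sub>F q :: nat in sequentially. 16 \<le> real q \<and> 4 \<le> sqrt (real q) \<and> sqrt (real q) * (26 + 4 * log 2 (real q)) \<le> real q \<and>
     400 * (real q + 1) \<le> (sqrt (real q) - 1) ^ 3 \<and> 3200 * real q ^ 3 \<le> 2 powr real q"
    using filterlim_real_sequentially ev unfolding filterlim_iff by blast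
  thus ?thesis
  proof eventually_elim
    case (elim q)
    define B where "B = nat \<lfloor>sqrt (real q)\<rfloor>"
    have B: "real B \<le> sqrt (real q)" "sqrt (real q) - 1 \<le> real B" unfolding B_def using elim by linarith+
    have B3: "3 \<le> B" using B elim by linarith
    have q16: "16 \<le> q" using elim by simp
    have sq: "sqrt (real q) \<le> real q"
    proof -
      have "sqrt (real q) * 1 \<le> sqrt (real q) * sqrt (real q)" using elim by (intro mult_left_mono) auto
      thus ?thesis by simp
    qed
    have Bq: "B \<le> q" using B sq by linarith
    have lgq: "4 \<le> log 2 (real q)"
    proof -
      have "log 2 16 \<le> log 2 (real q)" using elim by (subst log_le_cancel_iff) auto
      moreover have "log 2 16 = (4::real)" using log_pow_cancel[of 2 4] by simp
      ultimately show ?thesis by simp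
    qed
    have key: "real B * (26 + 4 * log 2 (real q)) \<le> real q"
    proof -
      have "real B * (26 + 4 * log 2 (real q)) \<le> sqrt (real q) * (26 + 4 * log 2 (real q))"
        using B lgq by (intro mult_right_mono) auto
      thus ?thesis using elim by linarith
    qed
    have "real ((2 ^ 26 * q ^ 4) ^ B) = (2 powr (26 + 4 * log 2 (real q))) powr real B"
    proof -
      have "2 powr (26 + 4 * log 2 (real q)) = 2 powr 26 * (2 powr log 2 (real q)) powr 4"
        by (simp add: powr_add powr_powr mult.commute)
      also have "\<dots> = 2 ^ 26 * real q ^ 4" using q16 by (simp add: powr_numeral)
      finally have "2 powr (26 + 4 * log 2 (real q)) = real (2 ^ 26 * q ^ 4)" by simp
      thus ?thesis using q16 by (simp add: powr_realpow)
    qed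
    also have "\<dots> = 2 powr (real B * (26 + 4 * log 2 (real q)))" by (simp add: powr_powr mult.commute)
    also have "\<dots> \<le> 2 powr real q" using key by (intro powr_mono) auto
    also have "\<dots> = real (2 ^ q)" by (simp add: powr_realpow)
    finally have c1: "(2 ^ 26 * q ^ 4) ^ B \<le> (2::nat) ^ q" using of_nat_le_iff by blast
    have "(32::nat) ^ B \<le> (2 ^ 26 * q ^ 4) ^ B"
    proof (rule power_mono)
      have "(32::nat) \<le> 2 ^ 26 * 1" by simp
      also have "\<dots> \<le> 2 ^ 26 * q ^ 4" using q16 by (intro mult_le_mono2) (simp add: Suc_le_eq)
      finally show "(32::nat) \<le> 2 ^ 26 * q ^ 4" .
    qed simp
    hence c2: "32 ^ B \<le> (2::nat) ^ q" using c1 by linarith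
    have "(sqrt (real q) - 1) ^ 3 \<le> real B ^ 3" using B elim by (intro power_mono) auto
    hence c3: "400 * (real q + 1) \<le> real B ^ 3" using elim by linarith
    have "100 * q * (32 * q * B) \<le> 100 * q * (32 * q * q)" using Bq by (intro mult_le_mono2)
    also have "\<dots> = 3200 * q ^ 3" by (simp add: power3_eq_cube)
    finally have "real (100 * q * (32 * q * B)) \<le> real (3200 * q ^ 3)" using of_nat_le_iff by blast
    also have "\<dots> \<le> 2 powr real q" using elim by simp
    also have "\<dots> = real (2 ^ q)" by (simp add: powr_realpow)
    finally have c4: "100 * q * (32 * q * B) \<le> 2 ^ q" using of_nat_le_iff by blast
    show ?case using q16 B3 Bq c1 c2 c3 c4 by blast
  qed
qed

theorem theorem2:
  "\<exists>c c' :: real. c > 0 \<and> c' > 0 \<and>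
     (\<forall>w. log_word_size w \<longrightarrow>
       (\<exists>(P :: instr list) (C :: real). \<forall>\<^sub>F n in sequentially. \<forall>t :: real. t \<ge> 1 \<longrightarrow>
         (\<forall>A \<in> bit_arrays n. \<exists>M \<in> memories (w n).
            real (space_bits (w n) M)
              \<le> real n + real n / (log 2 (real n)) powr (c' * t) + real n powr (1 - c) \<and>
            (\<forall>u \<le> n. \<exists>k :: nat. real k \<le> C * t \<and>
               answers_within (w n) P M k u (rank A u)))))"
proof (rule exI[of _ "1 / 1000"], rule exI[of _ 1], intro conjI allI impI)
  fix w assume lw: "log_word_size w"
  have "(\<lambda>n. real (w n)) \<in> O(\<lambda>n. log 2 (real n))" using lw unfolding log_word_size_def by (auto dest: bigthetaD1)
  then obtain W where W: "0 < W" "\<forall>\<^sub>F n in sequentially. norm (real (w n)) \<le> W * norm (log 2 (real n))"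
    by (rule landau_o.bigE)
  have w2: "\<forall>\<^sub>F n in sequentially. n < 2 ^ w n" using lw unfolding log_word_size_def by simp
  have ev: "\<forall>\<^sub>F x :: real in at_top. 1 \<le> x \<and> 1 \<le> log 2 x \<and> 2 * W \<le> log 2 x \<and>
      W * log 2 x * (x powr (82 / 100) + 2) \<le> x powr (1 - 1 / 1000) / 2 \<and>
      400 * W * log 2 x ^ 3 * x powr (1 - 1 / 400) \<le> x powr (1 - 1 / 1000) / 2"
    using W(1) by (intro eventually_conj; real_asymp)
  have evn: "\<forall>\<^sub>F n :: nat in sequentially. 1 \<le> real n \<and> 1 \<le> log 2 (real n) \<and> 2 * W \<le> log 2 (real n) \<and>
      W * log 2 (real n) * (real n powr (82 / 100) + 2) \<le> real n powr (1 - 1 / 1000) / 2 \<and>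
      400 * W * log 2 (real n) ^ 3 * real n powr (1 - 1 / 400) \<le> real n powr (1 - 1 / 1000) / 2"
    using filterlim_real_sequentially ev unfolding filterlim_iff by blast
  have "filterlim (\<lambda>n. nat \<lfloor>log 2 (real n) / 400\<rfloor>) sequentially sequentially"
  proof -
    have "filterlim (\<lambda>n :: nat. log 2 (real n) / 400) at_top sequentially" by real_asymp
    thus ?thesis by (intro filterlim_compose[OF filterlim_nat_sequentially] filterlim_compose[OF filterlim_floor_sequentially])
  qed
  hence evq: "\<forall>\<^sub>F n in sequentially. let q = nat \<lfloor>log 2 (real n) / 400\<rfloor> in
     16 \<le> q \<and> (\<exists>B. 3 \<le> B \<and> B \<le> q \<and> 32 ^ B \<le> (2::nat) ^ q \<and> (2 ^ 26 * q ^ 4) ^ B \<le> (2::nat) ^ q \<and>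
     400 * (real q + 1) \<le> real B ^ 3 \<and> 100 * q * (32 * q * B) \<le> 2 ^ q)"
    using eventually_parameters unfolding filterlim_iff Let_def by blast
  show "\<exists>(P :: instr list) (C :: real). \<forall>\<^sub>F n in sequentially. \<forall>t :: real. t \<ge> 1 \<longrightarrow>
         (\<forall>A \<in> bit_arrays n. \<exists>M \<in> memories (w n).
            real (space_bits (w n) M)
              \<le> real n + real n / (log 2 (real n)) powr (1 * t) + real n powr (1 - 1 / 1000) \<and>
            (\<forall>u \<le> n. \<exists>k :: nat. real k \<le> C * t \<and>
               answers_within (w n) P M k u (rank A u)))"
  \<comment> \<open>One program serves all \<open>n\<close>: it reads the word size and every other
    parameter from memory.\<close>
  proof (rule exI[of _ prog], rule exI[of _ 1721])
    show "\<forall>\<^sub>F n in sequentially. \<forall>t :: real. t \<ge> 1 \<longrightarrow>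
         (\<forall>A \<in> bit_arrays n. \<exists>M \<in> memories (w n).
            real (space_bits (w n) M)
              \<le> real n + real n / (log 2 (real n)) powr (1 * t) + real n powr (1 - 1 / 1000) \<and>
            (\<forall>u \<le> n. \<exists>k :: nat. real k \<le> 1721 * t \<and>
               answers_within (w n) prog M k u (rank A u)))"
      using W(2) w2 evn evq
    proof eventually_elim
      case (elim n)
      define q where "q = nat \<lfloor>log 2 (real n) / 400\<rfloor>"
      obtain B where B: "16 \<le> q" "3 \<le> B" "B \<le> q" "32 ^ B \<le> (2::nat) ^ q" "(2 ^ 26 * q ^ 4) ^ B \<le> (2::nat) ^ q"
        "400 * (real q + 1) \<le> real B ^ 3" "100 * q * (32 * q * B) \<le> 2 ^ q"
        using elim(4) unfolding q_def Let_def by blast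
      have lq: "log 2 (real n) \<le> real B ^ 3"
      proof -
        have "log 2 (real n) / 400 \<le> real q + 1" unfolding q_def by linarith
        hence "log 2 (real n) \<le> 400 * (real q + 1)" by simp
        thus ?thesis using B(6) by (rule order_trans)
      qed
      have wW: "real (w n) \<le> W * log 2 (real n)" using elim by simp
      show ?case unfolding mult_1
        by (intro allI impI ballI, rule rank_structure_at[where q = q and B = B and W = W]) (use B lq wW elim q_def in auto)
    qed
  qed
qed auto

end
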